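(* Let $(X,d)$ be a compact, path-connected, locally path-connected, semi-locally simply connected metric space with homotopy rectifiable paths, let $x_0\in X$, and let $\Gamma\curvearrowright X$ be a free action by homeomorphisms of a finitely generated group $\Gamma=\langle S\mid R\rangle$ ($S$ finite) such that $(X,\delta_S)$ is jumping-geodesic. Fix an integer $\theta\ge1$. Then for every $t$ large enough there is a short exact sequence $$1\to\langle\langle[\alpha_r] : r\in R_\theta\rangle\rangle_{\pi_{1,\theta}(X,\delta_S^t)}\to\pi_{1,\theta}\bigl((X,\delta_S^t),x_0\bigr)\to G_\theta\rtimes_{\bar\phi}\Gamma_\theta\to1,$$ where the first group is the normal closure in $\pi_{1,\theta}((X,\delta_S^t),x_0)$ of the images of the classes $[\alpha_r]\in\pi_1(X,x_0)$, $r\in R_\theta$.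
   Context: Warped metrics. $F_S$ is the free group on $S$, acting on $X$ through $\Gamma$. $\delta_S$ is the largest metric on $X$ with $\delta_S\le d$ and $\delta_S(x,s\cdot x)\le1$ for all $x\in X,s\in S$; for $t\ge1$, $\delta_S^t$ is defined in the same way from $d^t=t\cdot d$. A jumping-path is a sequence of continuous paths $\gamma_0,\dots,\gamma_n$ in $X$ and $\vec s_1,\dots,\vec s_n\in S\cup S^{-1}$ with $\gamma_i(0)=\vec s_i\gamma_{i-1}(1)$; its length is $n+\sum_i\|\gamma_i\|$ (lengths in $(X,d)$). $(X,\delta_S)$ is jumping-geodesic if $(X,d)$ is geodesic and any two points $x,y$ are joined by a jumping-path of length exactly $\delta_S(x,y)$. Homotopy rectifiable paths means every continuous path is homotopic (rel endpoints) to one of finite length. Discrete fundamental group. For a metric space $(Z,\rho)$ and $\theta>0$, a $\theta$-path is a sequence $(z_0,\dots,z_n)$ with $\rho(z_i,z_{i+1})\le\theta$. Lazifications are obtained by repeating values; a $\theta$-grid homotopy between $\theta$-paths of length $n$ with the same endpoints is a $\theta$-Lipschitz map $\{0,\dots,n\}\times\{0,\dots,m\}\to Z$ ($\ell^1$ metric on the source) restricting to the two paths on the bottom and top rows and constant on the left and right sides. $\pi_{1,\theta}(Z,z_0)$ is the group of closed $\theta$-paths based at $z_0$ modulo the equivalence relation generated by lazifications and $\theta$-grid homotopies, with concatenation. The map $\pi_1(X,x_0)\to\pi_{1,\theta}((X,\delta_S^t),x_0)$ sends $[\gamma]$ to the class of a sequence $(\gamma(t_0),\dots,\gamma(t_m))$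 with $0=t_0<\dots<t_m=1$ and $\gamma([t_{i-1},t_i])$ contained in the closed $d^t$-ball of radius $\theta$ about $\gamma(t_{i-1})$. Groups. Fix for $s\in S$ a path $\alpha_s$ from $x_0$ to $s x_0$; put $\alpha_{s^{-1}}=s^{-1}(\alpha_s^* )$ ($^*$ denotes reversal) and $\alpha_{\vec s_1\cdots\vec s_n}=\alpha_{\vec s_1}\vec s_1(\alpha_{\vec s_2})\cdots(\vec s_1\cdots\vec s_{n-1})(\alpha_{\vec s_n})$. Let $\phi_S\colon F_S\to\mathrm{Aut}(\pi_1(X,x_0))$, $\phi_S(w)[\gamma]=[\alpha_ww(\gamma)\alpha_w^*]$. Let $\langle\langle R\rangle\rangle$ be the normal closure of $R$ in $F_S$ (the kernel of $F_S\to\Gamma$), $R_\theta$ the set of elements of $\langle\langle R\rangle\rangle$ of word length at most $4\theta$, and $\Gamma_\theta=\langle S\mid R_\theta\rangle$. For $r\in\langle\langle R\rangle\rangle$ the path $\alpha_r$ is closed. Let $$G_\theta=\frac{\pi_1(X,x_0)}{\langle\langle\{[\alpha_r] : r\in\langle\langle R_\theta\rangle\rangle\}\cup\{[\alpha_r\gamma\alpha_r^*\gamma^{-1}] : [\gamma]\in\pi_1(X,x_0),\ r\in\langle\langle R_\theta\rangle\rangle\}\rangle\rangle}.$$ The action $\phi_S$ descends to a homomorphism $\bar\phi\colon\Gamma_\theta\to\mathrm{Aut}(G_\theta)$, which defines $G_\theta\rtimes_{\bar\phi}\Gamma_\theta$. *)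

theory Defs
  imports "HOL-Analysis.Analysis" "HOL-Algebra.Group_Action"
begin

section \<open>Groups\<close>

definition normal_closure :: "('a, 'b) monoid_scheme \<Rightarrow> 'a set \<Rightarrow> 'a set" where
  "normal_closure G A = \<Inter> {N. N \<lhd> G \<and> A \<subseteq> N}"

definition semidirect_product ::
  "('a, 'c) monoid_scheme \<Rightarrow> ('b, 'd) monoid_scheme \<Rightarrow> ('b \<Rightarrow> 'a \<Rightarrow> 'a) \<Rightarrow> ('a \<times> 'b) monoid" where
  "semidirect_product N H \<phi> =
     \<lparr>carrier = carrier N \<times> carrier H,
      mult = (\<lambda>(n, h) (n', h'). (n \<otimes>\<^bsub>N\<^esub> \<phi> h n', h \<otimes>\<^bsub>H\<^esub> h')),
      one = (\<one>\<^bsub>N\<^esub>, \<one>\<^bsub>H\<^esub>)\<rparr>"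

text \<open>Exactness of \<open>1 \<rightarrow> A \<rightarrow> B \<rightarrow> C \<rightarrow> 1\<close>; the library's
  \<open>short_exact_sequence\<close> requires the three groups to have the same element type.\<close>

definition short_exact ::
  "('a, 'd) monoid_scheme \<Rightarrow> ('a \<Rightarrow> 'b) \<Rightarrow> ('b, 'e) monoid_scheme \<Rightarrow> ('b \<Rightarrow> 'c)
    \<Rightarrow> ('c, 'f) monoid_scheme \<Rightarrow> bool" where
  "short_exact A f B g C \<longleftrightarrow>
     group A \<and> group B \<and> group C \<and> f \<in> mon A B \<and> g \<in> epi B C \<and> f ` carrier A = kernel B C g"


subsection \<open>Free groups and presentations\<close>

text \<open>The letter \<open>(s, True)\<close> stands for \<open>s\<close> and \<open>(s, False)\<close> for its formal inverse.
  Elements of the free group are the reduced words, so that word length is \<open>length\<close>.\<close>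

type_synonym 's letter = "'s \<times> bool"

definition inv_letter :: "'s letter \<Rightarrow> 's letter" where
  "inv_letter l = (fst l, \<not> snd l)"

definition reduced :: "'s letter list \<Rightarrow> bool" where
  "reduced w \<longleftrightarrow> successively (\<lambda>a b. b \<noteq> inv_letter a) w"

fun reduced_cons :: "'s letter \<Rightarrow> 's letter list \<Rightarrow> 's letter list" where
  "reduced_cons a [] = [a]"
| "reduced_cons a (b # w) = (if b = inv_letter a then w else a # b # w)"

definition normal_form :: "'s letter list \<Rightarrow> 's letter list" where
  "normal_form w = foldr reduced_cons w []"

definition free_group :: "'s set \<Rightarrow> 's letter list monoid" where
  "free_group S =
     \<lparr>carrier = {w \<in> lists (S \<times> UNIV). reduced w},
      mult = (\<lambda>u v. normal_form (u @ v)),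
      one = []\<rparr>"

lemma inv_letter_inv_letter [simp]: "inv_letter (inv_letter l) = l" by (simp add: inv_letter_def)

lemma reduced_Nil[simp]: "reduced []" by (simp add: reduced_def)
lemma reduced_Cons: "reduced (a # w) \<longleftrightarrow> (w = [] \<or> hd w \<noteq> inv_letter a) \<and> reduced w"
  by (cases w) (auto simp: reduced_def)

lemma reduced_cons_reduced: "reduced w \<Longrightarrow> reduced (reduced_cons a w)"
  by (cases w) (auto simp: reduced_Cons)

lemma reduced_cons_cancel: "reduced w \<Longrightarrow> reduced_cons a (reduced_cons (inv_letter a) w) = w"
  by (cases w) (auto simp: reduced_Cons hd_conv_nth neq_Nil_conv split: if_splits, metis inv_letter_inv_letter list.exhaust_sel reduced_cons.simps)

lemma reduced_cons_cancel': "reduced w \<Longrightarrow> reduced_cons (inv_letter a) (reduced_cons a w) = w"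
  using reduced_cons_cancel[of w "inv_letter a"] by simp

lemma foldr_reduced: "reduced z \<Longrightarrow> reduced (foldr reduced_cons w z)"
  by (induction w) (auto simp: reduced_cons_reduced)

lemma nf_reduced: "reduced (normal_form w)" by (simp add: normal_form_def foldr_reduced)

lemma nf_id: "reduced w \<Longrightarrow> normal_form w = w"
proof (induction w)
  case Nil then show ?case by (simp add: normal_form_def)
next
  case (Cons a w)
  then show ?case by (cases w) (auto simp: normal_form_def reduced_Cons)
qed

lemma foldr_rc: "reduced z \<Longrightarrow> foldr reduced_cons (reduced_cons l w) z = reduced_cons l (foldr reduced_cons w z)"
  by (cases w) (auto simp: reduced_cons_cancel foldr_reduced)

lemma foldr_nf: "reduced z \<Longrightarrow> foldr reduced_cons (normal_form w) z = foldr reduced_cons w z"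
  by (induction w) (auto simp: normal_form_def foldr_rc)

lemma nf_app: "normal_form (u @ v) = foldr reduced_cons u (normal_form v)"
  by (simp add: normal_form_def)

lemma nf_set: "set (normal_form w) \<subseteq> set w"
proof (induction w)
  case (Cons a w)
  have "set (reduced_cons a v) \<subseteq> insert a (set v)" for v by (cases v) auto
  then show ?case using Cons by (fastforce simp: normal_form_def)
qed (simp add: normal_form_def)

lemma foldr_inv: "reduced z \<Longrightarrow> foldr reduced_cons (rev (map inv_letter w)) (foldr reduced_cons w z) = z"
  by (induction w arbitrary: z) (auto simp: reduced_cons_cancel' foldr_reduced)

lemma group_free_group: "group (free_group S)"
proof (rule groupI)
  fix x y assume "x \<in> carrier (free_group S)" "y \<in> carrier (free_group S)"
  then show "x \<otimes>\<^bsub>free_group S\<^esub> y \<in> carrier (free_group S)"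
    using nf_set[of "x@y"] by (auto simp: free_group_def nf_reduced)
next
  fix x y z assume "x \<in> carrier (free_group S)" "y \<in> carrier (free_group S)" "z \<in> carrier (free_group S)"
  then show "x \<otimes>\<^bsub>free_group S\<^esub> y \<otimes>\<^bsub>free_group S\<^esub> z = x \<otimes>\<^bsub>free_group S\<^esub> (y \<otimes>\<^bsub>free_group S\<^esub> z)"
    apply (simp add: free_group_def nf_app foldr_nf nf_reduced nf_id foldr_reduced)
    by (metis foldr_append foldr_nf nf_app nf_id)
next
  fix x assume x: "x \<in> carrier (free_group S)"
  have "set (rev (map inv_letter x)) \<subseteq> S \<times> UNIV"
    using x by (auto simp: free_group_def inv_letter_def lists_eq_set)
  then have "set (normal_form (rev (map inv_letter x))) \<subseteq> S \<times> UNIV"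
    using nf_set order_trans by blast
  then have "normal_form (rev (map inv_letter x)) \<in> carrier (free_group S)"
    by (simp add: free_group_def nf_reduced lists_eq_set)
  moreover have "normal_form (normal_form (rev (map inv_letter x)) @ x) = []"
    using x foldr_inv[of "[]" x] by (simp add: nf_app foldr_nf foldr_reduced normal_form_def[of x])
  ultimately show "\<exists>y\<in>carrier (free_group S). y \<otimes>\<^bsub>free_group S\<^esub> x = \<one>\<^bsub>free_group S\<^esub>"
    by (auto simp: free_group_def)
qed (auto simp: free_group_def nf_id)

definition letter_val :: "('g, 'b) monoid_scheme \<Rightarrow> ('s \<Rightarrow> 'g) \<Rightarrow> 's letter \<Rightarrow> 'g" where
  "letter_val \<Gamma> \<eta> l = (if snd l then \<eta> (fst l) else inv\<^bsub>\<Gamma>\<^esub> (\<eta> (fst l)))"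

definition word_val :: "('g, 'b) monoid_scheme \<Rightarrow> ('s \<Rightarrow> 'g) \<Rightarrow> 's letter list \<Rightarrow> 'g" where
  "word_val \<Gamma> \<eta> w = foldr (\<lambda>l g. letter_val \<Gamma> \<eta> l \<otimes>\<^bsub>\<Gamma>\<^esub> g) w \<one>\<^bsub>\<Gamma>\<^esub>"

text \<open>\<open>\<Gamma> = \<langle>S | R\<rangle>\<close>, where \<open>\<eta>\<close> sends a generating symbol to the group element it denotes.
  It need not be injective.\<close>

definition presentation ::
  "('g, 'b) monoid_scheme \<Rightarrow> 's set \<Rightarrow> ('s \<Rightarrow> 'g) \<Rightarrow> 's letter list set \<Rightarrow> bool" where
  "presentation \<Gamma> S \<eta> R \<longleftrightarrow>
     group \<Gamma> \<and> \<eta> \<in> S \<rightarrow> carrier \<Gamma> \<and> R \<subseteq> carrier (free_group S) \<and>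
     word_val \<Gamma> \<eta> ` carrier (free_group S) = carrier \<Gamma> \<and>
     kernel (free_group S) \<Gamma> (word_val \<Gamma> \<eta>) = normal_closure (free_group S) R"

definition free_action ::
  "('g, 'b) monoid_scheme \<Rightarrow> ('s \<Rightarrow> 'g) \<Rightarrow> ('g \<Rightarrow> 'x \<Rightarrow> 'x) \<Rightarrow> 's letter list \<Rightarrow> 'x \<Rightarrow> 'x" where
  "free_action \<Gamma> \<eta> act w = act (word_val \<Gamma> \<eta> w)"

definition short_relators :: "'s set \<Rightarrow> 's letter list set \<Rightarrow> nat \<Rightarrow> 's letter list set" where
  "short_relators S R \<theta> = {r \<in> normal_closure (free_group S) R. length r \<le> 4 * \<theta>}"

definition Gamma_theta :: "'s set \<Rightarrow> 's letter list set \<Rightarrow> nat \<Rightarrow> 's letter list set monoid" where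
  "Gamma_theta S R \<theta> = free_group S Mod normal_closure (free_group S) (short_relators S R \<theta>)"


section \<open>Paths in a metric space\<close>

definition path_length :: "(real \<Rightarrow> 'a::metric_space) \<Rightarrow> ennreal" where
  "path_length p =
     (SUP ts \<in> {ts. sorted ts \<and> set ts \<subseteq> {0..1}}.
        \<Sum>i < length ts - 1. ennreal (dist (p (ts ! i)) (p (ts ! Suc i))))"

definition homotopy_rectifiable :: "'a::metric_space set \<Rightarrow> bool" where
  "homotopy_rectifiable X \<longleftrightarrow>
     (\<forall>p. path p \<and> path_image p \<subseteq> X \<longrightarrow> (\<exists>q. homotopic_paths X p q \<and> path_length q \<noteq> \<infinity>))"

definition semilocally_simply_connected :: "'a::topological_space set \<Rightarrow> bool" where
  "semilocally_simply_connected X \<longleftrightarrow>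
     (\<forall>x\<in>X. \<exists>U. openin (top_of_set X) U \<and> x \<in> U \<and>
        (\<forall>p. path p \<and> path_image p \<subseteq> U \<and> pathstart p = x \<and> pathfinish p = x
             \<longrightarrow> homotopic_paths X p (\<lambda>_. x)))"

definition geodesic_space :: "'a::metric_space set \<Rightarrow> bool" where
  "geodesic_space X \<longleftrightarrow>
     (\<forall>x\<in>X. \<forall>y\<in>X. \<exists>g. g ` {0..dist x y} \<subseteq> X \<and> g 0 = x \<and> g (dist x y) = y \<and>
        (\<forall>a\<in>{0..dist x y}. \<forall>b\<in>{0..dist x y}. dist (g a) (g b) = \<bar>a - b\<bar>))"


section \<open>Warped metrics\<close>

text \<open>From here on the space is a whole type \<open>'x\<close>, and \<open>\<rho> w\<close> is the homeomorphism by which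
  the word \<open>w\<close> acts on it.\<close>

definition warped_admissible ::
  "'s set \<Rightarrow> ('s letter list \<Rightarrow> 'x \<Rightarrow> 'x) \<Rightarrow> real \<Rightarrow> ('x::metric_space \<Rightarrow> 'x \<Rightarrow> real) \<Rightarrow> bool" where
  "warped_admissible S \<rho> t \<delta> \<longleftrightarrow>
     Metric_space UNIV \<delta> \<and> (\<forall>x y. \<delta> x y \<le> t * dist x y) \<and>
     (\<forall>x. \<forall>s\<in>S. \<delta> x (\<rho> [(s, True)] x) \<le> 1)"

definition warped_metric ::
  "'s set \<Rightarrow> ('s letter list \<Rightarrow> 'x \<Rightarrow> 'x) \<Rightarrow> real \<Rightarrow> 'x::metric_space \<Rightarrow> 'x \<Rightarrow> real" where
  "warped_metric S \<rho> t = (GREATEST \<delta>. warped_admissible S \<rho> t \<delta>)"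

text \<open>The largest admissible metric exists, so \<open>GREATEST\<close> really selects it.\<close>

lemma warped_admissible_warped_metric:
  fixes \<rho> :: "'s letter list \<Rightarrow> 'x::metric_space \<Rightarrow> 'x"
  assumes t: "0 < t"
  shows "warped_admissible S \<rho> t (warped_metric S \<rho> t)"
    and "\<And>\<delta>. warped_admissible S \<rho> t \<delta> \<Longrightarrow> \<delta> \<le> warped_metric S \<rho> t"
proof -
  let ?A = "{\<delta>. warped_admissible S \<rho> t \<delta>}"
  let ?m = "\<lambda>x y. Sup ((\<lambda>\<delta>. \<delta> x y) ` ?A)"
  let ?b = "\<lambda>x y::'x. min (t * dist x y) 1"
  have b: "warped_admissible S \<rho> t ?b"
  proof -
    have "Metric_space (UNIV::'x set) ?b"
    proof
      fix x y z :: 'x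
      have "t * dist x z \<le> t * dist x y + t * dist y z"
        using t by (simp add: dist_triangle distrib_left[symmetric])
      moreover have "0 \<le> t * dist x y" "0 \<le> t * dist y z" using t by auto
      ultimately show "?b x z \<le> ?b x y + ?b y z" by linarith
      show "?b x y = 0 \<longleftrightarrow> x = y" using t by (auto simp: min_def)
    qed (use t in \<open>auto simp: dist_commute\<close>)
    then show ?thesis by (auto simp: warped_admissible_def)
  qed
  have bdd: "bdd_above ((\<lambda>\<delta>. \<delta> x y) ` ?A)" for x y
    by (rule bdd_aboveI[of _ "t * dist x y"]) (auto simp: warped_admissible_def)
  have ne: "(\<lambda>\<delta>. \<delta> x y) ` ?A \<noteq> {}" for x y using b by blast
  have up: "\<delta> x y \<le> ?m x y" if "warped_admissible S \<rho> t \<delta>" for \<delta> x y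
    by (rule cSup_upper[OF _ bdd]) (use that in auto)
  have le: "?m x y \<le> c" if "\<And>\<delta>. warped_admissible S \<rho> t \<delta> \<Longrightarrow> \<delta> x y \<le> c" for x y c
    by (rule cSup_least[OF ne]) (use that in auto)
  have "Metric_space UNIV ?m"
  proof
    fix x y z :: 'x
    have "0 \<le> ?b x y" using t by auto
    also have "... \<le> ?m x y" by (rule up[OF b])
    finally show nn: "0 \<le> ?m x y" .
    have "(\<lambda>\<delta>. \<delta> x y) ` ?A = (\<lambda>\<delta>. \<delta> y x) ` ?A"
      by (rule image_cong) (auto simp: warped_admissible_def Metric_space_def)
    then show "?m x y = ?m y x" by simp
    show "?m x y = 0 \<longleftrightarrow> x = y"
    proof
      assume "?m x y = 0"
      then have "?b x y \<le> 0" using up[OF b, of x y] by simp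
      then show "x = y" using t by (auto simp: min_def mult_le_0_iff split: if_splits)
    next
      assume "x = y"
      then have "?m x y \<le> 0"
        by (intro le) (auto simp: warped_admissible_def dest: Metric_space.zero[THEN iffD2])
      with nn show "?m x y = 0" by simp
    qed
    show "?m x z \<le> ?m x y + ?m y z"
    proof (rule le)
      fix \<delta> assume a: "warped_admissible S \<rho> t \<delta>"
      then have "\<delta> x z \<le> \<delta> x y + \<delta> y z"
        by (auto simp: warped_admissible_def Metric_space_def)
      with up[OF a, of x y] up[OF a, of y z] show "\<delta> x z \<le> ?m x y + ?m y z" by linarith
    qed
  qed
  then have m: "warped_admissible S \<rho> t ?m"
    unfolding warped_admissible_def using le by (auto simp: warped_admissible_def)
  have eq: "warped_metric S \<rho> t = ?m"
    unfolding warped_metric_def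
    by (rule Greatest_equality[where P = "warped_admissible S \<rho> t", OF m]) (auto simp: le_fun_def intro: up)
  show "warped_admissible S \<rho> t (warped_metric S \<rho> t)" unfolding eq by (rule m)
  show "\<And>\<delta>. warped_admissible S \<rho> t \<delta> \<Longrightarrow> \<delta> \<le> warped_metric S \<rho> t"
    unfolding eq le_fun_def using up by auto
qed

definition jumping_path ::
  "'s set \<Rightarrow> ('s letter list \<Rightarrow> 'x::metric_space \<Rightarrow> 'x) \<Rightarrow> (real \<Rightarrow> 'x) list \<Rightarrow> 's letter list \<Rightarrow> bool" where
  "jumping_path S \<rho> ps ls \<longleftrightarrow>
     length ps = Suc (length ls) \<and> (\<forall>p\<in>set ps. path p) \<and> set ls \<subseteq> S \<times> UNIV \<and>
     (\<forall>i<length ls. pathstart (ps ! Suc i) = \<rho> [ls ! i] (pathfinish (ps ! i)))"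

definition jumping_length :: "(real \<Rightarrow> 'x::metric_space) list \<Rightarrow> 's letter list \<Rightarrow> ennreal" where
  "jumping_length ps ls = of_nat (length ls) + (\<Sum>p\<leftarrow>ps. path_length p)"

definition jumping_geodesic ::
  "'s set \<Rightarrow> ('s letter list \<Rightarrow> 'x::metric_space \<Rightarrow> 'x) \<Rightarrow> bool" where
  "jumping_geodesic S \<rho> \<longleftrightarrow>
     geodesic_space (UNIV :: 'x set) \<and>
     (\<forall>x y. \<exists>ps ls. jumping_path S \<rho> ps ls \<and> pathstart (hd ps) = x \<and> pathfinish (last ps) = y \<and>
        jumping_length ps ls = ennreal (warped_metric S \<rho> 1 x y))"


section \<open>Fundamental group\<close>

text \<open>Operations on equivalence classes are throughout defined as the union of the classes
  obtained from all representatives; when the operation is well defined on classes, this union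
  is the single class obtained from any one of them.\<close>

definition path_class :: "(real \<Rightarrow> 'x::topological_space) \<Rightarrow> (real \<Rightarrow> 'x) set" where
  "path_class p = {q. homotopic_paths UNIV p q}"

definition loops :: "'x::topological_space \<Rightarrow> (real \<Rightarrow> 'x) set" where
  "loops x0 = {p. path p \<and> pathstart p = x0 \<and> pathfinish p = x0}"

definition fundamental_group :: "'x::topological_space \<Rightarrow> (real \<Rightarrow> 'x) set monoid" where
  "fundamental_group x0 =
     \<lparr>carrier = path_class ` loops x0,
      mult = (\<lambda>A B. \<Union>p\<in>A. \<Union>q\<in>B. path_class (p +++ q)),
      one = path_class (\<lambda>_. x0)\<rparr>"


section \<open>Discrete fundamental group\<close>

text \<open>A path \<open>(z\<^sub>0, \<dots>, z\<^sub>n)\<close> is the nonempty list of its \<open>n + 1\<close> values.\<close>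

definition theta_path :: "('z \<Rightarrow> 'z \<Rightarrow> real) \<Rightarrow> real \<Rightarrow> 'z list \<Rightarrow> bool" where
  "theta_path d \<theta> zs \<longleftrightarrow> zs \<noteq> [] \<and> successively (\<lambda>x y. d x y \<le> \<theta>) zs"

definition theta_loops :: "('z \<Rightarrow> 'z \<Rightarrow> real) \<Rightarrow> real \<Rightarrow> 'z \<Rightarrow> 'z list set" where
  "theta_loops d \<theta> z0 = {zs. theta_path d \<theta> zs \<and> hd zs = z0 \<and> last zs = z0}"

definition lazification :: "'z list \<Rightarrow> 'z list \<Rightarrow> bool" where
  "lazification zs zs' \<longleftrightarrow>
     (\<exists>ks. length ks = length zs \<and> (\<forall>k\<in>set ks. 0 < k) \<and> zs' = concat (map2 replicate ks zs))"

definition grid_homotopic :: "('z \<Rightarrow> 'z \<Rightarrow> real) \<Rightarrow> real \<Rightarrow> 'z list \<Rightarrow> 'z list \<Rightarrow> bool" where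
  "grid_homotopic d \<theta> p q \<longleftrightarrow>
     (\<exists>n m H. length p = Suc n \<and> length q = Suc n \<and>
        (\<forall>i\<le>n. \<forall>j\<le>m. \<forall>i'\<le>n. \<forall>j'\<le>m.
           d (H i j) (H i' j') \<le> \<theta> * (\<bar>real i - real i'\<bar> + \<bar>real j - real j'\<bar>)) \<and>
        (\<forall>i\<le>n. H i 0 = p ! i \<and> H i m = q ! i) \<and>
        (\<forall>j\<le>m. H 0 j = H 0 0 \<and> H n j = H n 0))"

definition theta_equiv :: "('z \<Rightarrow> 'z \<Rightarrow> real) \<Rightarrow> real \<Rightarrow> 'z \<Rightarrow> 'z list \<Rightarrow> 'z list \<Rightarrow> bool" where
  "theta_equiv d \<theta> z0 =
     equivclp (\<lambda>p q. p \<in> theta_loops d \<theta> z0 \<and> q \<in> theta_loops d \<theta> z0 \<and>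
                     (lazification p q \<or> grid_homotopic d \<theta> p q))"

definition theta_class :: "('z \<Rightarrow> 'z \<Rightarrow> real) \<Rightarrow> real \<Rightarrow> 'z \<Rightarrow> 'z list \<Rightarrow> 'z list set" where
  "theta_class d \<theta> z0 p = {q. theta_equiv d \<theta> z0 p q}"

definition discrete_fundamental_group ::
  "('z \<Rightarrow> 'z \<Rightarrow> real) \<Rightarrow> real \<Rightarrow> 'z \<Rightarrow> 'z list set monoid" where
  "discrete_fundamental_group d \<theta> z0 =
     \<lparr>carrier = theta_class d \<theta> z0 ` theta_loops d \<theta> z0,
      mult = (\<lambda>A B. \<Union>p\<in>A. \<Union>q\<in>B. theta_class d \<theta> z0 (p @ tl q)),
      one = theta_class d \<theta> z0 [z0]\<rparr>"

text \<open>The subdivisions along which a path may be sampled, for the metric \<open>t * dist\<close>.\<close>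

definition sampling :: "real \<Rightarrow> real \<Rightarrow> (real \<Rightarrow> 'x::metric_space) \<Rightarrow> real list \<Rightarrow> bool" where
  "sampling t \<theta> p ts \<longleftrightarrow>
     2 \<le> length ts \<and> sorted_wrt (<) ts \<and> hd ts = 0 \<and> last ts = 1 \<and>
     (\<forall>i. Suc i < length ts \<longrightarrow> (\<forall>u\<in>{ts ! i .. ts ! Suc i}. t * dist (p (ts ! i)) (p u) \<le> \<theta>))"

definition discretize ::
  "'s set \<Rightarrow> ('s letter list \<Rightarrow> 'x::metric_space \<Rightarrow> 'x) \<Rightarrow> real \<Rightarrow> real \<Rightarrow> 'x
    \<Rightarrow> (real \<Rightarrow> 'x) set \<Rightarrow> 'x list set" where
  "discretize S \<rho> t \<theta> x0 C =
     (\<Union>p\<in>C. \<Union>ts\<in>Collect (sampling t \<theta> p). theta_class (warped_metric S \<rho> t) \<theta> x0 (map p ts))"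


section \<open>The action on the fundamental group and the group \<open>G\<^sub>\<theta>\<close>\<close>

definition letter_path ::
  "('s letter list \<Rightarrow> 'x \<Rightarrow> 'x) \<Rightarrow> ('s \<Rightarrow> real \<Rightarrow> 'x::topological_space) \<Rightarrow> 's letter \<Rightarrow> real \<Rightarrow> 'x" where
  "letter_path \<rho> \<alpha> l = (if snd l then \<alpha> (fst l) else \<rho> [l] \<circ> reversepath (\<alpha> (fst l)))"

text \<open>The trailing constant path contributed by the empty word does not change the homotopy
  class, and only homotopy classes are used.\<close>

fun word_path ::
  "('s letter list \<Rightarrow> 'x \<Rightarrow> 'x) \<Rightarrow> ('s \<Rightarrow> real \<Rightarrow> 'x::topological_space) \<Rightarrow> 'x
    \<Rightarrow> 's letter list \<Rightarrow> real \<Rightarrow> 'x" where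
  "word_path \<rho> \<alpha> x0 [] = (\<lambda>_. x0)"
| "word_path \<rho> \<alpha> x0 (l # w) = letter_path \<rho> \<alpha> l +++ (\<rho> [l] \<circ> word_path \<rho> \<alpha> x0 w)"

definition phi_S ::
  "('s letter list \<Rightarrow> 'x \<Rightarrow> 'x) \<Rightarrow> ('s \<Rightarrow> real \<Rightarrow> 'x::topological_space) \<Rightarrow> 'x
    \<Rightarrow> 's letter list \<Rightarrow> (real \<Rightarrow> 'x) set \<Rightarrow> (real \<Rightarrow> 'x) set" where
  "phi_S \<rho> \<alpha> x0 w C =
     (\<Union>p\<in>C. path_class (word_path \<rho> \<alpha> x0 w +++ (\<rho> w \<circ> p) +++ reversepath (word_path \<rho> \<alpha> x0 w)))"

definition G_theta ::
  "'s set \<Rightarrow> 's letter list set \<Rightarrow> ('s letter list \<Rightarrow> 'x \<Rightarrow> 'x)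
    \<Rightarrow> ('s \<Rightarrow> real \<Rightarrow> 'x::topological_space) \<Rightarrow> 'x \<Rightarrow> nat \<Rightarrow> (real \<Rightarrow> 'x) set set monoid" where
  "G_theta S R \<rho> \<alpha> x0 \<theta> =
     (let N = normal_closure (free_group S) (short_relators S R \<theta>); a = word_path \<rho> \<alpha> x0
      in fundamental_group x0 Mod
           normal_closure (fundamental_group x0)
             ({path_class (a r) | r. r \<in> N} \<union>
              {path_class (a r +++ p +++ reversepath (a r) +++ reversepath p) | r p.
                 r \<in> N \<and> p \<in> loops x0}))"

text \<open>The elements of \<open>\<Gamma>\<^sub>\<theta>\<close> and \<open>G\<^sub>\<theta>\<close> are cosets; the set of all \<open>\<phi>\<^sub>S(w)(a)\<close> with \<open>w\<close> and \<open>a\<close> in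
  given cosets is the coset of any one of them.\<close>

definition phi_bar ::
  "('s letter list \<Rightarrow> 'x \<Rightarrow> 'x) \<Rightarrow> ('s \<Rightarrow> real \<Rightarrow> 'x::topological_space) \<Rightarrow> 'x
    \<Rightarrow> 's letter list set \<Rightarrow> (real \<Rightarrow> 'x) set set \<Rightarrow> (real \<Rightarrow> 'x) set set" where
  "phi_bar \<rho> \<alpha> x0 W A = {phi_S \<rho> \<alpha> x0 w a | w a. w \<in> W \<and> a \<in> A}"

end

theory Submission
  imports Defs
begin

text \<open>For large \<open>t\<close> an edge of length at most \<open>\<theta>\<close> in the warped metric is a chain of at most \<open>\<theta>\<close> jumps and
  short geodesics, and jumps slide past paths, so every discrete loop is a sampled path \<open>c\<close> from \<open>x\<^sub>0\<close> to
  \<open>w x\<^sub>0\<close> followed by the jumps along \<open>w\<^sup>-\<^sup>1\<close>.  The pairs \<open>(c, w)\<close> up to homotopy form the semidirect product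
  of the fundamental group with the free group.  An elementary discrete homotopy is a quadrilateral with at
  most \<open>4\<theta>\<close> jumps; its corners move so little that, by freeness, its word is a relator of length at most
  \<open>4\<theta>\<close>, and its path part is a small loop, hence null-homotopic.  So the pair \<open>(c, w)\<close> is well defined modulo
  the loops that consist only of the jumps along a short relator \<open>r\<close>, and these become trivial once \<open>[\<alpha>\<^sub>r]\<close> and \<open>r\<close> are
  killed, which is what passing to the right-hand group does.\<close>

section \<open>Group-theoretic preliminaries\<close>

text \<open>A label for an edge has to be extracted from a chain of jumps that is far from unique;
  only its path class and its word modulo relators are stable. What is proved about these choices is
  a single statement, that the two routes around a quadrilateral have equal products; a
  quadrilateral with constant sides then gives independence of the choice. Two counts meet in
  4\<theta>: the four sides of a quadrilateral carry at most \<theta> jumps each, and conversely the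
  closed list of jumps of a relator with at most 4\<theta> letters is grouped into four edges of
  length at most \<theta>, hence contracts. The radius in which labels are stable comes from
  compactness, before t is chosen; t has only to make the continuous part of a chain of cost near
  \<theta> short enough for that radius. The kernel is computed from generators: every class is the
  discretization of a loop times the class \<open>U w\<close> of \<alpha>_w followed by jumps. Both
  factors are homomorphic in their argument and agree on relators, so normal closures are carried
  into normal closures.\<close>

lemma normal_carrier: "group G \<Longrightarrow> carrier G \<lhd> G"
  by (simp add: group.normal_inv_iff group.subgroup_self monoid.m_closed group.is_monoid)

lemma normal_closure_normal:
  assumes "group G" "A \<subseteq> carrier G"
  shows "normal_closure G A \<lhd> G"
proof -
  \<comment> \<open>The family to be intersected is non-empty; the intersection of the empty family
    would be the whole type.\<close>
  have c: "carrier G \<in> {N. N \<lhd> G \<and> A \<subseteq> N}" using assms normal_carrier by auto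
  have "subgroup (\<Inter> {N. N \<lhd> G \<and> A \<subseteq> N}) G"
    by (rule group.subgroups_Inter[OF assms(1)]) (use c in \<open>auto intro: normal_imp_subgroup\<close>)
  then show ?thesis
    unfolding normal_closure_def
    by (subst group.normal_inv_iff[OF assms(1)]) (auto intro: normal.inv_op_closed2)
qed

lemma normal_closure_subset: "A \<subseteq> normal_closure G A"
  by (auto simp: normal_closure_def)

lemma normal_closure_least: "N \<lhd> G \<Longrightarrow> A \<subseteq> N \<Longrightarrow> normal_closure G A \<subseteq> N"
  by (auto simp: normal_closure_def)

text \<open>Serves to show that a homomorphism carries a normal closure into a normal subgroup: the
  preimage is normal, so only the generators have to be checked.\<close>

lemma hom_vimage_normal:
  assumes "group G" "group H" "h \<in> hom G H" "N \<lhd> H"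
  shows "{x \<in> carrier G. h x \<in> N} \<lhd> G"
proof -
  interpret group_hom G H h using assms by (simp add: group_hom_def group_hom_axioms_def)
  interpret N: normal N H by fact
  show ?thesis
  proof (subst G.normal_inv_iff, intro conjI ballI)
    show "subgroup {x \<in> carrier G. h x \<in> N} G"
      by (rule G.subgroupI) (auto intro: exI[of _ "\<one>\<^bsub>G\<^esub>"])
  qed (auto intro: N.inv_op_closed2)
qed

lemma (in group) inv_cancel:
  assumes "x \<in> carrier G" "y \<in> carrier G"
  shows "inv x \<otimes> (x \<otimes> y) = y" "x \<otimes> (inv x \<otimes> y) = y"
  using assms by (simp_all flip: m_assoc)

lemma (in normal) rcos_eq_iff:
  assumes "x \<in> carrier G" "y \<in> carrier G"
  shows "H #> x = H #> y \<longleftrightarrow> x \<otimes> inv y \<in> H"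
proof
  assume "H #> x = H #> y"
  then have "x \<in> H #> y" using rcos_self[OF assms(1) subgroup_axioms] by simp
  then obtain h where h: "h \<in> H" "x = h \<otimes> y" by (auto simp: r_coset_def)
  then show "x \<otimes> inv y \<in> H" using assms by (simp add: m_assoc)
next
  assume "x \<otimes> inv y \<in> H"
  moreover have "x = (x \<otimes> inv y) \<otimes> y" using assms by (simp add: m_assoc)
  ultimately have "x \<in> H #> y" using assms by (auto simp: r_coset_def)
  then show "H #> x = H #> y" using repr_independence[OF _ assms(2) subgroup_axioms] by simp
qed

lemma semidirect_product_simps [simp]:
  "carrier (semidirect_product N H f) = carrier N \<times> carrier H"
  "(n, h) \<otimes>\<^bsub>semidirect_product N H f\<^esub> (n', h') = (n \<otimes>\<^bsub>N\<^esub> f h n', h \<otimes>\<^bsub>H\<^esub> h')"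
  "\<one>\<^bsub>semidirect_product N H f\<^esub> = (\<one>\<^bsub>N\<^esub>, \<one>\<^bsub>H\<^esub>)"
  by (simp_all add: semidirect_product_def)

lemma group_semidirect_product:
  assumes "group N" "group H"
    and hom: "\<And>h. h \<in> carrier H \<Longrightarrow> f h \<in> hom N N"
    and one: "\<And>n. n \<in> carrier N \<Longrightarrow> f \<one>\<^bsub>H\<^esub> n = n"
    and mult: "\<And>h h' n. h \<in> carrier H \<Longrightarrow> h' \<in> carrier H \<Longrightarrow> n \<in> carrier N
                 \<Longrightarrow> f (h \<otimes>\<^bsub>H\<^esub> h') n = f h (f h' n)"
  shows "group (semidirect_product N H f)"
proof -
  interpret N: group N by fact
  interpret H: group H by fact
  have cl: "f h n \<in> carrier N" if "h \<in> carrier H" "n \<in> carrier N" for h n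
    using hom[OF that(1)] that(2) by (rule hom_in_carrier)
  show ?thesis
  proof (rule groupI)
    fix x assume "x \<in> carrier (semidirect_product N H f)"
    then obtain n h where x: "x = (n, h)" "n \<in> carrier N" "h \<in> carrier H" by auto
    \<comment> \<open>The left inverse of (n, h) is (f (h^-1) (n^-1), h^-1): multiplying by (n, h)
      gives f (h^-1) (n^-1 n) in the first component.\<close>
    have "(f (inv\<^bsub>H\<^esub> h) (inv\<^bsub>N\<^esub> n), inv\<^bsub>H\<^esub> h) \<otimes>\<^bsub>semidirect_product N H f\<^esub> x = (\<one>\<^bsub>N\<^esub>, \<one>\<^bsub>H\<^esub>)"
      using x hom_mult[OF hom, of "inv\<^bsub>H\<^esub> h" "inv\<^bsub>N\<^esub> n" n] hom_one[OF hom \<open>group N\<close> \<open>group N\<close>]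
      by simp
    then show "\<exists>y\<in>carrier (semidirect_product N H f).
        y \<otimes>\<^bsub>semidirect_product N H f\<^esub> x = \<one>\<^bsub>semidirect_product N H f\<^esub>"
      using x cl by (intro bexI[of _ "(f (inv\<^bsub>H\<^esub> h) (inv\<^bsub>N\<^esub> n), inv\<^bsub>H\<^esub> h)"]) auto
  qed (auto simp: cl one mult N.m_assoc H.m_assoc hom_mult[OF hom])
qed

section \<open>Words and free groups\<close>

definition inv_word :: "'s letter list \<Rightarrow> 's letter list" where
  "inv_word w = rev (map inv_letter w)"

lemma inv_word_simps [simp]:
  "inv_word [] = []" "inv_word (l # w) = inv_word w @ [inv_letter l]"
  "inv_word (u @ v) = inv_word v @ inv_word u" "inv_word (inv_word w) = w"
  "length (inv_word w) = length w"
  by (simp_all add: inv_word_def rev_map[symmetric] o_def map_idI)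

lemma inv_letter_in_words [simp]: "inv_letter l \<in> S \<times> UNIV \<longleftrightarrow> l \<in> S \<times> UNIV"
  by (cases l) (auto simp: inv_letter_def)

lemma inv_word_in_lists [simp]: "inv_word w \<in> lists (S \<times> UNIV) \<longleftrightarrow> w \<in> lists (S \<times> UNIV)"
  by (induction w) (auto simp: inv_letter_def)

lemma normal_form_in_lists: "w \<in> lists A \<Longrightarrow> normal_form w \<in> lists A"
  using nf_set[of w] by (auto simp: lists_eq_set)

lemma length_normal_form: "length (normal_form w) \<le> length w"
proof (induction w)
  case (Cons a w)
  have "length (reduced_cons a v) \<le> Suc (length v)" for v by (cases v) auto
  from this[of "normal_form w"] Cons show ?case by (simp add: normal_form_def)
qed (simp add: normal_form_def)

lemma normal_form_Nil [simp]: "normal_form [] = []"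
  by (simp add: normal_form_def)

lemma normal_form_append_normal_form:
  "normal_form (normal_form u @ v) = normal_form (u @ v)"
  "normal_form (u @ normal_form v) = normal_form (u @ v)"
  by (simp_all add: nf_app foldr_nf nf_reduced nf_id)

lemma normal_form_inv_word:
  "normal_form (w @ inv_word w) = []" "normal_form (inv_word w @ w) = []"
proof -
  show *: "normal_form (inv_word w @ w) = []" for w :: "'a letter list"
    using foldr_inv[of "[]" w] by (simp add: normal_form_def inv_word_def)
  from *[of "inv_word w"] show "normal_form (w @ inv_word w) = []" by simp
qed

text \<open>Reduction to normal form only deletes adjacent pairs of mutually inverse letters.\<close>

lemma normal_form_invariant:
  assumes "w \<in> lists A" and "\<And>l. l \<in> A \<Longrightarrow> inv_letter l \<in> A"
    and refl: "\<And>w. w \<in> lists A \<Longrightarrow> E w w"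
    and trans: "\<And>u v w. E u v \<Longrightarrow> E v w \<Longrightarrow> E u w"
    and cons: "\<And>l u v. l \<in> A \<Longrightarrow> u \<in> lists A \<Longrightarrow> v \<in> lists A \<Longrightarrow> E u v \<Longrightarrow> E (l # u) (l # v)"
    and cancel: "\<And>l v. l \<in> A \<Longrightarrow> v \<in> lists A \<Longrightarrow> E (l # inv_letter l # v) v"
  shows "E w (normal_form w)"
  using assms(1)
proof (induction w)
  case (Cons l w)
  have nf: "normal_form w \<in> lists A" using Cons by (intro normal_form_in_lists) auto
  have "E (l # normal_form w) (l # normal_form w)" using Cons nf by (intro refl) auto
  \<comment> \<open>The new head letter is either kept, which is the reflexive case, or cancels
    against the head of the normal form.\<close>
  then have "E (l # normal_form w) (reduced_cons l (normal_form w))"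
    using Cons nf by (cases "normal_form w") (auto intro: cancel)
  with cons[OF _ _ nf Cons.IH, of l] Cons.hyps show ?case
    by (auto simp: normal_form_def intro: trans)
qed (simp add: refl)

lemma carrier_free_group: "w \<in> carrier (free_group S) \<longleftrightarrow> w \<in> lists (S \<times> UNIV) \<and> reduced w"
  by (auto simp: free_group_def)

lemma normal_form_in_carrier: "w \<in> lists (S \<times> UNIV) \<Longrightarrow> normal_form w \<in> carrier (free_group S)"
  by (simp add: carrier_free_group nf_reduced normal_form_in_lists)

lemma free_group_simps:
  "u \<otimes>\<^bsub>free_group S\<^esub> v = normal_form (u @ v)" "\<one>\<^bsub>free_group S\<^esub> = []"
  by (simp_all add: free_group_def)

lemma inv_free_group:
  assumes "w \<in> carrier (free_group S)"
  shows "inv\<^bsub>free_group S\<^esub> w = normal_form (inv_word w)"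
proof -
  interpret group "free_group S" by (rule group_free_group)
  show ?thesis
  proof (rule inv_equality)
    show "normal_form (inv_word w) \<in> carrier (free_group S)"
      using assms by (intro normal_form_in_carrier) (simp add: carrier_free_group)
  qed (simp_all add: assms free_group_simps normal_form_append_normal_form normal_form_inv_word)
qed

section \<open>Discrete homotopy\<close>

text \<open>The moves are local and ask nothing of the rest of the list, neither that it is a
  \<theta>-path nor that it is closed; so the relation is a congruence for concatenation and pieces
  can be treated separately. A flip bounds only the four sides of the quadrilateral: the distance
  from b to c may reach 2\<theta>.\<close>

inductive theta_homotopic :: "('z \<Rightarrow> 'z \<Rightarrow> real) \<Rightarrow> real \<Rightarrow> 'z list \<Rightarrow> 'z list \<Rightarrow> bool"
  for d :: "'z \<Rightarrow> 'z \<Rightarrow> real" and \<theta> :: real where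
  homotopic_refl: "theta_homotopic d \<theta> xs xs"
| homotopic_sym: "theta_homotopic d \<theta> xs ys \<Longrightarrow> theta_homotopic d \<theta> ys xs"
| homotopic_trans: "theta_homotopic d \<theta> xs ys \<Longrightarrow> theta_homotopic d \<theta> ys zs \<Longrightarrow> theta_homotopic d \<theta> xs zs"
| homotopic_dup: "theta_homotopic d \<theta> (us @ [a] @ vs) (us @ [a, a] @ vs)"
| homotopic_square: "d a b \<le> \<theta> \<Longrightarrow> d b e \<le> \<theta> \<Longrightarrow> d a c \<le> \<theta> \<Longrightarrow> d c e \<le> \<theta>
    \<Longrightarrow> theta_homotopic d \<theta> (us @ [a, b, e] @ vs) (us @ [a, c, e] @ vs)"

fun list_length :: "('z \<Rightarrow> 'z \<Rightarrow> real) \<Rightarrow> 'z list \<Rightarrow> real" where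
  "list_length d (x # y # zs) = d x y + list_length d (y # zs)"
| "list_length d _ = 0"

section \<open>Calculus of lists up to elementary moves\<close>

locale theta_space =
  fixes d :: "'z \<Rightarrow> 'z \<Rightarrow> real" and \<theta> :: real
  assumes metric: "Metric_space UNIV d" and theta_nonneg: "0 \<le> \<theta>"
begin

abbreviation heq (infix "\<simeq>" 50) where "xs \<simeq> ys \<equiv> theta_homotopic d \<theta> xs ys"

lemma heq_trans [trans]: "xs \<simeq> ys \<Longrightarrow> ys \<simeq> zs \<Longrightarrow> xs \<simeq> zs"
  by (rule theta_homotopic.homotopic_trans)

lemmas heq_refl [simp] = theta_homotopic.homotopic_refl[of d \<theta>]

lemma heq_sym: "xs \<simeq> ys \<Longrightarrow> ys \<simeq> xs"
  by (rule theta_homotopic.homotopic_sym)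

lemma d_self [simp]: "d x x = 0" and d_nonneg [simp]: "0 \<le> d x y"
  and d_commute: "d x y = d y x" and d_triangle: "d x z \<le> d x y + d y z"
  using metric unfolding Metric_space_def by auto

lemma heq_context:
  assumes "xs \<simeq> ys"
  shows "us @ xs @ vs \<simeq> us @ ys @ vs"
  using assms
proof induction
  case (homotopic_dup ps a qs)
  show ?case using theta_homotopic.homotopic_dup[of d \<theta> "us @ ps" a "qs @ vs"] by simp
next
  case (homotopic_square a b e c ps qs)
  show ?case using theta_homotopic.homotopic_square[OF homotopic_square, of "us @ ps" "qs @ vs"] by simp
qed (auto intro: heq_sym heq_trans)

lemma heq_Cons: "xs \<simeq> ys \<Longrightarrow> x # xs \<simeq> x # ys"
  using heq_context[of xs ys "[x]" "[]"] by simp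

lemma heq_append1: "xs \<simeq> ys \<Longrightarrow> xs @ vs \<simeq> ys @ vs"
  using heq_context[of xs ys "[]" vs] by simp

lemma heq_append2: "xs \<simeq> ys \<Longrightarrow> us @ xs \<simeq> us @ ys"
  using heq_context[of xs ys us "[]"] by simp

lemma heq_dup_Cons: "x # xs \<simeq> x # x # xs"
  using theta_homotopic.homotopic_dup[of d \<theta> "[]" x xs] by simp

lemma heq_square_Cons:
  "d a b \<le> \<theta> \<Longrightarrow> d b e \<le> \<theta> \<Longrightarrow> d a c \<le> \<theta> \<Longrightarrow> d c e \<le> \<theta> \<Longrightarrow> a # b # e # vs \<simeq> a # c # e # vs"
  using theta_homotopic.homotopic_square[of d a b \<theta> e c "[]" vs] by simp

abbreviation "tpath \<equiv> theta_path d \<theta>"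

lemma theta_path_simps [simp]:
  "\<not> tpath []" "tpath [x]"
  "tpath (x # y # zs) \<longleftrightarrow> d x y \<le> \<theta> \<and> tpath (y # zs)"
  by (auto simp: theta_path_def)

lemma theta_path_append:
  "xs \<noteq> [] \<Longrightarrow> ys \<noteq> [] \<Longrightarrow> tpath (xs @ ys) \<longleftrightarrow>
     tpath xs \<and> tpath ys \<and> d (last xs) (hd ys) \<le> \<theta>"
  by (auto simp: theta_path_def successively_append_iff)

lemma theta_path_join:
  assumes "xs \<noteq> []" "ys \<noteq> []" "last xs = hd ys"
  shows "tpath (xs @ tl ys) \<longleftrightarrow> tpath xs \<and> tpath ys"
  using assms by (cases ys; cases "tl ys") (auto simp: theta_path_append)

lemma theta_path_rev: "tpath (rev xs) \<longleftrightarrow> tpath xs"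
  by (simp add: theta_path_def d_commute)

text \<open>Each move keeps the end points and the \<theta>-path property. Equalities, in place of
  implications, make the induction hypothesis symmetric, as the case of an inverted move
  requires.\<close>

lemma heq_imp:
  assumes "xs \<simeq> ys"
  shows "tpath xs = tpath ys \<and> (xs = [] \<longleftrightarrow> ys = []) \<and> hd xs = hd ys \<and> last xs = last ys"
  using assms
proof induction
  case (homotopic_dup us a vs)
  show ?case using theta_nonneg
    by (cases "us = []"; cases "vs = []") (auto simp: theta_path_def successively_append_iff successively_Cons)
next
  case (homotopic_square a b e c us vs)
  then show ?case
    by (cases "us = []"; cases "vs = []") (auto simp: theta_path_def successively_append_iff successively_Cons)
qed auto

lemma heq_join:
  assumes "xs \<simeq> xs'" "ys \<simeq> ys'" "xs \<noteq> []" "ys \<noteq> []" "last xs = hd ys"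
  shows "xs @ tl ys \<simeq> xs' @ tl ys'"
proof -
  \<comment> \<open>The shared vertex is dropped from the second list by \<open>tl\<close>. Dropping
    it from the end of the first list instead leaves the second list whole, so that its homotopy can
    be applied.\<close>
  have 1: "zs @ tl ws = butlast zs @ ws" if "zs \<noteq> []" "ws \<noteq> []" "last zs = hd ws" for zs ws :: "'z list"
    using that by (cases ws; cases zs rule: rev_cases) auto
  have "xs' \<noteq> []" "ys' \<noteq> []" "last xs' = hd ys'" using heq_imp assms by metis+
  have "xs @ tl ys \<simeq> xs' @ tl ys" by (rule heq_append1) fact
  also have "xs' @ tl ys = butlast xs' @ ys" using heq_imp[OF assms(1)] assms 1 by auto
  also have "\<dots> \<simeq> butlast xs' @ ys'" by (rule heq_append2) fact
  also have "\<dots> = xs' @ tl ys'" using heq_imp[OF assms(1)] heq_imp[OF assms(2)] assms 1 by auto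
  finally show ?thesis .
qed

text \<open>The squares of the ladder are crossed one at a time from the far end: along
  \<open>xs\<close> and down the last rung becomes down the first rung and along \<open>ys\<close>.
  The end rungs are kept, so the two sides may have different ends; sliding a path past a jump
  relies on this.\<close>

lemma ladder:
  assumes "list_all2 (\<lambda>x y. d x y \<le> \<theta>) xs ys" "tpath xs" "tpath ys"
  shows "xs @ [last ys] \<simeq> hd xs # ys"
  using assms
proof (induction xs ys rule: list_all2_induct)
  case (Cons x xs y ys)
  show ?case
  proof (cases xs)
    case Nil
    with Cons show ?thesis by simp
  next
    case xs: (Cons x' xs')
    with Cons.hyps obtain y' ys' where ys: "ys = y' # ys'" by (cases ys) auto
    have "x # xs @ [last ys] \<simeq> x # x' # y' # ys'"
      using Cons xs ys by (intro heq_Cons) auto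
    also have "\<dots> \<simeq> x # y # y' # ys'"
      using Cons xs ys by (intro heq_square_Cons) auto
    finally show ?thesis using xs ys by simp
  qed
qed simp

lemma ladder_closed:
  assumes "list_all2 (\<lambda>x y. d x y \<le> \<theta>) xs ys" "tpath xs" "tpath ys"
    and "hd xs = hd ys" "last xs = last ys"
  shows "xs \<simeq> ys"
proof -
  from assms have ne: "xs \<noteq> []" "ys \<noteq> []" by auto
  have "xs \<simeq> xs @ [last ys]"
    using theta_homotopic.homotopic_dup[of d \<theta> "butlast xs" "last xs" "[]"] ne assms(5)
    by (metis append.assoc append.right_neutral append_Cons append_Nil append_butlast_last_id)
  also have "\<dots> \<simeq> hd xs # ys" by (rule ladder) fact+
  also have "\<dots> \<simeq> ys" using heq_sym[OF heq_dup_Cons[of "hd ys" "tl ys"]] ne assms(4) by simp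
  finally show ?thesis .
qed

lemma backtrack: "tpath xs \<Longrightarrow> xs @ tl (rev xs) \<simeq> [hd xs]"
proof (induction xs)
  case (Cons x xs)
  show ?case
  proof (cases xs)
    case Nil
    then show ?thesis by simp
  next
    case xs: (Cons y ys)
    have "(x # xs) @ tl (rev (x # xs)) = x # (xs @ tl (rev xs)) @ [x]"
      using xs by (cases "rev xs") auto
    also have "\<dots> \<simeq> [x, y, x]" using Cons xs heq_context[of "xs @ tl (rev xs)" "[y]" "[x]" "[x]"] by simp
    \<comment> \<open>A degenerate quadrilateral: y is flipped to x itself.\<close>
    also have "\<dots> \<simeq> [x, x, x]"
      using Cons.prems xs theta_nonneg by (intro heq_square_Cons) (auto simp: d_commute)
    also have "\<dots> \<simeq> [x, x]" by (rule heq_sym[OF heq_dup_Cons])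
    also have "\<dots> \<simeq> [x]" by (rule heq_sym[OF heq_dup_Cons])
    finally show ?thesis by simp
  qed
qed simp

lemma heq_spur: "d x y \<le> \<theta> \<Longrightarrow> us @ [x, y, x] @ vs \<simeq> us @ [x] @ vs"
  using heq_context[OF backtrack[of "[x, y]"]] by simp

subsection \<open>Agreement with grid homotopies and lazifications\<close>

lemma theta_path_dist:
  assumes "tpath xs" "i \<le> j" "j < length xs"
  shows "d (xs ! i) (xs ! j) \<le> \<theta> * (real j - real i)"
  using assms(2,3)
proof (induction j rule: dec_induct)
  case (step j)
  have "d (xs ! j) (xs ! Suc j) \<le> \<theta>"
    using assms(1) step by (auto simp: theta_path_def successively_conv_nth)
  with step d_triangle[of "xs ! i" "xs ! Suc j" "xs ! j"] show ?case
    by (simp add: algebra_simps)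
qed simp

lemma theta_path_dist':
  assumes "tpath xs" "i < length xs" "j < length xs"
  shows "d (xs ! i) (xs ! j) \<le> \<theta> * \<bar>real i - real j\<bar>"
proof (cases "i \<le> j")
  case True
  then show ?thesis using theta_path_dist[OF assms(1) True assms(3)] by (simp add: abs_if)
next
  case False
  then show ?thesis using theta_path_dist[OF assms(1) _ assms(2), of j] by (simp add: d_commute abs_if)
qed

text \<open>A ladder with common ends is a grid of height one. The Lipschitz bound between vertices
  of different rows comes from going along one row and then across a rung.\<close>

lemma grid_homotopicI:
  assumes l: "list_all2 (\<lambda>x y. d x y \<le> \<theta>) xs ys" and p: "tpath xs" "tpath ys"
    and e: "hd xs = hd ys" "last xs = last ys"
  shows "grid_homotopic d \<theta> xs ys"
proof -
  define H where "H i j = (if j = 0 then xs ! i else ys ! i)" for i and j :: nat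
  from p have ne: "xs \<noteq> []" "ys \<noteq> []" by auto
  define n where "n = length xs - 1"
  have len: "length xs = Suc n" "length ys = Suc n"
    using ne list_all2_lengthD[OF l] by (auto simp: n_def)
  have v: "d (xs ! i) (ys ! i) \<le> \<theta>" if "i \<le> n" for i
    using list_all2_nthD[OF l, of i] that len by simp
  have diag: "d (xs ! i) (ys ! i') \<le> \<theta> * (\<bar>real i - real i'\<bar> + 1)" if "i \<le> n" "i' \<le> n" for i i'
    using theta_path_dist'[OF p(1), of i i'] v[OF that(2)] d_triangle[of "xs ! i" "ys ! i'" "xs ! i'"] that len
    by (simp add: algebra_simps)
  have "d (H i j) (H i' j') \<le> \<theta> * (\<bar>real i - real i'\<bar> + \<bar>real j - real j'\<bar>)"
    if "i \<le> n" "j \<le> 1" "i' \<le> n" "j' \<le> 1" for i j i' j'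
  proof -
    have "j = 0 \<or> j = 1" "j' = 0 \<or> j' = 1" using that by auto
    then show ?thesis
      using theta_path_dist'[OF p(1), of i i'] theta_path_dist'[OF p(2), of i i']
        diag[of i i'] diag[of i' i] that len
      by (auto simp: H_def d_commute abs_minus_commute)
  qed
  moreover have "xs ! 0 = ys ! 0" "xs ! n = ys ! n"
    using e ne len by (simp_all add: hd_conv_nth last_conv_nth)
  ultimately show ?thesis unfolding grid_homotopic_def
    by (intro exI[of _ n] exI[of _ 1] exI[of _ H]) (auto simp: len H_def)
qed

text \<open>Consecutive rows of a grid are the sides of a ladder with common ends, so the rows are
  homotopic one after the other.\<close>

lemma heq_grid_homotopic:
  assumes "grid_homotopic d \<theta> p q"
  shows "p \<simeq> q"
proof -
  obtain n m H where len: "length p = Suc n" "length q = Suc n"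
    and lip': "\<forall>i\<le>n. \<forall>j\<le>m. \<forall>i'\<le>n. \<forall>j'\<le>m.
        d (H i j) (H i' j') \<le> \<theta> * (\<bar>real i - real i'\<bar> + \<bar>real j - real j'\<bar>)"
    and rows': "\<forall>i\<le>n. H i 0 = p ! i \<and> H i m = q ! i"
    and sides': "\<forall>j\<le>m. H 0 j = H 0 0 \<and> H n j = H n 0"
    using assms unfolding grid_homotopic_def by (elim exE conjE) (rule that)
  note lip = lip'[rule_format] and rows = rows'[rule_format] and sides = sides'[rule_format]
  let ?row = "\<lambda>j. map (\<lambda>i. H i j) [0..<Suc n]"
  have tp: "tpath (?row j)" if "j \<le> m" for j
    unfolding theta_path_def successively_conv_nth
  proof (intro conjI allI impI)
    fix i assume "Suc i < length (?row j)"
    then have i: "i \<le> n" "Suc i \<le> n" by auto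
    then have "d (H i j) (H (Suc i) j) \<le> \<theta>" using lip[of i j "Suc i" j] that by simp
    with i show "d (?row j ! i) (?row j ! Suc i) \<le> \<theta>" by (simp del: upt_Suc)
  qed simp
  have "?row 0 \<simeq> ?row j" if "j \<le> m" for j
    using that
  proof (induction j)
    case (Suc j)
    then have "?row 0 \<simeq> ?row j" by simp
    also have "\<dots> \<simeq> ?row (Suc j)"
    proof (rule ladder_closed)
      show "list_all2 (\<lambda>x y. d x y \<le> \<theta>) (?row j) (?row (Suc j))"
      proof (rule list_all2_all_nthI)
        fix i assume "i < length (?row j)"
        then have i: "i \<le> n" by auto
        then have "d (H i j) (H i (Suc j)) \<le> \<theta>" using lip[of i j i "Suc j"] Suc by simp
        with i show "d (?row j ! i) (?row (Suc j) ! i) \<le> \<theta>" by (simp del: upt_Suc)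
      qed simp
      show "hd (?row j) = hd (?row (Suc j))" "last (?row j) = last (?row (Suc j))"
        using sides[of j] sides[of "Suc j"] Suc.prems by (simp_all add: hd_map hd_append)
    qed (use tp Suc in auto)
    finally show ?case .
  qed simp
  moreover have "?row 0 = p" "?row m = q" using rows len by (auto intro!: nth_equalityI simp del: upt_Suc)
  ultimately show ?thesis by (metis order_refl)
qed

lemma heq_replicate: "0 < k \<Longrightarrow> x # xs \<simeq> replicate k x @ xs"
proof (induction k)
  case (Suc k)
  show ?case
  proof (cases "k = 0")
    case False
    have "x # xs \<simeq> x # x # xs" by (rule heq_dup_Cons)
    also have "\<dots> \<simeq> x # replicate k x @ xs" using False Suc by (intro heq_Cons) simp
    finally show ?thesis by simp
  qed simp
qed simp

lemma heq_lazification: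
  assumes "lazification zs zs'"
  shows "zs \<simeq> zs'"
proof -
  obtain ks where "length ks = length zs" "\<forall>k\<in>set ks. 0 < k" "zs' = concat (map2 replicate ks zs)"
    using assms by (auto simp: lazification_def)
  then show ?thesis
  proof (induction ks zs arbitrary: zs' rule: list_induct2)
    case (Cons k ks z zs)
    have "z # zs \<simeq> z # concat (map2 replicate ks zs)" using Cons by (intro heq_Cons) auto
    also have "\<dots> \<simeq> replicate k z @ concat (map2 replicate ks zs)" using Cons by (intro heq_replicate) auto
    finally show ?case using Cons by simp
  qed simp
qed

lemma lazification_dup:
  fixes a :: 'z
  shows "lazification (us @ [a] @ vs) (us @ [a, a] @ vs)"
proof -
  have 1: "concat (map2 replicate (replicate (length ws) (Suc 0)) ws) = ws" for ws :: "'z list"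
    by (induction ws) auto
  let ?ks = "replicate (length us) (Suc 0) @ [Suc (Suc 0)] @ replicate (length vs) (Suc 0)"
  have "us @ [a, a] @ vs = concat (map2 replicate ?ks (us @ [a] @ vs))" by (simp add: 1)
  moreover have "length ?ks = length (us @ [a] @ vs)" "\<forall>k\<in>set ?ks. 0 < k" by auto
  ultimately show ?thesis unfolding lazification_def by (intro exI[of _ ?ks] conjI)
qed

lemma theta_loops_heq:
  assumes "p \<simeq> q"
  shows "p \<in> theta_loops d \<theta> z0 \<longleftrightarrow> q \<in> theta_loops d \<theta> z0"
proof -
  have "tpath p = tpath q" "hd p = hd q" "last p = last q"
    using heq_imp[OF assms] by auto
  then show ?thesis by (simp only: theta_loops_def mem_Collect_eq)
qed

lemma theta_equivI:
  assumes "p \<in> theta_loops d \<theta> z0" "q \<in> theta_loops d \<theta> z0"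
    "lazification p q \<or> grid_homotopic d \<theta> p q"
  shows "theta_equiv d \<theta> z0 p q"
  unfolding theta_equiv_def using assms by (intro r_into_equivclp conjI)

lemma theta_equiv_sym: "theta_equiv d \<theta> z0 p q \<Longrightarrow> theta_equiv d \<theta> z0 q p"
  unfolding theta_equiv_def by (rule equivclp_sym)

lemma theta_equiv_trans: "theta_equiv d \<theta> z0 p q \<Longrightarrow> theta_equiv d \<theta> z0 q r \<Longrightarrow> theta_equiv d \<theta> z0 p r"
  unfolding theta_equiv_def by (rule equivclp_trans)

lemma heq_imp_theta_equiv:
  assumes "p \<simeq> q" "p \<in> theta_loops d \<theta> z0"
  shows "theta_equiv d \<theta> z0 p q"
  using assms
proof induction
  case (homotopic_refl xs)
  then show ?case by (simp add: theta_equiv_def)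
next
  case (homotopic_sym xs ys)
  then show ?case using theta_loops_heq[OF homotopic_sym.hyps, of z0] theta_equiv_sym[of z0 xs ys] by simp
next
  case (homotopic_trans xs ys zs)
  then show ?case
    using theta_loops_heq[OF homotopic_trans.hyps(1), of z0] theta_equiv_trans[of z0 xs ys zs] by simp
next
  case (homotopic_dup us a vs)
  then show ?case
    using theta_loops_heq[OF theta_homotopic.homotopic_dup[of d \<theta> us a vs], of z0] lazification_dup[of us a vs]
    by (intro theta_equivI) simp_all
next
  case (homotopic_square a b e c us vs)
  \<comment> \<open>The flip is not a grid of height one as it stands, because b and c may be
    further apart than \<theta>. After one lazification on each side, shifted against each other,
    the rungs are a-a, a-c, b-e and e-e, all of length at most \<theta>.\<close>
  let ?p = "us @ [a, a, b, e] @ vs" and ?q = "us @ [a, c, e, e] @ vs"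
  have l: "lazification (us @ [a, b, e] @ vs) ?p" "lazification (us @ [a, c, e] @ vs) ?q"
    using lazification_dup[of us a "[b, e] @ vs"] lazification_dup[of "us @ [a, c]" e vs] by simp_all
  have in1: "us @ [a, c, e] @ vs \<in> theta_loops d \<theta> z0"
    using theta_loops_heq[OF theta_homotopic.homotopic_square[OF homotopic_square(1-4), of us vs], of z0] homotopic_square.prems by simp
  have in2: "?p \<in> theta_loops d \<theta> z0" "?q \<in> theta_loops d \<theta> z0"
    using in1 homotopic_square.prems theta_loops_heq[OF heq_lazification[OF l(1)], of z0]
      theta_loops_heq[OF heq_lazification[OF l(2)], of z0] by simp_all
  have "grid_homotopic d \<theta> ?p ?q"
  proof (rule grid_homotopicI)
    have "list_all2 (\<lambda>x y. d x y \<le> \<theta>) ws ws" for ws using theta_nonneg by (simp add: list_all2_same)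
    then show "list_all2 (\<lambda>x y. d x y \<le> \<theta>) ?p ?q"
      using homotopic_square theta_nonneg by (intro list_all2_appendI) auto
  qed (use in2 in \<open>auto simp: theta_loops_def\<close>)
  then have 2: "theta_equiv d \<theta> z0 ?p ?q" using in2 by (intro theta_equivI) auto
  have 1: "theta_equiv d \<theta> z0 (us @ [a, b, e] @ vs) ?p"
    using l in2 homotopic_square.prems by (intro theta_equivI) auto
  have 3: "theta_equiv d \<theta> z0 ?q (us @ [a, c, e] @ vs)"
    using l in1 in2 by (intro theta_equiv_sym[OF theta_equivI]) auto
  show ?case by (rule theta_equiv_trans[OF 1 theta_equiv_trans[OF 2 3]])
qed

lemma theta_equiv_imp_heq: "theta_equiv d \<theta> z0 p q \<Longrightarrow> p \<simeq> q"
  unfolding theta_equiv_def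
proof (induction rule: equivclp_induct)
  case (step y z)
  then have "y \<simeq> z"
    by (auto intro: heq_lazification heq_grid_homotopic heq_sym[OF heq_lazification] heq_sym[OF heq_grid_homotopic])
  then show ?case by (rule heq_trans[OF step.IH])
qed (rule heq_refl)

lemma theta_class_eq:
  assumes "p \<in> theta_loops d \<theta> z0"
  shows "theta_class d \<theta> z0 p = {q. p \<simeq> q}"
proof -
  have "theta_equiv d \<theta> z0 p q \<longleftrightarrow> p \<simeq> q" for q
    using theta_equiv_imp_heq[of z0 p q] heq_imp_theta_equiv[of p q z0] assms by blast
  then show ?thesis unfolding theta_class_def by (rule Collect_cong)
qed

lemma theta_class_eq_iff:
  assumes "p \<in> theta_loops d \<theta> z0" "q \<in> theta_loops d \<theta> z0"
  shows "theta_class d \<theta> z0 p = theta_class d \<theta> z0 q \<longleftrightarrow> p \<simeq> q"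
proof
  assume "theta_class d \<theta> z0 p = theta_class d \<theta> z0 q"
  then have "{r. p \<simeq> r} = {r. q \<simeq> r}" unfolding theta_class_eq[OF assms(1)] theta_class_eq[OF assms(2)] .
  then show "p \<simeq> q" using heq_refl[of q] by (metis mem_Collect_eq)
next
  assume *: "p \<simeq> q"
  have "p \<simeq> r \<longleftrightarrow> q \<simeq> r" for r
    using heq_trans[OF *, of r] heq_trans[OF heq_sym[OF *], of r] by blast
  then show "theta_class d \<theta> z0 p = theta_class d \<theta> z0 q"
    unfolding theta_class_eq[OF assms(1)] theta_class_eq[OF assms(2)] by (rule Collect_cong)
qed

subsection \<open>The discrete fundamental group\<close>

lemma theta_loops_ne: "p \<in> theta_loops d \<theta> z0 \<Longrightarrow> p \<noteq> [] \<and> hd p = z0 \<and> last p = z0"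
  by (auto simp: theta_loops_def)

lemma theta_loops_join:
  assumes "p \<in> theta_loops d \<theta> z0" "q \<in> theta_loops d \<theta> z0"
  shows "p @ tl q \<in> theta_loops d \<theta> z0"
  using theta_loops_ne[OF assms(1)] theta_loops_ne[OF assms(2)] assms theta_path_join[of p q]
  by (cases q; cases "tl q") (auto simp: theta_loops_def)

lemma theta_loops_rev: "p \<in> theta_loops d \<theta> z0 \<Longrightarrow> rev p \<in> theta_loops d \<theta> z0"
  by (simp add: theta_loops_def theta_path_rev hd_rev last_rev)

lemma theta_loops_single [simp]: "[z0] \<in> theta_loops d \<theta> z0"
  by (simp add: theta_loops_def)

abbreviation "DFG \<equiv> discrete_fundamental_group d \<theta>"
abbreviation "cls \<equiv> theta_class d \<theta>"

lemma discrete_mult: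
  assumes p: "p \<in> theta_loops d \<theta> z0" and q: "q \<in> theta_loops d \<theta> z0"
  shows "cls z0 p \<otimes>\<^bsub>DFG z0\<^esub> cls z0 q = cls z0 (p @ tl q)"
proof -
  have "cls z0 (p' @ tl q') = cls z0 (p @ tl q)" if "p' \<in> cls z0 p" "q' \<in> cls z0 q" for p' q'
  proof -
    have *: "p \<simeq> p'" "q \<simeq> q'"
      using that unfolding theta_class_eq[OF p] theta_class_eq[OF q] by simp_all
    have "p @ tl q \<simeq> p' @ tl q'"
      by (rule heq_join[OF *]) (use theta_loops_ne[OF p] theta_loops_ne[OF q] in auto)
    moreover have "p' \<in> theta_loops d \<theta> z0" "q' \<in> theta_loops d \<theta> z0"
      using p q theta_loops_heq[OF *(1)] theta_loops_heq[OF *(2)] by simp_all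
    ultimately show ?thesis
      using theta_class_eq_iff[OF theta_loops_join[OF p q] theta_loops_join[of p' z0 q']] by simp
  qed
  then have "(\<Union>p'\<in>cls z0 p. \<Union>q'\<in>cls z0 q. cls z0 (p' @ tl q')) =
      (\<Union>p'\<in>cls z0 p. \<Union>q'\<in>cls z0 q. cls z0 (p @ tl q))"
    by (intro SUP_cong[OF refl])
  also have "\<dots> = cls z0 (p @ tl q)"
  proof -
    have "p \<in> cls z0 p" "q \<in> cls z0 q" using p q by (simp_all add: theta_class_eq)
    then show ?thesis by auto
  qed
  finally show ?thesis by (simp add: discrete_fundamental_group_def)
qed

lemma discrete_carrier: "carrier (DFG z0) = cls z0 ` theta_loops d \<theta> z0"
  and discrete_one: "\<one>\<^bsub>DFG z0\<^esub> = cls z0 [z0]"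
  by (simp_all add: discrete_fundamental_group_def)

lemma group_discrete: "group (DFG z0)"
proof (rule groupI)
  fix x y assume "x \<in> carrier (DFG z0)" "y \<in> carrier (DFG z0)"
  then show "x \<otimes>\<^bsub>DFG z0\<^esub> y \<in> carrier (DFG z0)"
    using theta_loops_join by (auto simp: discrete_carrier discrete_mult)
next
  fix x y z assume "x \<in> carrier (DFG z0)" "y \<in> carrier (DFG z0)" "z \<in> carrier (DFG z0)"
  then obtain p q r where "x = cls z0 p" "y = cls z0 q" "z = cls z0 r"
    and in1: "p \<in> theta_loops d \<theta> z0" "q \<in> theta_loops d \<theta> z0" "r \<in> theta_loops d \<theta> z0"
    by (auto simp: discrete_carrier)
  then show "x \<otimes>\<^bsub>DFG z0\<^esub> y \<otimes>\<^bsub>DFG z0\<^esub> z = x \<otimes>\<^bsub>DFG z0\<^esub> (y \<otimes>\<^bsub>DFG z0\<^esub> z)"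
    using theta_loops_ne[OF in1(2)] by (simp add: discrete_mult theta_loops_join)
next
  fix x assume "x \<in> carrier (DFG z0)"
  then obtain p where p: "x = cls z0 p" "p \<in> theta_loops d \<theta> z0" by (auto simp: discrete_carrier)
  then show "\<one>\<^bsub>DFG z0\<^esub> \<otimes>\<^bsub>DFG z0\<^esub> x = x"
    using theta_loops_ne[of p z0] by (cases p) (auto simp: discrete_one discrete_mult)
  have "cls z0 (rev p) \<otimes>\<^bsub>DFG z0\<^esub> x = \<one>\<^bsub>DFG z0\<^esub>"
    using p theta_loops_rev[OF p(2)] backtrack[of "rev p"] theta_loops_ne[OF p(2)]
      theta_class_eq_iff[OF theta_loops_join[OF theta_loops_rev[OF p(2)] p(2)] theta_loops_single]
    by (simp add: discrete_one discrete_mult theta_loops_def theta_path_rev hd_rev)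
  then show "\<exists>y\<in>carrier (DFG z0). y \<otimes>\<^bsub>DFG z0\<^esub> x = \<one>\<^bsub>DFG z0\<^esub>"
    using theta_loops_rev[OF p(2)] by (auto simp: discrete_carrier)
qed (auto simp: discrete_carrier discrete_one)

subsection \<open>Short lists\<close>

abbreviation "len \<equiv> list_length d"

lemma len_nonneg [simp]: "0 \<le> len zs"
proof (induction zs)
  case (Cons x zs)
  then show ?case by (cases zs) auto
qed simp

lemma len_append: "as \<noteq> [] \<Longrightarrow> bs \<noteq> [] \<Longrightarrow> len (as @ bs) = len as + d (last as) (hd bs) + len bs"
proof (induction as)
  case (Cons a as)
  then show ?case by (cases as; cases bs) auto
qed simp

lemma len_join: "as \<noteq> [] \<Longrightarrow> bs \<noteq> [] \<Longrightarrow> last as = hd bs \<Longrightarrow> len (as @ tl bs) = len as + len bs"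
  by (cases bs; cases "tl bs") (auto simp: len_append)

lemma d_le_len: "zs \<noteq> [] \<Longrightarrow> d (hd zs) (last zs) \<le> len zs"
proof (induction zs)
  case (Cons z zs)
  then show ?case using d_triangle[of z "last zs" "hd zs"] by (cases zs) auto
qed simp

text \<open>All distances from the first vertex are at most \<theta>, so the list can be coned off
  from there.\<close>

lemma heq_short:
  assumes "zs \<noteq> []" "len zs \<le> \<theta>"
  shows "zs \<simeq> [hd zs, last zs]"
  using assms
proof (induction zs)
  case (Cons x zs)
  show ?case
  proof (cases zs)
    case Nil
    then show ?thesis by (simp add: heq_dup_Cons)
  next
    case zs: (Cons y ys)
    have le: "d x y + len zs \<le> \<theta>" using Cons.prems zs by simp
    have "d y (last zs) \<le> len zs" using d_le_len[of zs] zs by simp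
    with le d_triangle[of x "last zs" y] have e: "d x y \<le> \<theta>" "d y (last zs) \<le> \<theta>" "d x (last zs) \<le> \<theta>"
      using d_nonneg[of x y] len_nonneg[of zs] by linarith+
    have "len zs \<le> \<theta>" using le d_nonneg[of x y] by linarith
    then have "x # zs \<simeq> [x, y, last zs]" using Cons.IH zs by (intro heq_Cons) auto
    also have "\<dots> \<simeq> [x, x, last zs]" using e theta_nonneg by (intro heq_square_Cons) auto
    also have "\<dots> \<simeq> [x, last zs]" by (rule heq_sym[OF heq_dup_Cons])
    finally show ?thesis using zs by simp
  qed
qed simp

text \<open>A list of total length at most \<open>2\<theta>\<close> splits into two parts of length at most \<open>\<theta>\<close> joined by a
  single edge, so that it bounds a quadrilateral together with the edge between its end points.\<close>

lemma len_split:
  assumes "zs \<noteq> []" "\<theta> < len zs"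
  shows "\<exists>as bs. zs = as @ bs \<and> as \<noteq> [] \<and> bs \<noteq> [] \<and> len as \<le> \<theta> \<and> \<theta> < len as + d (last as) (hd bs)"
  using assms
proof (induction zs rule: rev_induct)
  case (snoc y zs)
  show ?case
  proof (cases "zs = []")
    case True
    then show ?thesis using snoc theta_nonneg by simp
  next
    case ne: False
    show ?thesis
    proof (cases "len zs \<le> \<theta>")
      case True
      then show ?thesis using snoc.prems ne len_append[of zs "[y]"]
        by (intro exI[of _ zs] exI[of _ "[y]"]) auto
    next
      case False
      then obtain as bs where "zs = as @ bs \<and> as \<noteq> [] \<and> bs \<noteq> [] \<and> len as \<le> \<theta> \<and> \<theta> < len as + d (last as) (hd bs)"
        using snoc.IH[OF ne] by auto
      then show ?thesis by (intro exI[of _ as] exI[of _ "bs @ [y]"]) auto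
    qed
  qed
qed simp

lemma heq_edge:
  assumes "tpath zs" "len zs \<le> 2 * \<theta>" "d (hd zs) (last zs) \<le> \<theta>"
  shows "zs \<simeq> [hd zs, last zs]"
proof (cases "len zs \<le> \<theta>")
  case True
  then show ?thesis using assms by (intro heq_short) auto
next
  case False
  from assms have "zs \<noteq> []" by auto
  with False obtain as bs where zs: "zs = as @ bs" "as \<noteq> []" "bs \<noteq> []" "len as \<le> \<theta>"
    "\<theta> < len as + d (last as) (hd bs)"
    using len_split[of zs] by auto
  define x u v y where "x = hd zs" "u = last as" "v = hd bs" "y = last zs"
  note xuvy = x_u_v_y_def
  have bs: "len bs \<le> \<theta>" using assms(2) zs len_append[of as bs] by simp
  have e: "d x u \<le> \<theta>" "d u v \<le> \<theta>" "d v y \<le> \<theta>" "d x y \<le> \<theta>"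
    using d_le_len[of as] d_le_len[of bs] zs bs assms theta_path_append[of as bs] xuvy by auto
  have "zs \<simeq> [x, u] @ [v, y]"
    using heq_append1[OF heq_short[OF zs(2,4)], of bs] heq_append2[OF heq_short[OF zs(3) bs], of "[x, u]"]
      zs xuvy by (auto intro: heq_trans)
  \<comment> \<open>The quadrilateral has the sides x-u, u-v, x-y and y-v; flipping u to y leaves
    the edge x-y with a spur to v.\<close>
  also have "\<dots> \<simeq> [x, y, v, y]"
    using heq_square_Cons[of x u v y "[y]"] e d_commute by simp
  also have "\<dots> \<simeq> [x, y]" using heq_spur[of y v "[x]" "[]"] e d_commute by simp
  finally show ?thesis using xuvy by simp
qed

lemma unit_steps:
  assumes "successively (\<lambda>x y. d x y \<le> 1) zs" "zs \<noteq> []"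
  shows "len zs \<le> real (length zs) - 1"
  using assms
proof (induction zs)
  case (Cons x zs)
  then show ?case by (cases zs) auto
qed simp

lemma heq_unit_steps1:
  assumes "successively (\<lambda>x y. d x y \<le> 1) zs" "zs \<noteq> []" "length zs \<le> Suc k" "real k \<le> \<theta>"
  shows "zs \<simeq> [hd zs, last zs] \<and> d (hd zs) (last zs) \<le> \<theta>"
  using unit_steps[OF assms(1,2)] assms d_le_len[of zs] heq_short[of zs] by auto

lemma take_join_drop:
  assumes "k < length zs"
  shows "zs = take (Suc k) zs @ tl (drop k zs)" "hd (drop k zs) = zs ! k" "last (take (Suc k) zs) = zs ! k"
proof -
  have "tl (drop k zs) = drop (Suc k) zs" by (simp add: drop_Suc tl_drop)
  then show "zs = take (Suc k) zs @ tl (drop k zs)" by simp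
qed (use assms in \<open>simp_all add: hd_drop_conv_nth take_Suc_conv_app_nth\<close>)

lemma heq_unit_steps2:
  assumes "successively (\<lambda>x y. d x y \<le> 1) zs" "zs \<noteq> []" "length zs \<le> Suc (2 * k)" "real k \<le> \<theta>"
  shows "\<exists>b. zs \<simeq> [hd zs, b, last zs] \<and> d (hd zs) b \<le> \<theta> \<and> d b (last zs) \<le> \<theta>"
proof (cases "length zs \<le> Suc k")
  case True
  have "zs \<simeq> [hd zs, last zs]" "d (hd zs) (last zs) \<le> \<theta>"
    using heq_unit_steps1[OF assms(1,2) True assms(4)] by auto
  moreover from this(1) have "zs \<simeq> [hd zs, hd zs, last zs]" by (rule heq_trans[OF _ heq_dup_Cons])
  ultimately show ?thesis using theta_nonneg by (intro exI[of _ "hd zs"]) simp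
next
  case False
  define as bs where "as = take (Suc k) zs" and "bs = drop k zs"
  have k: "k < length zs" using False by simp
  have s: "successively (\<lambda>x y. d x y \<le> 1) as" "successively (\<lambda>x y. d x y \<le> 1) bs"
    using assms(1) successively_append_iff[of _ "take (Suc k) zs" "drop (Suc k) zs"]
      successively_append_iff[of _ "take k zs" "drop k zs"] by (auto simp: as_def bs_def)
  have ne: "as \<noteq> []" "bs \<noteq> []" using k by (auto simp: as_def bs_def)
  have *: "hd as = hd zs" "last bs = last zs" "last as = hd bs" "zs = as @ tl bs"
    using take_join_drop[OF k] k by (auto simp: as_def bs_def)
  have "as \<simeq> [hd as, last as] \<and> d (hd as) (last as) \<le> \<theta>"
    by (rule heq_unit_steps1[OF s(1) ne(1) _ assms(4)]) (simp add: as_def)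
  then have as': "as \<simeq> [hd zs, hd bs]" "d (hd zs) (hd bs) \<le> \<theta>" using * by simp_all
  have "bs \<simeq> [hd bs, last bs] \<and> d (hd bs) (last bs) \<le> \<theta>"
    by (rule heq_unit_steps1[OF s(2) ne(2) _ assms(4)]) (use assms(3) in \<open>simp add: bs_def\<close>)
  then have bs': "bs \<simeq> [hd bs, last zs]" "d (hd bs) (last zs) \<le> \<theta>" using * by simp_all
  have "zs = as @ tl bs" by fact
  also have "\<dots> \<simeq> [hd zs, hd bs] @ tl [hd bs, last zs]"
    by (rule heq_join[OF as'(1) bs'(1) ne *(3)])
  finally show ?thesis using as'(2) bs'(2) by (intro exI[of _ "hd bs"]) simp
qed

text \<open>At most 4k unit steps are grouped into four edges of length at most \<theta>, that is,
  into a quadrilateral, which is filled by one flip. This is the reason why relators up to length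
  4\<theta> become trivial jumps.\<close>

lemma heq_closed_unit_steps:
  assumes "successively (\<lambda>x y. d x y \<le> 1) zs" "zs \<noteq> []" "length zs \<le> Suc (4 * k)" "real k \<le> \<theta>"
    and "last zs = hd zs"
  shows "zs \<simeq> [hd zs]"
proof -
  have "\<exists>b c e. zs \<simeq> [hd zs, b, c, e, last zs] \<and> d (hd zs) b \<le> \<theta> \<and> d b c \<le> \<theta> \<and> d c e \<le> \<theta> \<and> d e (last zs) \<le> \<theta>"
  proof (cases "length zs \<le> Suc (2 * k)")
    case True
    then obtain b where b: "zs \<simeq> [hd zs, b, last zs]" "d (hd zs) b \<le> \<theta>" "d b (last zs) \<le> \<theta>"
      using heq_unit_steps2[OF assms(1,2) True assms(4)] by auto
    \<comment> \<open>A list too short to be cut in the middle is padded to four edges by repeating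
      its first vertex.\<close>
    have "[hd zs, b, last zs] \<simeq> [hd zs, hd zs, b, last zs]" by (rule heq_dup_Cons)
    also have "\<dots> \<simeq> [hd zs, hd zs, hd zs, b, last zs]" by (rule heq_dup_Cons)
    finally have "zs \<simeq> [hd zs, hd zs, hd zs, b, last zs]" by (rule heq_trans[OF b(1)])
    then show ?thesis using b theta_nonneg
      by (intro exI[of _ "hd zs"] exI[of _ b]) simp
  next
    case False
    define as bs where "as = take (Suc (2 * k)) zs" and "bs = drop (2 * k) zs"
    have k: "2 * k < length zs" using False by simp
    have s: "successively (\<lambda>x y. d x y \<le> 1) as" "successively (\<lambda>x y. d x y \<le> 1) bs"
      using assms(1) successively_append_iff[of _ "take (Suc (2 * k)) zs" "drop (Suc (2 * k)) zs"]
        successively_append_iff[of _ "take (2 * k) zs" "drop (2 * k) zs"] by (auto simp: as_def bs_def)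
    have ne: "as \<noteq> []" "bs \<noteq> []" using k by (auto simp: as_def bs_def)
    have *: "hd as = hd zs" "last bs = last zs" "last as = hd bs" "zs = as @ tl bs"
      using take_join_drop[OF k] k by (auto simp: as_def bs_def)
    have l: "length as \<le> Suc (2 * k)" "length bs \<le> Suc (2 * k)"
      using assms(3) by (simp_all add: as_def bs_def)
    obtain b where b: "as \<simeq> [hd zs, b, hd bs]" "d (hd zs) b \<le> \<theta>" "d b (hd bs) \<le> \<theta>"
      using heq_unit_steps2[OF s(1) ne(1) l(1) assms(4)] unfolding * by (elim exE conjE)
    obtain e where e: "bs \<simeq> [hd bs, e, last zs]" "d (hd bs) e \<le> \<theta>" "d e (last zs) \<le> \<theta>"
      using heq_unit_steps2[OF s(2) ne(2) l(2) assms(4)] unfolding * by (elim exE conjE)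
    have "zs = as @ tl bs" by fact
    also have "\<dots> \<simeq> [hd zs, b, hd bs] @ tl [hd bs, e, last zs]"
      by (rule heq_join[OF b(1) e(1) ne *(3)])
    finally show ?thesis using b(2,3) e(2,3)
      by (intro exI[of _ b] exI[of _ "hd bs"] exI[of _ e]) simp
  qed
  then obtain b c e where q: "zs \<simeq> [hd zs, b, c, e, hd zs]"
    "d (hd zs) b \<le> \<theta>" "d b c \<le> \<theta>" "d c e \<le> \<theta>" "d e (hd zs) \<le> \<theta>" using assms(5) by auto
  note q(1)
  \<comment> \<open>Flipping b to e makes the second half retrace the first; two spurs remain to be
    removed.\<close>
  also have "[hd zs, b, c, e, hd zs] \<simeq> [hd zs, e, c, e, hd zs]"
    using q d_commute by (intro heq_square_Cons) auto
  also have "\<dots> \<simeq> [hd zs, e, hd zs]" using heq_spur[of e c "[hd zs]" "[hd zs]"] q d_commute by simp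
  also have "\<dots> \<simeq> [hd zs]" using heq_spur[of "hd zs" e "[]" "[]"] q d_commute by simp
  finally show ?thesis .
qed

end

section \<open>Path homotopy\<close>

lemma const_path [simp]: "path (\<lambda>_. x)" "pathstart (\<lambda>_. x) = x" "pathfinish (\<lambda>_. x) = x"
  "reversepath (\<lambda>_. x) = (\<lambda>_. x)" "f \<circ> (\<lambda>_. x) = (\<lambda>_. f x)"
  by (auto simp: path_def pathstart_def pathfinish_def reversepath_def)

text \<open>The library states these for constant paths of the form \<open>linepath a a\<close>, hence only in
  normed spaces.\<close>

lemma homotopic_paths_rid_const:
  assumes "path p" "x = pathfinish p"
  shows "homotopic_paths UNIV (p +++ (\<lambda>_. x)) p"
  using assms
  by (intro homotopic_paths_sym[OF homotopic_paths_reparametrize[where f = "\<lambda>t. min 1 (2 * t)"]])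
    (auto simp: joinpaths_def pathfinish_def min_absorb1 min_absorb2 intro!: continuous_intros)

lemma homotopic_paths_lid_const:
  assumes "path p" "x = pathstart p"
  shows "homotopic_paths UNIV ((\<lambda>_. x) +++ p) p"
  using assms
  by (intro homotopic_paths_sym[OF homotopic_paths_reparametrize[where f = "\<lambda>t. max 0 (2 * t - 1)"]])
    (auto simp: joinpaths_def pathstart_def max_absorb1 max_absorb2 intro!: continuous_intros)

lemma homotopic_paths_rinv_const:
  assumes "path p"
  shows "homotopic_paths UNIV (p +++ reversepath p) (\<lambda>_. pathstart p)"
proof -
  \<comment> \<open>Going out and back is p composed with the tent function 1 - |2u - 1|; the
    homotopy scales the tent down to 0.\<close>
  let ?h = "\<lambda>y. p ((1 - fst y) * (1 - \<bar>2 * snd y - 1\<bar>))"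
  have "continuous_on ({0..1} \<times> {0..1}) ?h"
  proof (rule continuous_on_compose2[of "{0..1}" p])
    show "(\<lambda>y. (1 - fst y) * (1 - \<bar>2 * snd y - 1\<bar>)) ` ({0..1} \<times> {0..1}) \<subseteq> {0..1::real}"
      by (auto intro!: mult_nonneg_nonneg mult_le_one)
  qed (use assms in \<open>auto simp: path_def intro!: continuous_intros\<close>)
  then show ?thesis unfolding homotopic_paths
    by (intro exI[of _ ?h])
      (auto simp: joinpaths_def reversepath_def pathstart_def pathfinish_def abs_if algebra_simps)
qed

lemma homotopic_paths_cancel_left:
  assumes "path p" "path q" "pathfinish p = pathstart q"
  shows "homotopic_paths UNIV (reversepath p +++ p +++ q) q"
proof -
  have "homotopic_paths UNIV (reversepath p +++ p) (\<lambda>_. pathstart q)"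
    using homotopic_paths_rinv_const[of "reversepath p"] assms by simp
  then have "homotopic_paths UNIV ((reversepath p +++ p) +++ q) ((\<lambda>_. pathstart q) +++ q)"
    using assms by (intro homotopic_paths_join) auto
  also have "homotopic_paths UNIV \<dots> q" using assms by (intro homotopic_paths_lid_const) auto
  finally show ?thesis
    using assms homotopic_paths_assoc[of "reversepath p" UNIV p q] by (auto intro: homotopic_paths_trans)
qed

lemma path_compose_UNIV:
  assumes "continuous_on UNIV f" "path p"
  shows "path (f \<circ> p)"
  using assms by (auto intro: path_continuous_image continuous_on_subset)

lemma path_class_eq_iff:
  assumes "path p"
  shows "path_class p = path_class q \<longleftrightarrow> homotopic_paths UNIV p q"
  unfolding path_class_def using assms
  by (metis (mono_tags, lifting) Collect_cong homotopic_paths_refl homotopic_paths_sym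
      homotopic_paths_trans mem_Collect_eq subset_UNIV)

lemma path_class_self: "path p \<Longrightarrow> p \<in> path_class p"
  by (simp add: path_class_def)

lemma loops_simps: "p \<in> loops x \<longleftrightarrow> path p \<and> pathstart p = x \<and> pathfinish p = x"
  by (simp add: loops_def)

lemma const_in_loops [simp]: "(\<lambda>_. x) \<in> loops x"
  by (simp add: loops_def path_def pathstart_def pathfinish_def)

lemma fundamental_carrier: "carrier (fundamental_group x) = path_class ` loops x"
  and fundamental_one: "\<one>\<^bsub>fundamental_group x\<^esub> = path_class (\<lambda>_. x)"
  by (simp_all add: fundamental_group_def)

lemma fundamental_mult:
  assumes "p \<in> loops x" "q \<in> loops x"
  shows "path_class p \<otimes>\<^bsub>fundamental_group x\<^esub> path_class q = path_class (p +++ q)"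
proof -
  have "path_class (p' +++ q') = path_class (p +++ q)" if "p' \<in> path_class p" "q' \<in> path_class q" for p' q'
  proof -
    have h: "homotopic_paths UNIV p p'" "homotopic_paths UNIV q q'" using that by (simp_all add: path_class_def)
    have "homotopic_paths UNIV (p +++ q) (p' +++ q')"
      using h assms by (intro homotopic_paths_join) (auto simp: loops_simps)
    then show ?thesis using path_class_eq_iff[of "p +++ q" "p' +++ q'"] assms by (simp add: loops_simps)
  qed
  then have "(\<Union>p'\<in>path_class p. \<Union>q'\<in>path_class q. path_class (p' +++ q')) =
     (\<Union>p'\<in>path_class p. \<Union>q'\<in>path_class q. path_class (p +++ q))"
    by (intro SUP_cong[OF HOL.refl])
  also have "\<dots> = path_class (p +++ q)"
    using path_class_self[of p] path_class_self[of q] assms by (auto simp: loops_simps)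
  finally show ?thesis by (simp add: fundamental_group_def)
qed

lemma loops_join: "p \<in> loops x \<Longrightarrow> q \<in> loops x \<Longrightarrow> p +++ q \<in> loops x"
  and loops_reversepath: "p \<in> loops x \<Longrightarrow> reversepath p \<in> loops x"
  by (simp_all add: loops_simps)

lemma group_fundamental_group: "group (fundamental_group x)"
proof (rule groupI)
  fix A B assume "A \<in> carrier (fundamental_group x)" "B \<in> carrier (fundamental_group x)"
  then show "A \<otimes>\<^bsub>fundamental_group x\<^esub> B \<in> carrier (fundamental_group x)"
    by (auto simp: fundamental_carrier fundamental_mult loops_join)
next
  fix A B C
  assume "A \<in> carrier (fundamental_group x)" "B \<in> carrier (fundamental_group x)"
    "C \<in> carrier (fundamental_group x)"
  then obtain p q r where "A = path_class p" "B = path_class q" "C = path_class r"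
    and l: "p \<in> loops x" "q \<in> loops x" "r \<in> loops x"
    by (auto simp: fundamental_carrier)
  moreover have "path_class ((p +++ q) +++ r) = path_class (p +++ (q +++ r))"
    using l by (subst path_class_eq_iff) (auto simp: loops_simps homotopic_paths_sym homotopic_paths_assoc)
  ultimately show "A \<otimes>\<^bsub>fundamental_group x\<^esub> B \<otimes>\<^bsub>fundamental_group x\<^esub> C =
      A \<otimes>\<^bsub>fundamental_group x\<^esub> (B \<otimes>\<^bsub>fundamental_group x\<^esub> C)"
    by (simp add: fundamental_mult loops_join)
next
  fix A assume "A \<in> carrier (fundamental_group x)"
  then obtain p where p: "A = path_class p" "p \<in> loops x" by (auto simp: fundamental_carrier)
  then show "\<one>\<^bsub>fundamental_group x\<^esub> \<otimes>\<^bsub>fundamental_group x\<^esub> A = A"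
    by (simp add: fundamental_one fundamental_mult)
      (subst path_class_eq_iff, auto simp: loops_simps homotopic_paths_lid_const)
  have "path_class (reversepath p) \<otimes>\<^bsub>fundamental_group x\<^esub> A = \<one>\<^bsub>fundamental_group x\<^esub>"
    using p homotopic_paths_rinv_const[of "reversepath p"]
    by (simp add: fundamental_one fundamental_mult loops_reversepath, subst path_class_eq_iff)
      (auto simp: loops_simps)
  then show "\<exists>B\<in>carrier (fundamental_group x). B \<otimes>\<^bsub>fundamental_group x\<^esub> A = \<one>\<^bsub>fundamental_group x\<^esub>"
    using p(2) loops_reversepath by (auto simp: fundamental_carrier)
qed (simp add: fundamental_carrier fundamental_one)

text \<open>Closing up along chosen paths \<open>\<beta>\<close> from the base point turns computations with paths up to
  homotopy into computations in the fundamental group.\<close>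

locale based_paths =
  fixes x0 :: "'x::topological_space" and \<beta> :: "'x \<Rightarrow> real \<Rightarrow> 'x"
  assumes beta: "path (\<beta> x)" "pathstart (\<beta> x) = x0" "pathfinish (\<beta> x) = x"
    and beta_base: "\<beta> x0 = (\<lambda>_. x0)"
begin

sublocale pi: group "fundamental_group x0" by (rule group_fundamental_group)

abbreviation "FG \<equiv> fundamental_group x0"

abbreviation pi_mult (infixl "\<cdot>" 70) where "A \<cdot> B \<equiv> A \<otimes>\<^bsub>FG\<^esub> B"

definition L :: "(real \<Rightarrow> 'x) \<Rightarrow> (real \<Rightarrow> 'x) set" where
  "L p = path_class (\<beta> (pathstart p) +++ p +++ reversepath (\<beta> (pathfinish p)))"

lemma close_loop: "path p \<Longrightarrow> \<beta> (pathstart p) +++ p +++ reversepath (\<beta> (pathfinish p)) \<in> loops x0"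
  by (simp add: loops_simps beta)

lemma L_carrier [simp]: "path p \<Longrightarrow> L p \<in> carrier FG"
  unfolding L_def fundamental_carrier using close_loop by blast

lemma L_homotopic:
  assumes "homotopic_paths UNIV p q"
  shows "L p = L q"
proof -
  note h = homotopic_paths_imp_path[OF assms] homotopic_paths_imp_pathstart[OF assms]
    homotopic_paths_imp_pathfinish[OF assms]
  have "homotopic_paths UNIV (\<beta> (pathstart p) +++ p +++ reversepath (\<beta> (pathfinish p)))
      (\<beta> (pathstart p) +++ q +++ reversepath (\<beta> (pathfinish p)))"
    using assms h by (intro homotopic_paths_join) (auto simp: beta)
  then show ?thesis using h by (simp add: L_def path_class_eq_iff beta)
qed

text \<open>The closing path at the common end point occurs once forwards and once backwards and
  cancels. Thus \<open>L\<close> is a functor from the fundamental groupoid to the group at the base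
  point.\<close>

lemma L_join:
  assumes "path p" "path q" "pathfinish p = pathstart q"
  shows "L (p +++ q) = L p \<cdot> L q"
proof -
  define a b c where "a = \<beta> (pathstart p)" and "b = \<beta> (pathstart q)" and "c = reversepath (\<beta> (pathfinish q))"
  have ab: "path a" "path b" "path c" "pathfinish a = pathstart p" "pathfinish b = pathstart q"
    "pathstart c = pathfinish q" "pathstart b = x0"
    by (auto simp: a_def b_def c_def beta)
  note [simp] = ab assms
  have "homotopic_paths UNIV ((a +++ p +++ reversepath b) +++ b +++ q +++ c)
      (a +++ (p +++ reversepath b) +++ b +++ q +++ c)"
    by (intro homotopic_paths_sym[OF homotopic_paths_assoc]) auto
  also have "homotopic_paths UNIV \<dots> (a +++ p +++ reversepath b +++ b +++ q +++ c)"
    by (intro homotopic_paths_join homotopic_paths_sym[OF homotopic_paths_assoc]) auto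
  also have "homotopic_paths UNIV \<dots> (a +++ p +++ q +++ c)"
    by (intro homotopic_paths_join homotopic_paths_cancel_left) auto
  also have "homotopic_paths UNIV \<dots> (a +++ (p +++ q) +++ c)"
    by (intro homotopic_paths_join homotopic_paths_assoc) auto
  finally have "path_class ((a +++ p +++ reversepath b) +++ b +++ q +++ c) = path_class (a +++ (p +++ q) +++ c)"
    by (subst path_class_eq_iff) auto
  moreover have "L p = path_class (a +++ p +++ reversepath b)" "L q = path_class (b +++ q +++ c)"
    "L (p +++ q) = path_class (a +++ (p +++ q) +++ c)"
    by (simp_all add: L_def a_def b_def c_def)
  moreover have "a +++ p +++ reversepath b \<in> loops x0" "b +++ q +++ c \<in> loops x0"
    by (auto simp: loops_simps a_def b_def c_def beta)
  ultimately show ?thesis by (simp add: fundamental_mult)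
qed

lemma L_const [simp]: "L (\<lambda>_. x) = \<one>\<^bsub>FG\<^esub>"
proof -
  have "homotopic_paths UNIV ((\<lambda>_. x) +++ (\<lambda>_. x)) (\<lambda>_. x)"
    by (rule homotopic_paths_lid_const) auto
  \<comment> \<open>A group element equal to its own square is the identity.\<close>
  then have "L (\<lambda>_. x) \<cdot> L (\<lambda>_. x) = L (\<lambda>_. x)"
    using L_homotopic L_join[of "\<lambda>_. x" "\<lambda>_. x"] by (simp add: path_def pathfinish_def pathstart_def)
  moreover have "L (\<lambda>_. x) \<in> carrier FG" by (simp add: path_def)
  ultimately show ?thesis by (simp add: pi.r_cancel_one')
qed

lemma L_reversepath: "path p \<Longrightarrow> L (reversepath p) = inv\<^bsub>FG\<^esub> L p"
  using L_homotopic[OF homotopic_paths_rinv_const[of "reversepath p"]] L_join[of "reversepath p" p]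
  by (intro pi.inv_equality[symmetric]) auto

lemma L_loop:
  assumes "p \<in> loops x0"
  shows "L p = path_class p"
proof -
  have "homotopic_paths UNIV ((\<lambda>_. x0) +++ p +++ (\<lambda>_. x0)) (p +++ (\<lambda>_. x0))"
    using assms by (intro homotopic_paths_lid_const) (auto simp: loops_simps)
  also have "homotopic_paths UNIV \<dots> p"
    using assms by (intro homotopic_paths_rid_const) (auto simp: loops_simps)
  finally show ?thesis
    using assms homotopic_paths_imp_path[of UNIV "(\<lambda>_. x0) +++ p +++ (\<lambda>_. x0)" p]
    by (simp add: L_def loops_simps beta_base path_class_eq_iff)
qed

lemma L_carrierE:
  assumes "A \<in> carrier FG"
  obtains p where "p \<in> loops x0" "A = L p"
  using assms by (auto simp: fundamental_carrier L_loop)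

lemma L_beta [simp]: "L (\<beta> x) = \<one>\<^bsub>FG\<^esub>"
proof -
  have "L (\<beta> x) = path_class ((\<lambda>_. x0) +++ \<beta> x +++ reversepath (\<beta> x))"
    by (simp add: L_def beta beta_base)
  also have "\<dots> = path_class (\<beta> x +++ reversepath (\<beta> x))"
    by (subst path_class_eq_iff) (auto simp: beta intro!: homotopic_paths_lid_const)
  also have "\<dots> = path_class (\<lambda>_. x0)"
    using homotopic_paths_rinv_const[of "\<beta> x"] by (subst path_class_eq_iff) (auto simp: beta)
  finally show ?thesis by (simp add: fundamental_one)
qed

text \<open>Undoing the closing paths on both sides recovers the path up to homotopy: on paths with
  given end points \<open>L\<close> loses nothing. This brings computations in the fundamental group
  back to paths.\<close>

lemma L_eqD:
  assumes "L p = L q" "path p" "path q" "pathstart p = pathstart q" "pathfinish p = pathfinish q"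
  shows "homotopic_paths UNIV p q"
proof -
  define a b where "a = \<beta> (pathstart p)" and "b = \<beta> (pathfinish p)"
  have *: "homotopic_paths UNIV (reversepath a +++ (a +++ r +++ reversepath b) +++ b) r"
    if r: "path r" "pathstart r = pathstart p" "pathfinish r = pathfinish p" for r
  proof -
    have [simp]: "path a" "path b" "pathfinish a = pathstart r" "pathfinish b = pathfinish r"
      "pathstart a = x0" "pathstart b = x0" by (auto simp: a_def b_def beta r)
    note [simp] = r(1)
    have "homotopic_paths UNIV (reversepath a +++ (a +++ r +++ reversepath b) +++ b)
        (reversepath a +++ a +++ (r +++ reversepath b) +++ b)"
      by (intro homotopic_paths_join homotopic_paths_sym[OF homotopic_paths_assoc]) auto
    also have "homotopic_paths UNIV \<dots> ((r +++ reversepath b) +++ b)"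
      by (intro homotopic_paths_cancel_left) auto
    also have "homotopic_paths UNIV \<dots> (r +++ reversepath b +++ b)"
      by (intro homotopic_paths_sym[OF homotopic_paths_assoc]) auto
    also have "homotopic_paths UNIV \<dots> (r +++ (\<lambda>_. pathfinish r))"
      using homotopic_paths_rinv_const[of "reversepath b"] by (intro homotopic_paths_join) auto
    also have "homotopic_paths UNIV \<dots> r" by (rule homotopic_paths_rid_const) auto
    finally show ?thesis .
  qed
  have "homotopic_paths UNIV (a +++ p +++ reversepath b) (a +++ q +++ reversepath b)"
    using assms by (simp add: L_def a_def b_def path_class_eq_iff beta)
  then have "homotopic_paths UNIV ((a +++ p +++ reversepath b) +++ b) ((a +++ q +++ reversepath b) +++ b)"
    by (rule homotopic_paths_join) (auto simp: a_def b_def beta)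
  then have "homotopic_paths UNIV (reversepath a +++ (a +++ p +++ reversepath b) +++ b)
      (reversepath a +++ (a +++ q +++ reversepath b) +++ b)"
    by (rule homotopic_paths_join[rotated]) (auto simp: a_def b_def beta)
  moreover have "homotopic_paths UNIV (reversepath a +++ (a +++ p +++ reversepath b) +++ b) p"
    by (rule *) (use assms in auto)
  moreover have "homotopic_paths UNIV (reversepath a +++ (a +++ q +++ reversepath b) +++ b) q"
    by (rule *) (use assms in auto)
  ultimately show ?thesis
    using homotopic_paths_sym homotopic_paths_trans by meson
qed

end

section \<open>Sampling continuous paths\<close>

lemma path_uniformly_continuous:
  fixes p :: "real \<Rightarrow> 'x::metric_space"
  assumes "path p" "0 < e"
  obtains \<delta> where "0 < \<delta>" "\<And>u v. u \<in> {0..1} \<Longrightarrow> v \<in> {0..1} \<Longrightarrow> \<bar>u - v\<bar> < \<delta> \<Longrightarrow> dist (p u) (p v) < e"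
proof -
  have "uniformly_continuous_on {0..1} p"
    using assms compact_uniformly_continuous by (auto simp: path_def)
  then show ?thesis
    using assms(2) that unfolding uniformly_continuous_on_def dist_real_def by metis
qed

definition unif :: "nat \<Rightarrow> real list" where
  "unif n = map (\<lambda>i. real i / real n) [0..<Suc n]"

lemma unif_nth: "i \<le> n \<Longrightarrow> unif n ! i = real i / real n"
  and length_unif [simp]: "length (unif n) = Suc n"
  by (simp_all add: unif_def del: upt_Suc)

lemma unif_not_Nil [simp]: "unif n \<noteq> []"
  by (simp add: unif_def)

lemma unif_sorted: "0 < n \<Longrightarrow> sorted_wrt (<) (unif n)"
  by (auto simp: sorted_wrt_iff_nth_less unif_nth divide_strict_right_mono)

lemma unif_hd: "0 < n \<Longrightarrow> hd (unif n) = 0" "0 < n \<Longrightarrow> last (unif n) = 1"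
  by (simp_all add: unif_def hd_map last_map del: upt_Suc)

locale sampled_space = theta_space d \<theta>
  for d :: "'x::metric_space \<Rightarrow> 'x \<Rightarrow> real" and \<theta> :: real +
  fixes t :: real
  assumes t_pos: "0 < t" and theta_pos: "0 < \<theta>" and d_le: "d x y \<le> t * dist x y"
begin

definition samples :: "(real \<Rightarrow> 'x) \<Rightarrow> 'x list \<Rightarrow> bool" where
  "samples p zs \<longleftrightarrow> (\<exists>ts. sampling t \<theta> p ts \<and> zs = map p ts)"

lemma sampling_imp:
  assumes "sampling t \<theta> p ts"
  shows "ts \<noteq> []" "hd ts = 0" "last ts = 1" "set ts \<subseteq> {0..1}"
    "successively (\<lambda>a b. a < b \<and> (\<forall>u\<in>{a..b}. t * dist (p a) (p u) \<le> \<theta>)) ts"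
proof -
  show *: "ts \<noteq> []" "hd ts = 0" "last ts = 1" using assms by (auto simp: sampling_def)
  have s: "sorted_wrt (<) ts" using assms by (simp add: sampling_def)
  then have "sorted ts" by (rule strict_sorted_imp_sorted)
  then have "0 \<le> x \<and> x \<le> 1" if "x \<in> set ts" for x
    using that * by (metis hd_conv_nth in_set_conv_nth last_conv_nth le0 sorted_nth_mono
        Suc_diff_1 length_greater_0_conv less_Suc_eq_le diff_less zero_less_one)
  then show "set ts \<subseteq> {0..1}" by auto
  show "successively (\<lambda>a b. a < b \<and> (\<forall>u\<in>{a..b}. t * dist (p a) (p u) \<le> \<theta>)) ts"
    using assms s by (auto simp: successively_conv_nth sampling_def sorted_wrt_iff_nth_less)
qed

lemma samples_imp:
  assumes "samples p zs"
  shows "tpath zs" "hd zs = pathstart p" "last zs = pathfinish p"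
proof -
  obtain ts where ts: "sampling t \<theta> p ts" "zs = map p ts" using assms by (auto simp: samples_def)
  note s = sampling_imp[OF ts(1)]
  show "hd zs = pathstart p" "last zs = pathfinish p"
    using s ts by (simp_all add: hd_map last_map pathstart_def pathfinish_def)
  have "successively (\<lambda>a b. d (p a) (p b) \<le> \<theta>) ts"
    by (rule successively_mono[OF s(5)]) (auto intro: order_trans[OF d_le])
  then show "tpath zs" using s(1) ts(2) by (simp add: theta_path_def successively_map)
qed

lemma samples_ne: "samples p zs \<Longrightarrow> zs \<noteq> []"
  using samples_imp(1)[of p zs] by auto

text \<open>Comparison of a sampling \<open>x # xs\<close> with a fine subdivision \<open>y # ys\<close>, where \<open>y\<close> lies in the first
  interval of the former.\<close>

lemma heq_sampling_fine:
  fixes p :: "real \<Rightarrow> 'x"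
  assumes fine: "\<And>u v. u \<in> {0..1} \<Longrightarrow> v \<in> {0..1} \<Longrightarrow> \<bar>u - v\<bar> \<le> \<eta> \<Longrightarrow> t * dist (p u) (p v) \<le> \<theta>"
    and "successively (\<lambda>a b. a < b \<and> (\<forall>u\<in>{a..b}. t * dist (p a) (p u) \<le> \<theta>)) (x # xs)"
    and "successively (\<lambda>a b. a < b \<and> b - a \<le> \<eta>) (y # ys)"
    and "last (x # xs) = 1" "last (y # ys) = 1" "set (x # xs) \<subseteq> {0..1}" "set (y # ys) \<subseteq> {0..1}"
    and "x \<le> y" "xs = [] \<Longrightarrow> y \<le> x" "xs \<noteq> [] \<Longrightarrow> y \<le> hd xs"
  shows "p x # map p (y # ys) \<simeq> map p (x # xs)"
  using assms(2-)
proof (induction "length xs + length ys" arbitrary: x xs y ys rule: less_induct)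
  case less
  have dle: "d (p u) (p v) \<le> \<theta>" if "t * dist (p u) (p v) \<le> \<theta>" for u v
    using that d_le[of "p u" "p v"] by simp
  have lt1: "zs = []" if "successively (\<lambda>a b. a < b \<and> Q a b) (1 # zs)" "set zs \<subseteq> {0..1}"
    for zs :: "real list" and Q
    using that by (cases zs) auto
  show ?case
  proof (cases xs)
    case Nil
    then have "x = 1" using less.prems by auto
    moreover have "y = 1" by (rule order_antisym) (use less.prems Nil \<open>x = 1\<close> in auto)
    moreover from this have "ys = []" using lt1 less.prems by auto
    ultimately show ?thesis using Nil heq_sym[OF heq_dup_Cons[of "p 1" "[]"]] by simp
  next
    case xs: (Cons x' xs')
    then have y: "x \<le> y" "y \<le> x'" "x < x'" using less.prems by auto
    have in01: "x \<in> {0..1}" "x' \<in> {0..1}" "y \<in> {0..1}" using less.prems xs by auto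
    have xu: "d (p x) (p u) \<le> \<theta>" if "x \<le> u" "u \<le> x'" for u
      using less.prems(1) xs that by (intro dle) auto
    show ?thesis
    proof (cases ys)
      case Nil
      then have "y = 1" using less.prems by auto
      then have "x' = 1" using y in01 by auto
      then have "xs' = []" using lt1 less.prems xs by auto
      then show ?thesis using Nil xs \<open>x' = 1\<close> \<open>y = 1\<close> by simp
    next
      case ys: (Cons y1 ys')
      have yy: "y < y1" "y1 - y \<le> \<eta>" "y1 \<in> {0..1}" using less.prems ys by auto
      have f: "d (p u) (p v) \<le> \<theta>" if "u \<in> {y..y1}" "v \<in> {y..y1}" for u v
        using that yy in01 by (intro dle fine) auto
      show ?thesis
      proof (cases "y1 \<le> x'")
        \<comment> \<open>The next fine point \<open>y1\<close> still lies in the first coarse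
          interval, so it is close to the vertex at x, and y can be flipped to x.\<close>
        case True
        have "p x # map p (y # ys) \<simeq> p x # p x # p y1 # map p ys'"
          unfolding ys list.map
          by (rule heq_square_Cons) (use xu y yy f True theta_nonneg in auto)
        also have "\<dots> \<simeq> p x # map p (y1 # ys')"
          using heq_sym[OF heq_dup_Cons[of "p x" "map p (y1 # ys')"]] by simp
        also have "\<dots> \<simeq> map p (x # xs)"
          by (rule less.hyps) (use less.prems xs ys y yy True in auto)
        finally show ?thesis .
      next
        \<comment> \<open>Now \<open>x'\<close> lies between y and \<open>y1\<close>. It is inserted
          by doubling y and flipping the second copy; then y is absorbed into x, and the comparison
          restarts with \<open>x'\<close> as first point of both subdivisions.\<close>
        case False
        have "p x # map p (y # ys) \<simeq> p x # p y # p y # p y1 # map p ys'"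
          unfolding ys list.map by (intro heq_Cons heq_dup_Cons)
        also have "\<dots> \<simeq> p x # p y # p x' # p y1 # map p ys'"
          by (rule heq_Cons, rule heq_square_Cons) (use y yy f False theta_nonneg in auto)
        also have "\<dots> \<simeq> p x # p x # p x' # p y1 # map p ys'"
          by (rule heq_square_Cons) (use xu y yy f False theta_nonneg in auto)
        also have "\<dots> \<simeq> p x # p x' # p y1 # map p ys'"
          by (rule heq_sym[OF heq_dup_Cons])
        also have "\<dots> \<simeq> p x # p x' # map p (x' # y1 # ys')"
          using heq_Cons[OF heq_dup_Cons[of "p x'" "map p (y1 # ys')"], of "p x"] by simp
        also have "\<dots> \<simeq> p x # map p (x' # xs')"
          by (rule heq_Cons, rule less.hyps) (use less.prems xs ys y yy False in \<open>auto simp: successively_Cons\<close>)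
        finally show ?thesis using xs by simp
      qed
    qed
  qed
qed

text \<open>Valid for all larger n, so that one uniform subdivision can meet several requirements at
  once.\<close>

lemma fine_unif:
  assumes "path p" "0 < e"
  obtains N where "0 < N" "\<And>n u v. N \<le> n \<Longrightarrow> u \<in> {0..1} \<Longrightarrow> v \<in> {0..1} \<Longrightarrow> \<bar>u - v\<bar> \<le> 1 / real n \<Longrightarrow> dist (p u) (p v) < e"
proof -
  obtain \<delta> where \<delta>: "0 < \<delta>" "\<And>u v. u \<in> {0..1} \<Longrightarrow> v \<in> {0..1} \<Longrightarrow> \<bar>u - v\<bar> < \<delta> \<Longrightarrow> dist (p u) (p v) < e"
    using path_uniformly_continuous[OF assms] by blast
  obtain N where N: "0 < N" "1 / real N < \<delta>" using \<delta>(1) nat_approx_posE by (metis zero_less_Suc)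
  show ?thesis
  proof (rule that[OF N(1)])
    fix n u v assume "N \<le> n" "u \<in> {0..1}" "v \<in> {0..1}" and uv: "\<bar>u - v\<bar> \<le> 1 / real n"
    have "1 / real n \<le> 1 / real N" using N \<open>N \<le> n\<close> by (simp add: frac_le)
    then show "dist (p u) (p v) < e" using uv N \<open>u \<in> _\<close> \<open>v \<in> _\<close> by (intro \<delta>) auto
  qed
qed

lemma unif_succ: "Suc i \<le> n \<Longrightarrow> unif n ! Suc i - unif n ! i = 1 / real n"
  by (simp add: unif_nth field_simps)

lemma unif_in01: "i \<le> n \<Longrightarrow> unif n ! i \<in> {0..1}"
  by (cases "n = 0") (auto simp: unif_nth)

lemma set_unif: "set (unif n) \<subseteq> {0..1}"
  using unif_in01[of _ n] by (auto simp: in_set_conv_nth less_Suc_eq_le)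

lemma sampling_unif:
  assumes "\<And>u v. u \<in> {0..1} \<Longrightarrow> v \<in> {0..1} \<Longrightarrow> \<bar>u - v\<bar> \<le> 1 / real n \<Longrightarrow> t * dist (p u) (p v) \<le> \<theta>"
    and "0 < n"
  shows "sampling t \<theta> p (unif n)"
proof -
  have "t * dist (p (unif n ! i)) (p u) \<le> \<theta>" if "Suc i < length (unif n)" "u \<in> {unif n ! i..unif n ! Suc i}" for i u
    using that unif_succ[of i n] unif_in01[of i n] unif_in01[of "Suc i" n] by (intro assms) auto
  then show ?thesis using assms(2) by (auto simp: sampling_def unif_sorted unif_hd)
qed

lemma fine_unif_sampling:
  assumes "path p"
  obtains N where "0 < N"
    "\<And>n u v. N \<le> n \<Longrightarrow> u \<in> {0..1} \<Longrightarrow> v \<in> {0..1} \<Longrightarrow> \<bar>u - v\<bar> \<le> 1 / real n \<Longrightarrow> t * dist (p u) (p v) \<le> \<theta>"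
proof -
  have "0 < \<theta> / t" using t_pos theta_pos by simp
  then obtain N where N: "0 < N"
    "\<And>n u v. N \<le> n \<Longrightarrow> u \<in> {0..1} \<Longrightarrow> v \<in> {0..1} \<Longrightarrow> \<bar>u - v\<bar> \<le> 1 / real n \<Longrightarrow> dist (p u) (p v) < \<theta> / t"
    using fine_unif[OF assms] by blast
  show ?thesis
  proof (rule that[OF N(1)])
    fix n u v assume "N \<le> n" "u \<in> {0..1}" "v \<in> {0..1}" "\<bar>u - v\<bar> \<le> 1 / real n"
    then have "dist (p u) (p v) < \<theta> / t" by (rule N(2))
    then show "t * dist (p u) (p v) \<le> \<theta>" using t_pos by (simp add: pos_less_divide_eq mult.commute)
  qed
qed

lemma sampling_unif_eventually:
  assumes "path p"
  shows "\<exists>N. \<forall>n\<ge>N. sampling t \<theta> p (unif n)"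
proof -
  obtain N where N: "0 < N"
    "\<And>n u v. N \<le> n \<Longrightarrow> u \<in> {0..1} \<Longrightarrow> v \<in> {0..1} \<Longrightarrow> \<bar>u - v\<bar> \<le> 1 / real n \<Longrightarrow> t * dist (p u) (p v) \<le> \<theta>"
    using fine_unif_sampling[OF assms] by blast
  show ?thesis
    by (intro exI[of _ N] allI impI, rule sampling_unif) (use N in auto)
qed

lemma samples_exists: "path p \<Longrightarrow> \<exists>zs. samples p zs"
  using sampling_unif_eventually unfolding samples_def by (metis order_refl)

text \<open>A refinement of a sampling can fail to be a sampling, since the condition measures only
  from the left end of each interval. Hence there is no passage to a common refinement: both
  samplings are compared with one uniform subdivision that is fine enough for p.\<close>

lemma samples_heq:
  assumes "path p" "samples p zs" "samples p zs'"
  shows "zs \<simeq> zs'"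
proof -
  obtain N where N: "0 < N"
    "\<And>n u v. N \<le> n \<Longrightarrow> u \<in> {0..1} \<Longrightarrow> v \<in> {0..1} \<Longrightarrow> \<bar>u - v\<bar> \<le> 1 / real n \<Longrightarrow> t * dist (p u) (p v) \<le> \<theta>"
    using fine_unif_sampling[OF assms(1)] by blast
  have "map p (unif N) \<simeq> ws" if ws: "samples p ws" for ws
  proof -
    obtain ts where ts: "sampling t \<theta> p ts" "ws = map p ts" using ws by (auto simp: samples_def)
    note s = sampling_imp[OF ts(1)]
    obtain xs where xs: "ts = 0 # xs" using s by (cases ts) auto
    obtain ys where ys: "unif N = 0 # ys" using unif_hd(1)[OF N(1)] length_unif[of N]
      by (cases "unif N") auto
    have f: "successively (\<lambda>a b. a < b \<and> b - a \<le> 1 / real N) (unif N)"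
      using unif_sorted[OF N(1)] unif_succ[of _ N]
      by (auto simp: successively_conv_nth sorted_wrt_iff_nth_less)
    have h: "xs \<noteq> [] \<Longrightarrow> 0 \<le> hd xs" using s(5) xs by (cases xs) auto
    have "p 0 # map p (0 # ys) \<simeq> map p (0 # xs)"
      by (rule heq_sampling_fine[where \<eta> = "1 / real N"])
        (use N s xs ys f h unif_hd(2)[OF N(1)] set_unif[of N] in auto)
    then show ?thesis
      using heq_trans[OF heq_dup_Cons[of "p 0" "map p ys"]] xs ys ts(2) by simp
  qed
  from this[OF assms(2)] this[OF assms(3)] show ?thesis by (rule heq_trans[OF heq_sym])
qed

text \<open>On a square grid adapted to the uniform continuity of the homotopy every row is a
  sampling and neighbouring rows are the sides of a ladder.\<close>

lemma samples_homotopic: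
  assumes "homotopic_paths UNIV p q" "samples p zs" "samples q zs'"
  shows "zs \<simeq> zs'"
proof -
  obtain h where h: "continuous_on ({0..1} \<times> {0..1}) h"
    "\<And>x. x \<in> {0..1} \<Longrightarrow> h (0, x) = p x" "\<And>x. x \<in> {0..1} \<Longrightarrow> h (1, x) = q x"
    "\<And>s. s \<in> {0..1::real} \<Longrightarrow> h (s, 0) = p 0 \<and> h (s, 1) = p 1"
    using assms(1) unfolding homotopic_paths by (auto simp: pathstart_def pathfinish_def)
  have "uniformly_continuous_on ({0..1} \<times> {0..1}) h"
    by (intro compact_uniformly_continuous h compact_Times compact_Icc)
  moreover have "0 < \<theta> / t" using t_pos theta_pos by simp
  ultimately obtain \<delta> where \<delta>: "0 < \<delta>"
    "\<And>a b. a \<in> {0..1} \<times> {0..1} \<Longrightarrow> b \<in> {0..1} \<times> {0..1} \<Longrightarrow> dist b a < \<delta> \<Longrightarrow> dist (h b) (h a) < \<theta> / t"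
    unfolding uniformly_continuous_on_def by metis
  obtain n where n: "0 < n" "1 / real n < \<delta>" using \<delta>(1) nat_approx_posE by (metis zero_less_Suc)
  have hd: "t * dist (h a) (h b) \<le> \<theta>"
    if "a \<in> {0..1} \<times> {0..1}" "b \<in> {0..1} \<times> {0..1}" "dist a b \<le> 1 / real n" for a b
  proof -
    have "dist (h a) (h b) < \<theta> / t" using that n by (intro \<delta>) auto
    then show ?thesis using t_pos by (simp add: pos_less_divide_eq mult.commute)
  qed
  let ?row = "\<lambda>j. map (\<lambda>x. h (unif n ! j, x)) (unif n)"
  have row: "samples (\<lambda>x. h (unif n ! j, x)) (?row j)" if "j \<le> n" for j
    unfolding samples_def
    by (rule exI[of _ "unif n"], intro conjI sampling_unif hd HOL.refl)
      (use n unif_in01[OF that] in \<open>auto simp: dist_Pair_Pair dist_real_def\<close>)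
  have "?row 0 \<simeq> ?row j" if "j \<le> n" for j
    using that
  proof (induction j)
    case (Suc j)
    then have "?row 0 \<simeq> ?row j" by simp
    also have "\<dots> \<simeq> ?row (Suc j)"
    proof (rule ladder_closed)
      have "d (h (unif n ! j, x)) (h (unif n ! Suc j, x)) \<le> \<theta>" if "x \<in> set (unif n)" for x
      proof (rule order_trans[OF d_le hd])
        show "dist (unif n ! j, x) (unif n ! Suc j, x) \<le> 1 / real n"
          using unif_succ[of j n] Suc.prems abs_minus_commute[of "unif n ! j" "unif n ! Suc j"]
          by (simp add: dist_Pair_Pair dist_real_def)
      qed (use subsetD[OF set_unif that] unif_in01[of j n] unif_in01[of "Suc j" n] Suc.prems in auto)
      then show "list_all2 (\<lambda>x y. d x y \<le> \<theta>) (?row j) (?row (Suc j))"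
        by (simp add: list_all2_conv_all_nth)
      show "tpath (?row j)" "tpath (?row (Suc j))"
        using samples_imp(1)[OF row] Suc.prems by auto
      show "hd (?row j) = hd (?row (Suc j))" "last (?row j) = last (?row (Suc j))"
        using unif_hd[OF n(1)] h(4)[of "unif n ! j"] h(4)[of "unif n ! Suc j"]
          unif_in01[of j n] unif_in01[of "Suc j" n] Suc.prems
        by (auto simp: hd_map last_map)
    qed
    finally show ?case .
  qed simp
  then have "?row 0 \<simeq> ?row n" by simp
  moreover have "?row 0 = map p (unif n)" "?row n = map q (unif n)"
    using h set_unif[of n] unif_nth[of 0 n] unif_nth[of n n] n by auto
  moreover have "samples p (map p (unif n))" "samples q (map q (unif n))"
  proof -
    have "sampling t \<theta> p (unif n)"
      by (rule sampling_unif[OF _ n(1)]) (use hd[of "(0, _)" "(0, _)"] h(2) in \<open>auto simp: dist_Pair_Pair dist_real_def\<close>)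
    then show "samples p (map p (unif n))" by (auto simp: samples_def)
    have "sampling t \<theta> q (unif n)"
      by (rule sampling_unif[OF _ n(1)]) (use hd[of "(1, _)" "(1, _)"] h(3) in \<open>auto simp: dist_Pair_Pair dist_real_def\<close>)
    then show "samples q (map q (unif n))" by (auto simp: samples_def)
  qed
  ultimately have "map p (unif n) \<simeq> map q (unif n)" "zs \<simeq> map p (unif n)" "map q (unif n) \<simeq> zs'"
    using samples_heq assms homotopic_paths_imp_path[OF assms(1)] by auto
  then show ?thesis by (blast intro: heq_trans)
qed

lemma samples_join:
  assumes "samples p zs" "samples q zs'" "pathfinish p = pathstart q"
  shows "samples (p +++ q) (zs @ tl zs')"
proof -
  obtain ts us where ts: "sampling t \<theta> p ts" "zs = map p ts" and us: "sampling t \<theta> q us" "zs' = map q us"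
    using assms by (auto simp: samples_def)
  note s = sampling_imp[OF ts(1)] and s' = sampling_imp[OF us(1)]
  \<comment> \<open>The two halves of the parameter interval of the joined path; the last point of
    the first subdivision and the first point of the second coincide at 1/2, which is why
    \<open>tl\<close> drops one of them.\<close>
  let ?f = "\<lambda>x::real. x / 2" and ?g = "\<lambda>x::real. (x + 1) / 2"
  let ?r = "p +++ q"
  obtain us' where us': "us = 0 # us'" "us' \<noteq> []"
    using s' by (cases us; cases "tl us") auto
  have rp: "?r (x / 2) = p x" if "x \<le> 1" for x using that by (simp add: joinpaths_def)
  have rq: "?r ((x + 1) / 2) = q x" if "0 \<le> x" for x
  proof -
    have e: "2 * ((x + 1) / 2) = x + 1" by simp
    show ?thesis
      using that assms(3) unfolding joinpaths_def e
      by (cases "x = 0") (auto simp: pathfinish_def pathstart_def)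
  qed
  define Q where "Q = (\<lambda>a b. a < b \<and> (\<forall>u\<in>{a..b}. t * dist (?r a) (?r u) \<le> \<theta>))"
  have 1: "successively Q (map ?f ts)"
    unfolding Q_def successively_map
  proof (rule successively_mono[OF s(5)])
    fix a b assume ab: "a \<in> set ts" "b \<in> set ts" "a < b \<and> (\<forall>u\<in>{a..b}. t * dist (p a) (p u) \<le> \<theta>)"
    have "t * dist (?r (a / 2)) (?r u) \<le> \<theta>" if "u \<in> {a / 2..b / 2}" for u
    proof -
      have "t * dist (p a) (p (2 * u)) \<le> \<theta>" using ab that by auto
      then show ?thesis using rp[of a] rp[of "2 * u"] ab that s(4) by auto
    qed
    then show "a / 2 < b / 2 \<and> (\<forall>u\<in>{a / 2..b / 2}. t * dist (?r (a / 2)) (?r u) \<le> \<theta>)" using ab by simp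
  qed
  have 2: "successively Q (map ?g us)"
    unfolding Q_def successively_map
  proof (rule successively_mono[OF s'(5)])
    fix a b assume ab: "a \<in> set us" "b \<in> set us" "a < b \<and> (\<forall>u\<in>{a..b}. t * dist (q a) (q u) \<le> \<theta>)"
    have "t * dist (?r ((a + 1) / 2)) (?r u) \<le> \<theta>" if "u \<in> {(a + 1) / 2..(b + 1) / 2}" for u
    proof -
      have "t * dist (q a) (q (2 * u - 1)) \<le> \<theta>" using ab that by auto
      then show ?thesis using rq[of a] rq[of "2 * u - 1"] ab that s'(4) by auto
    qed
    then show "(a + 1) / 2 < (b + 1) / 2 \<and> (\<forall>u\<in>{(a + 1) / 2..(b + 1) / 2}. t * dist (?r ((a + 1) / 2)) (?r u) \<le> \<theta>)"
      using ab by simp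
  qed
  have mid: "last (map ?f ts) = 1 / 2" using s by (simp add: last_map)
  from 2 us' have "successively Q ((1 / 2) # map ?g us')" by simp
  then have "Q (last (map ?f ts)) (hd (map ?g us'))" "successively Q (map ?g us')"
    unfolding mid using us'(2) by (simp_all add: successively_Cons)
  then have succ: "successively Q (map ?f ts @ tl (map ?g us))"
    using 1 us' by (simp add: successively_append_iff)
  let ?ts = "map ?f ts @ tl (map ?g us)"
  have "successively (<) ?ts" by (rule successively_mono[OF succ]) (simp add: Q_def)
  then have "sorted_wrt (<) ?ts" by (subst (asm) successively_conv_sorted_wrt) auto
  moreover have "2 \<le> length ?ts" using us' s(1) by (cases ts; cases us') auto
  moreover have "hd ?ts = 0" "last ?ts = 1"
    using s s' us' by (auto simp: hd_map last_map hd_append)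
  ultimately have "sampling t \<theta> ?r ?ts"
    using succ by (auto simp: sampling_def successively_conv_nth Q_def)
  moreover have "map ?r ?ts = zs @ tl zs'"
    using ts us us' s(4) s'(4) by (auto simp: rp rq)
  ultimately show ?thesis unfolding samples_def by metis
qed

lemma samples_const: "samples (\<lambda>_. x) [x, x]"
  unfolding samples_def sampling_def using theta_pos
  by (intro exI[of _ "[0, 1]"]) auto

text \<open>One subdivision for p and for its image puts the two lists of vertices in
  correspondence, so that they can serve as the sides of a ladder.\<close>

lemma samples_common:
  assumes "path p" "path (f \<circ> p)"
  obtains zs where "samples p zs" "samples (f \<circ> p) (map f zs)"
proof -
  obtain N where N: "\<forall>n\<ge>N. sampling t \<theta> p (unif n)"
    using sampling_unif_eventually[OF assms(1)] by blast
  obtain M where M: "\<forall>n\<ge>M. sampling t \<theta> (f \<circ> p) (unif n)"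
    using sampling_unif_eventually[OF assms(2)] by blast
  have "sampling t \<theta> p (unif (max N M))" "sampling t \<theta> (f \<circ> p) (unif (max N M))"
    using N M by simp_all
  then show ?thesis by (intro that[of "map p (unif (max N M))"]) (auto simp: samples_def)
qed

end

section \<open>The target group\<close>

locale warped_action = based_paths x0 \<beta>
  for x0 :: "'x::metric_space" and \<beta> :: "'x \<Rightarrow> real \<Rightarrow> 'x" +
  fixes \<Gamma> :: "'g monoid" and act :: "'g \<Rightarrow> 'x \<Rightarrow> 'x"
    and S :: "'s set" and \<eta> :: "'s \<Rightarrow> 'g" and R :: "'s letter list set"
    and \<rho> :: "'s letter list \<Rightarrow> 'x \<Rightarrow> 'x"
    and \<alpha> :: "'s \<Rightarrow> real \<Rightarrow> 'x" and \<theta> :: nat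
  assumes compact_space: "compact (UNIV :: 'x set)"
    and loc_path_conn: "locally path_connected (UNIV :: 'x set)"
    and slsc: "semilocally_simply_connected (UNIV :: 'x set)"
    and geodesic: "geodesic_space (UNIV :: 'x set)"
    and finite_S: "finite S" and pres: "presentation \<Gamma> S \<eta> R"
    and act: "group_action \<Gamma> UNIV act"
    and homeo: "\<And>g. g \<in> carrier \<Gamma> \<Longrightarrow> \<exists>h. homeomorphism UNIV UNIV (act g) h"
    and free: "\<And>g x. g \<in> carrier \<Gamma> \<Longrightarrow> act g x = x \<Longrightarrow> g = \<one>\<^bsub>\<Gamma>\<^esub>"
    and rho: "\<rho> = free_action \<Gamma> \<eta> act"
    and alpha: "\<And>s. s \<in> S \<Longrightarrow> path (\<alpha> s) \<and> pathstart (\<alpha> s) = x0 \<and> pathfinish (\<alpha> s) = \<rho> [(s, True)] x0"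
    and theta_ge1: "1 \<le> \<theta>"
begin

text \<open>Unreduced words. Paths, jumps and labels are recursive in the word and multiply by plain
  concatenation; reduction enters only on passing to \<open>F\<close>, through invariance under
  cancelling a letter against its inverse.\<close>

definition words :: "'s letter list set" where "words = lists (S \<times> UNIV)"

lemma words_simps [simp]:
  "[] \<in> words" "l # w \<in> words \<longleftrightarrow> l \<in> S \<times> UNIV \<and> w \<in> words"
  "u @ v \<in> words \<longleftrightarrow> u \<in> words \<and> v \<in> words" "inv_word w \<in> words \<longleftrightarrow> w \<in> words"
  by (simp_all add: words_def)

lemma normal_form_words [simp]: "w \<in> words \<Longrightarrow> normal_form w \<in> words"
  by (simp add: words_def normal_form_in_lists)

abbreviation "F \<equiv> free_group S"
abbreviation "R\<theta> \<equiv> short_relators S R \<theta>"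
abbreviation "N\<theta> \<equiv> normal_closure F R\<theta>"
abbreviation "val \<equiv> word_val \<Gamma> \<eta>"

sublocale F: group F by (rule group_free_group)
sublocale Gam: group \<Gamma> using pres by (simp add: presentation_def)

lemma carrier_F: "w \<in> carrier F \<longleftrightarrow> w \<in> words \<and> reduced w"
  by (simp add: carrier_free_group words_def)

lemma carrier_F_words [simp]: "w \<in> carrier F \<Longrightarrow> w \<in> words"
  by (simp add: carrier_F)

lemma normal_form_carrier [simp]: "w \<in> words \<Longrightarrow> normal_form w \<in> carrier F"
  by (simp add: carrier_F nf_reduced)

lemma normal_form_F [simp]: "w \<in> carrier F \<Longrightarrow> normal_form w = w"
  by (simp add: carrier_F nf_id)

lemma inv_normal_form: "w \<in> words \<Longrightarrow> inv\<^bsub>F\<^esub> (normal_form w) = normal_form (inv_word w)"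
proof (rule F.inv_equality)
  assume w: "w \<in> words"
  have "normal_form (normal_form (inv_word w) @ normal_form w) = normal_form (inv_word w @ w)"
    by (simp only: normal_form_append_normal_form)
  then show "normal_form (inv_word w) \<otimes>\<^bsub>F\<^esub> normal_form w = \<one>\<^bsub>F\<^esub>"
    by (simp add: free_group_simps normal_form_inv_word)
qed simp_all

lemma words_invariant:
  assumes "w \<in> words"
    and "\<And>w. w \<in> words \<Longrightarrow> E w w"
    and "\<And>u v w. E u v \<Longrightarrow> E v w \<Longrightarrow> E u w"
    and "\<And>l u v. l \<in> S \<times> UNIV \<Longrightarrow> u \<in> words \<Longrightarrow> v \<in> words \<Longrightarrow> E u v \<Longrightarrow> E (l # u) (l # v)"
    and "\<And>l v. l \<in> S \<times> UNIV \<Longrightarrow> v \<in> words \<Longrightarrow> E (l # inv_letter l # v) v"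
  shows "E w (normal_form w)"
  by (rule normal_form_invariant[where A = "S \<times> UNIV" and E = E])
    (use assms in \<open>simp_all add: words_def\<close>)

section \<open>Values of words in the group and their action on the space\<close>

lemma letter_val_closed [simp]: "l \<in> S \<times> UNIV \<Longrightarrow> letter_val \<Gamma> \<eta> l \<in> carrier \<Gamma>"
  using pres by (auto simp: letter_val_def presentation_def)

lemma val_simps [simp]: "val [] = \<one>\<^bsub>\<Gamma>\<^esub>" "val (l # w) = letter_val \<Gamma> \<eta> l \<otimes>\<^bsub>\<Gamma>\<^esub> val w"
  by (simp_all add: word_val_def)

lemma val_closed [simp]: "w \<in> words \<Longrightarrow> val w \<in> carrier \<Gamma>"
  by (induction w) simp_all

lemma val_append: "u \<in> words \<Longrightarrow> v \<in> words \<Longrightarrow> val (u @ v) = val u \<otimes>\<^bsub>\<Gamma>\<^esub> val v"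
  by (induction u) (simp_all add: Gam.m_assoc)

lemma letter_val_inv:
  "l \<in> S \<times> UNIV \<Longrightarrow> letter_val \<Gamma> \<eta> (inv_letter l) = inv\<^bsub>\<Gamma>\<^esub> letter_val \<Gamma> \<eta> l"
proof -
  assume "l \<in> S \<times> UNIV"
  then have "\<eta> (fst l) \<in> carrier \<Gamma>" using pres by (auto simp: presentation_def)
  then show ?thesis by (simp add: letter_val_def inv_letter_def)
qed

lemma val_inv_word: "w \<in> words \<Longrightarrow> val (inv_word w) = inv\<^bsub>\<Gamma>\<^esub> val w"
  by (induction w) (simp_all add: val_append letter_val_inv Gam.inv_mult_group)

lemma val_normal_form: "w \<in> words \<Longrightarrow> val (normal_form w) = val w"
proof -
  assume "w \<in> words"
  then have "val w = val (normal_form w)"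
    by (rule words_invariant[where E = "\<lambda>u v. val u = val v"])
      (simp_all add: letter_val_inv Gam.inv_cancel)
  then show ?thesis ..
qed

lemma rho_val: "\<rho> w = act (val w)"
  by (simp add: rho free_action_def)

lemma rho_Nil: "\<rho> [] = (\<lambda>x. x)"
  using group_action.id_eq_one[OF act] by (simp add: rho_val restrict_def)

lemma rho_append: "u \<in> words \<Longrightarrow> v \<in> words \<Longrightarrow> \<rho> (u @ v) x = \<rho> u (\<rho> v x)"
  by (simp add: rho_val val_append group_action.composition_rule[OF act])

lemma rho_Cons: "l \<in> S \<times> UNIV \<Longrightarrow> w \<in> words \<Longrightarrow> \<rho> (l # w) x = \<rho> [l] (\<rho> w x)"
  using rho_append[of "[l]" w x] by simp

lemma rho_cong: "val u = val v \<Longrightarrow> \<rho> u = \<rho> v"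
  by (simp add: rho_val)

lemma rho_trivial: "val w = \<one>\<^bsub>\<Gamma>\<^esub> \<Longrightarrow> \<rho> w = (\<lambda>x. x)"
  using rho_cong[of w "[]"] by (simp add: rho_Nil)

lemma rho_cancel:
  assumes "w \<in> words"
  shows "\<rho> w (\<rho> (inv_word w) x) = x" "\<rho> (inv_word w) (\<rho> w x) = x"
  using assms rho_append[of w "inv_word w" x] rho_append[of "inv_word w" w x]
  by (simp_all add: rho_trivial val_append val_inv_word)

lemma rho_cancel_letter: "l \<in> S \<times> UNIV \<Longrightarrow> \<rho> [l] (\<rho> [inv_letter l] x) = x"
  using rho_cancel(1)[of "[l]" x] by simp

lemma rho_normal_form: "w \<in> words \<Longrightarrow> \<rho> (normal_form w) = \<rho> w"
  by (rule rho_cong) (rule val_normal_form)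

lemma rho_fixed: "w \<in> words \<Longrightarrow> \<rho> w x = x \<Longrightarrow> val w = \<one>\<^bsub>\<Gamma>\<^esub>"
  using free[of "val w" x] by (simp add: rho_val)

lemma rho_continuous: "w \<in> words \<Longrightarrow> continuous_on UNIV (\<rho> w)"
  using homeo[of "val w"] by (auto simp: rho_val homeomorphism_def)

lemma rho_path [simp]: "w \<in> words \<Longrightarrow> path p \<Longrightarrow> path (\<rho> w \<circ> p)"
  by (rule path_compose_UNIV[OF rho_continuous])

lemma rho_comp_append: "u \<in> words \<Longrightarrow> v \<in> words \<Longrightarrow> \<rho> u \<circ> (\<rho> v \<circ> p) = \<rho> (u @ v) \<circ> p"
  by (auto simp: rho_append)

lemma rho_comp_Nil [simp]: "\<rho> [] \<circ> p = p"
  by (auto simp: rho_Nil)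

lemmas path_compose = path_compose_join path_compose_reversepath pathstart_compose pathfinish_compose

lemma ker_val: "kernel F \<Gamma> val = normal_closure F R"
  using pres by (simp add: presentation_def)

lemma R\<theta>_iff: "r \<in> R\<theta> \<longleftrightarrow> r \<in> carrier F \<and> val r = \<one>\<^bsub>\<Gamma>\<^esub> \<and> length r \<le> 4 * \<theta>"
  unfolding short_relators_def ker_val[symmetric] by (auto simp: kernel_def)

lemma val_hom: "val \<in> hom F \<Gamma>"
  by (rule homI) (simp_all add: free_group_simps val_normal_form val_append)

lemma N\<theta>_normal: "N\<theta> \<lhd> F"
  by (rule normal_closure_normal[OF group_free_group]) (auto simp: R\<theta>_iff)

sublocale N\<theta>: normal N\<theta> F by (rule N\<theta>_normal)

lemma N\<theta>_val: "r \<in> N\<theta> \<Longrightarrow> val r = \<one>\<^bsub>\<Gamma>\<^esub>"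
proof -
  interpret h: group_hom F \<Gamma> val
    using val_hom by (simp add: group_hom_def group_hom_axioms_def F.is_group Gam.is_group)
  have "N\<theta> \<subseteq> kernel F \<Gamma> val"
    by (rule normal_closure_least[OF h.normal_kernel]) (auto simp: R\<theta>_iff kernel_def)
  then show "r \<in> N\<theta> \<Longrightarrow> val r = \<one>\<^bsub>\<Gamma>\<^esub>" by (auto simp: kernel_def)
qed

lemma N\<theta>_carrier: "r \<in> N\<theta> \<Longrightarrow> r \<in> carrier F"
  by (rule N\<theta>.mem_carrier)

lemma N\<theta>_rho: "r \<in> N\<theta> \<Longrightarrow> \<rho> r = (\<lambda>x. x)"
  by (intro rho_trivial N\<theta>_val)

lemma N\<theta>_conj: "w \<in> words \<Longrightarrow> r \<in> N\<theta> \<Longrightarrow> normal_form (w @ r @ inv_word w) \<in> N\<theta>"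
  using N\<theta>.inv_op_closed2[of "normal_form w" r] N\<theta>_carrier[of r]
  by (simp add: free_group_simps inv_normal_form normal_form_append_normal_form)

subsection \<open>The connecting paths\<close>

abbreviation "apath \<equiv> word_path \<rho> \<alpha> x0"

lemma letter_path_props:
  assumes "l \<in> S \<times> UNIV"
  shows "path (letter_path \<rho> \<alpha> l) \<and> pathstart (letter_path \<rho> \<alpha> l) = x0 \<and>
    pathfinish (letter_path \<rho> \<alpha> l) = \<rho> [l] x0"
proof -
  obtain s b where l: "l = (s, b)" "s \<in> S" using assms by auto
  show ?thesis
    using l alpha[OF l(2)] rho_cancel_letter[of "(s, False)" x0]
    by (cases b) (auto simp: letter_path_def path_compose inv_letter_def)
qed

text \<open>The convention for the path of an inverse generator, in a form valid for both signs of
  the letter. It makes the path of the word l l^-1 a path followed by its reverse, so that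
  cancellation does not change the class.\<close>

lemma letter_path_inv:
  assumes "l \<in> S \<times> UNIV"
  shows "\<rho> [l] \<circ> letter_path \<rho> \<alpha> (inv_letter l) = reversepath (letter_path \<rho> \<alpha> l)"
proof -
  obtain s b where l: "l = (s, b)" "s \<in> S" using assms by auto
  have "\<rho> [(s, True)] \<circ> (\<rho> [(s, False)] \<circ> p) = p" for p :: "real \<Rightarrow> 'x"
    using rho_cancel_letter[of "(s, True)"] l by (auto simp: inv_letter_def)
  then show ?thesis using l
    by (cases b) (simp_all add: letter_path_def inv_letter_def path_compose_reversepath)
qed

lemma apath_props [simp]:
  assumes "w \<in> words"
  shows "path (apath w)" "pathstart (apath w) = x0" "pathfinish (apath w) = \<rho> w x0"
proof -
  have "path (apath w) \<and> pathstart (apath w) = x0 \<and> pathfinish (apath w) = \<rho> w x0"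
    using assms
  proof (induction w)
    case (Cons l w)
    then have "l \<in> S \<times> UNIV" "w \<in> words" by simp_all
    with Cons.IH letter_path_props[of l] show ?case
      by (simp add: path_compose rho_Cons[symmetric])
  qed (simp add: rho_Nil)
  then show "path (apath w)" "pathstart (apath w) = x0" "pathfinish (apath w) = \<rho> w x0" by simp_all
qed

lemma L_apath_Cons:
  assumes "g \<in> words" "l \<in> S \<times> UNIV" "w \<in> words"
  shows "L (\<rho> g \<circ> apath (l # w)) =
    L (\<rho> g \<circ> letter_path \<rho> \<alpha> l) \<cdot> L (\<rho> (g @ [l]) \<circ> apath w)"
  using assms letter_path_props[OF assms(2)]
  by (simp add: path_compose L_join rho_comp_append rho_append)

text \<open>The cocycle rule for \<alpha>, for all translates at once: the recursion translates the
  tail of the word, and the closing paths \<beta> are not assumed equivariant, so g has to be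
  carried through the induction.\<close>

lemma L_apath_append:
  assumes "u \<in> words" "v \<in> words" "g \<in> words"
  shows "L (\<rho> g \<circ> apath (u @ v)) = L (\<rho> g \<circ> apath u) \<cdot> L (\<rho> (g @ u) \<circ> apath v)"
  using assms(1,3)
proof (induction u arbitrary: g)
  case (Cons l u)
  then have "l \<in> S \<times> UNIV" "u \<in> words" by simp_all
  note lu = this and lp = letter_path_props[OF this(1)] and g = \<open>g \<in> words\<close>
  have gl: "g @ [l] \<in> words" using g lu(1) by simp
  have "L (\<rho> g \<circ> apath ((l # u) @ v)) =
      L (\<rho> g \<circ> letter_path \<rho> \<alpha> l) \<cdot> L (\<rho> (g @ [l]) \<circ> apath (u @ v))"
    using L_apath_Cons[OF g lu(1), of "u @ v"] lu assms(2) unfolding append_Cons by simp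
  also have "\<dots> = L (\<rho> g \<circ> letter_path \<rho> \<alpha> l) \<cdot>
      (L (\<rho> (g @ [l]) \<circ> apath u) \<cdot> L (\<rho> ((g @ [l]) @ u) \<circ> apath v))"
    unfolding Cons.IH[OF lu(2) gl] ..
  also have "\<dots> = L (\<rho> g \<circ> letter_path \<rho> \<alpha> l) \<cdot> L (\<rho> (g @ [l]) \<circ> apath u) \<cdot>
      L (\<rho> ((g @ [l]) @ u) \<circ> apath v)"
    using lu lp g gl assms(2) by (subst pi.m_assoc) (simp_all del: append.assoc append_assoc)
  also have "\<dots> = L (\<rho> g \<circ> apath (l # u)) \<cdot> L (\<rho> (g @ l # u) \<circ> apath v)"
    unfolding L_apath_Cons[OF g lu] by simp
  finally show ?case .
qed (use assms(2) in simp)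

lemma L_apath_normal_form:
  assumes "w \<in> words" "g \<in> words"
  shows "L (\<rho> g \<circ> apath (normal_form w)) = L (\<rho> g \<circ> apath w)"
proof -
  have "\<forall>g\<in>words. L (\<rho> g \<circ> apath w) = L (\<rho> g \<circ> apath (normal_form w))"
  proof (rule words_invariant[where E = "\<lambda>u v. \<forall>g\<in>words. L (\<rho> g \<circ> apath u) = L (\<rho> g \<circ> apath v)"])
    show "w \<in> words" by fact
    fix l v assume lv: "l \<in> S \<times> (UNIV :: bool set)" "v \<in> words"
    show "\<forall>g\<in>words. L (\<rho> g \<circ> apath (l # inv_letter l # v)) = L (\<rho> g \<circ> apath v)"
    proof
      fix g assume g: "g \<in> words"
      have il: "inv_letter l \<in> S \<times> UNIV" using lv(1) by simp
      note lp = letter_path_props[OF lv(1)] letter_path_props[OF il]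
      have "\<rho> (g @ [l]) \<circ> letter_path \<rho> \<alpha> (inv_letter l) = reversepath (\<rho> g \<circ> letter_path \<rho> \<alpha> l)"
        using lv(1) g letter_path_inv[OF lv(1)]
        by (simp add: rho_comp_append[symmetric] path_compose)
      moreover have "\<rho> (g @ [l, inv_letter l]) = \<rho> g"
        using g lv(1) il by (intro rho_cong) (simp add: val_append letter_val_inv)
      ultimately show "L (\<rho> g \<circ> apath (l # inv_letter l # v)) = L (\<rho> g \<circ> apath v)"
        using g lv il lp
        by (simp add: L_apath_Cons L_reversepath pi.inv_cancel del: word_path.simps)
    qed
  qed (simp_all add: L_apath_Cons del: word_path.simps)
  with assms(2) show ?thesis by simp
qed

lemma L_apath_inv:
  assumes "w \<in> words" "g \<in> words"
  shows "L (\<rho> (g @ w) \<circ> apath (inv_word w)) = inv\<^bsub>FG\<^esub> L (\<rho> g \<circ> apath w)"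
proof -
  have "L (\<rho> g \<circ> apath w) \<cdot> L (\<rho> (g @ w) \<circ> apath (inv_word w)) = \<one>\<^bsub>FG\<^esub>"
    using L_apath_append[of w "inv_word w" g] L_apath_normal_form[of "w @ inv_word w" g] assms
    by (simp add: normal_form_inv_word)
  then show ?thesis using assms by (metis L_carrier apath_props(1) words_simps(3,4) pi.inv_equality pi.inv_comm rho_path)
qed

subsection \<open>The automorphisms\<close>

abbreviation "phi \<equiv> phi_S \<rho> \<alpha> x0"

lemma phi_loop:
  assumes w: "w \<in> words" and p: "p \<in> loops x0"
  shows "phi w (L p) = L (apath w +++ (\<rho> w \<circ> p) +++ reversepath (apath w))"
    "apath w +++ (\<rho> w \<circ> p) +++ reversepath (apath w) \<in> loops x0"
proof -
  let ?q = "\<lambda>p. apath w +++ (\<rho> w \<circ> p) +++ reversepath (apath w)"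
  show q: "?q p \<in> loops x0" using w p by (simp add: loops_simps path_compose)
  have "path_class (?q p') = path_class (?q p)" if "p' \<in> path_class p" for p'
  proof -
    have h: "homotopic_paths UNIV p p'" using that by (simp add: path_class_def)
    have "homotopic_paths UNIV (\<rho> w \<circ> p) (\<rho> w \<circ> p')"
      by (rule homotopic_paths_continuous_image[OF h rho_continuous[OF w]]) auto
    then have "homotopic_paths UNIV (?q p) (?q p')"
      using w p by (intro homotopic_paths_join) (auto simp: loops_simps path_compose)
    then show ?thesis using path_class_eq_iff[of "?q p" "?q p'"] q by (simp add: loops_simps)
  qed
  then have "(\<Union>p'\<in>path_class p. path_class (?q p')) = (\<Union>p'\<in>path_class p. path_class (?q p))"
    by (intro SUP_cong[OF HOL.refl])
  also have "\<dots> = path_class (?q p)" using p path_class_self[of p] by (auto simp: loops_simps)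
  finally show "phi w (L p) = L (?q p)" using q p by (simp add: phi_S_def L_loop)
qed

lemma phi_L:
  assumes "w \<in> words" "p \<in> loops x0"
  shows "phi w (L p) = L (apath w) \<cdot> L (\<rho> w \<circ> p) \<cdot> inv\<^bsub>FG\<^esub> L (apath w)"
  using assms phi_loop(1)[OF assms]
  by (simp add: L_join L_reversepath loops_simps path_compose pi.m_assoc)

lemma phi_closed [simp]: "w \<in> words \<Longrightarrow> A \<in> carrier FG \<Longrightarrow> phi w A \<in> carrier FG"
  by (erule L_carrierE) (simp add: phi_L loops_simps)

lemma phi_mult:
  assumes "w \<in> words" "A \<in> carrier FG" "B \<in> carrier FG"
  shows "phi w (A \<cdot> B) = phi w A \<cdot> phi w B"
proof -
  obtain p q where p: "p \<in> loops x0" "A = L p" and q: "q \<in> loops x0" "B = L q"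
    using assms L_carrierE by metis
  then have pq: "A \<cdot> B = L (p +++ q)" by (simp add: L_join loops_simps)
  show ?thesis
    unfolding pq phi_L[OF assms(1) loops_join[OF p(1) q(1)]]
    using p q assms(1)
    by (simp add: phi_L path_compose L_join loops_simps pi.m_assoc pi.inv_cancel)
qed

lemma phi_hom: "w \<in> words \<Longrightarrow> phi w \<in> hom FG FG"
  by (rule homI) (simp_all add: phi_mult)

lemma phi_append:
  assumes "u \<in> words" "v \<in> words" "A \<in> carrier FG"
  shows "phi (u @ v) A = phi u (phi v A)"
proof -
  obtain p where p: "p \<in> loops x0" "A = L p" using assms L_carrierE by metis
  have a: "L (apath (u @ v)) = L (apath u) \<cdot> L (\<rho> u \<circ> apath v)"
    using L_apath_append[of u v "[]"] assms by simp
  define c where "c = apath v +++ (\<rho> v \<circ> p) +++ reversepath (apath v)"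
  have c: "phi v A = L c" "c \<in> loops x0"
    using phi_loop[OF assms(2) p(1)] p(2) by (simp_all add: c_def)
  have "L (\<rho> u \<circ> c) = L (\<rho> u \<circ> apath v) \<cdot> (L (\<rho> (u @ v) \<circ> p) \<cdot> inv\<^bsub>FG\<^esub> L (\<rho> u \<circ> apath v))"
    using p assms by (simp add: c_def path_compose L_join L_reversepath loops_simps rho_comp_append rho_append)
  then show ?thesis
    unfolding c(1) using p assms a phi_L[OF assms(1) c(2)] phi_L[of "u @ v" p]
    by (simp add: loops_simps pi.m_assoc pi.inv_mult_group)
qed

lemma phi_normal_form:
  assumes "w \<in> words" "A \<in> carrier FG"
  shows "phi (normal_form w) A = phi w A"
proof -
  obtain p where p: "p \<in> loops x0" "A = L p" using assms L_carrierE by metis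
  show ?thesis using p assms(1) L_apath_normal_form[of w "[]"]
    by (simp add: phi_L rho_normal_form)
qed

lemma phi_Nil [simp]: "A \<in> carrier FG \<Longrightarrow> phi [] A = A"
  by (erule L_carrierE) (simp add: phi_L loops_simps)

subsection \<open>The groups \<open>G\<^sub>\<theta>\<close> and \<open>\<Gamma>\<^sub>\<theta>\<close>\<close>

definition M :: "(real \<Rightarrow> 'x) set set" where
  "M = normal_closure FG
     ({path_class (apath r) | r. r \<in> N\<theta>} \<union>
      {path_class (apath r +++ p +++ reversepath (apath r) +++ reversepath p) | r p.
         r \<in> N\<theta> \<and> p \<in> loops x0})"

lemma apath_relator_loop: "r \<in> N\<theta> \<Longrightarrow> apath r \<in> loops x0"
  using N\<theta>_carrier[of r] N\<theta>_rho[of r] by (simp add: loops_simps)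

lemma commutator_loop:
  assumes "r \<in> N\<theta>" "p \<in> loops x0"
  shows "apath r +++ p +++ reversepath (apath r) +++ reversepath p \<in> loops x0"
  using assms apath_relator_loop[OF assms(1)] by (simp add: loops_simps)

lemma M_normal: "M \<lhd> FG"
  unfolding M_def
  by (rule normal_closure_normal[OF group_fundamental_group])
    (use apath_relator_loop commutator_loop in \<open>auto simp: fundamental_carrier\<close>)

sublocale M: normal M FG by (rule M_normal)

lemma apath_in_M: "r \<in> N\<theta> \<Longrightarrow> L (apath r) \<in> M"
  unfolding M_def using normal_closure_subset apath_relator_loop[of r] L_loop[of "apath r"] by fastforce

text \<open>The commutator of [\<alpha>_r] with a loop is [\<alpha>_r] times a conjugate of its
  inverse, hence lies in every normal subgroup that contains [\<alpha>_r].\<close>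

lemma M_least:
  assumes N: "N \<lhd> FG" and r: "\<And>r. r \<in> N\<theta> \<Longrightarrow> L (apath r) \<in> N"
  shows "M \<subseteq> N"
  unfolding M_def
proof (rule normal_closure_least[OF N], intro Un_least subsetI; clarify)
  fix r assume "r \<in> N\<theta>"
  then show "path_class (apath r) \<in> N" using r[of r] L_loop[OF apath_relator_loop[of r]] by simp
next
  interpret N: normal N FG by fact
  fix r p assume rp: "r \<in> N\<theta>" "p \<in> loops x0"
  note ar = apath_relator_loop[OF rp(1)]
  have "L (apath r) \<cdot> (L p \<cdot> inv\<^bsub>FG\<^esub> L (apath r) \<cdot> inv\<^bsub>FG\<^esub> L p) \<in> N"
    using r[OF rp(1)] rp ar by (intro N.m_closed N.inv_op_closed2 N.m_inv_closed) (auto simp: loops_simps)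
  then show "path_class (apath r +++ p +++ reversepath (apath r) +++ reversepath p) \<in> N"
    using L_loop[OF commutator_loop[OF rp]] rp ar
    by (simp add: L_join L_reversepath loops_simps pi.m_assoc)
qed

text \<open>Since r acts trivially on the space, the cocycle rule gives [\<alpha>_{w r w^-1}] as the
  image of [\<alpha>_r], and the conjugate of r lies again in \<open>N\<theta>\<close>.\<close>

lemma phi_M:
  assumes w: "w \<in> words" and A: "A \<in> M"
  shows "phi w A \<in> M"
proof -
  have "M \<subseteq> {A \<in> carrier FG. phi w A \<in> M}"
  proof (rule M_least)
    show "{A \<in> carrier FG. phi w A \<in> M} \<lhd> FG"
      by (rule hom_vimage_normal[OF group_fundamental_group group_fundamental_group phi_hom[OF w] M_normal])
    fix r assume r: "r \<in> N\<theta>"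
    note rw = N\<theta>_carrier[OF r, THEN carrier_F_words] and ar = apath_relator_loop[OF r]
    have "\<rho> (w @ r) = \<rho> w"
      using N\<theta>_val[OF r] w rw by (intro rho_cong) (simp add: val_append)
    then have "phi w (L (apath r)) = L (apath (w @ r @ inv_word w))"
      using w rw ar L_apath_append[of w "r @ inv_word w" "[]"] L_apath_append[of r "inv_word w" w]
        L_apath_inv[of w "[]"]
      by (simp add: phi_L pi.m_assoc)
    also have "\<dots> = L (apath (normal_form (w @ r @ inv_word w)))"
      using L_apath_normal_form[of "w @ r @ inv_word w" "[]"] w rw by simp
    also have "\<dots> \<in> M" by (intro apath_in_M N\<theta>_conj w r)
    finally show "L (apath r) \<in> {A \<in> carrier FG. phi w A \<in> M}" using ar by (simp add: loops_simps)
  qed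
  with A show ?thesis by auto
qed

text \<open>As r acts trivially, its automorphism is conjugation by [\<alpha>_r], which is an
  element of \<open>M\<close>.\<close>

lemma phi_relator:
  assumes "r \<in> N\<theta>" "A \<in> carrier FG"
  shows "M #>\<^bsub>FG\<^esub> phi r A = M #>\<^bsub>FG\<^esub> A"
proof -
  obtain p where p: "p \<in> loops x0" "A = L p" using assms L_carrierE by metis
  note rw = N\<theta>_carrier[OF assms(1), THEN carrier_F_words]
  have "\<rho> r \<circ> p = p" using N\<theta>_rho[OF assms(1)] by (simp add: o_def)
  then have "phi r A = L (apath r) \<cdot> A \<cdot> inv\<^bsub>FG\<^esub> L (apath r)"
    using p rw by (simp add: phi_L)
  then have "phi r A \<cdot> inv\<^bsub>FG\<^esub> A =
      L (apath r) \<cdot> (A \<cdot> inv\<^bsub>FG\<^esub> L (apath r) \<cdot> inv\<^bsub>FG\<^esub> A)"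
    using assms(2) rw by (simp add: pi.m_assoc)
  also have "\<dots> \<in> M"
    using apath_in_M[OF assms(1)] assms(2) by (intro M.m_closed M.inv_op_closed2 M.m_inv_closed)
  finally show ?thesis using assms(2) rw by (subst M.rcos_eq_iff) auto
qed

abbreviation "cosM A \<equiv> M #>\<^bsub>FG\<^esub> A"
abbreviation "cosN w \<equiv> N\<theta> #>\<^bsub>F\<^esub> w"

lemma cosM_phi: 
  assumes "w \<in> words" "A \<in> carrier FG" "B \<in> carrier FG" "cosM A = cosM B"
  shows "cosM (phi w A) = cosM (phi w B)"
proof -
  interpret h: group_hom FG FG "phi w"
    using phi_hom[OF assms(1)] by (simp add: group_hom_def group_hom_axioms_def group_fundamental_group)
  show ?thesis using assms phi_M[of w "A \<cdot> inv\<^bsub>FG\<^esub> B"] by (simp add: M.rcos_eq_iff)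
qed

lemma phi_bar_cosets:
  assumes w: "w \<in> carrier F" and A: "A \<in> carrier FG"
  shows "phi_bar \<rho> \<alpha> x0 (cosN w) (cosM A) = cosM (phi w A)"
proof (intro equalityI subsetI)
  note ww = carrier_F_words[OF w]
  fix B assume "B \<in> phi_bar \<rho> \<alpha> x0 (cosN w) (cosM A)"
  then obtain r m where rm: "r \<in> N\<theta>" "m \<in> M" "B = phi (normal_form (r @ w)) (m \<cdot> A)"
    by (auto simp: phi_bar_def r_coset_def free_group_simps)
  note rw = N\<theta>_carrier[OF rm(1), THEN carrier_F_words] and mc = M.mem_carrier[OF rm(2)]
  have B: "B = phi r (phi w (m \<cdot> A))"
    using rm rw ww mc A by (simp add: phi_normal_form phi_append)
  then have "cosM B = cosM (phi w (m \<cdot> A))" using phi_relator[OF rm(1)] ww mc A by simp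
  also have "\<dots> = cosM (phi w A)"
    using ww mc A rm(2) by (intro cosM_phi) (auto simp: M.rcos_eq_iff pi.m_assoc)
  finally show "B \<in> cosM (phi w A)"
    using pi.rcos_self[OF _ M.subgroup_axioms, of B] B rw ww mc A by simp
next
  note ww = carrier_F_words[OF w]
  fix B assume "B \<in> cosM (phi w A)"
  then obtain m where m: "m \<in> M" "B = m \<cdot> phi w A" by (auto simp: r_coset_def)
  note mc = M.mem_carrier[OF m(1)]
  \<comment> \<open>The preimage of m under \<open>phi w\<close>, again in \<open>M\<close>: thus
    \<open>phi w\<close> maps \<open>M\<close> onto itself, and the images fill the whole
    coset.\<close>
  let ?m = "phi (inv_word w) m"
  have "phi w ?m = m"
    using phi_append[of w "inv_word w" m] phi_normal_form[of "w @ inv_word w" m] ww mc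
    by (simp add: normal_form_inv_word)
  then have "B = phi w (?m \<cdot> A)" using m ww mc A by (simp add: phi_mult)
  moreover have "?m \<cdot> A \<in> cosM A" using phi_M[of "inv_word w" m] ww m by (auto simp: r_coset_def)
  moreover have "w \<in> cosN w" by (rule F.rcos_self[OF w N\<theta>.subgroup_axioms])
  ultimately show "B \<in> phi_bar \<rho> \<alpha> x0 (cosN w) (cosM A)" by (auto simp: phi_bar_def)
qed

abbreviation "G \<equiv> G_theta S R \<rho> \<alpha> x0 \<theta>"
abbreviation "Q \<equiv> Gamma_theta S R \<theta>"
abbreviation "H \<equiv> semidirect_product G Q (phi_bar \<rho> \<alpha> x0)"

lemma G_eq: "G = FG Mod M"
  by (simp add: G_theta_def Let_def M_def)

lemma Q_eq: "Q = F Mod N\<theta>"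
  by (simp add: Gamma_theta_def)

lemma carrier_G: "carrier G = cosM ` carrier FG" and carrier_Q: "carrier Q = cosN ` carrier F"
  by (simp_all add: G_eq Q_eq carrier_FactGroup)

lemma mult_G: "A \<in> carrier FG \<Longrightarrow> B \<in> carrier FG \<Longrightarrow> cosM A \<otimes>\<^bsub>G\<^esub> cosM B = cosM (A \<cdot> B)"
  by (simp add: G_eq M.rcos_sum)

lemma mult_Q: "u \<in> words \<Longrightarrow> v \<in> words \<Longrightarrow>
    cosN (normal_form u) \<otimes>\<^bsub>Q\<^esub> cosN (normal_form v) = cosN (normal_form (u @ v))"
  by (simp add: Q_eq N\<theta>.rcos_sum free_group_simps normal_form_append_normal_form)

lemma one_G: "\<one>\<^bsub>G\<^esub> = M" and one_Q: "\<one>\<^bsub>Q\<^esub> = N\<theta>"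
  by (simp_all add: G_eq Q_eq)

lemma cosM_one: "cosM \<one>\<^bsub>FG\<^esub> = M"
  by (rule pi.coset_mult_one) (rule M.subset)

lemma cosN_one: "cosN [] = N\<theta>"
  using F.coset_mult_one[OF N\<theta>.subset] by (simp add: free_group_simps)

lemma group_H: "group H"
proof (rule group_semidirect_product)
  show "group G" "group Q" by (simp_all add: G_eq Q_eq M.factorgroup_is_group N\<theta>.factorgroup_is_group)
  fix h assume "h \<in> carrier Q"
  then obtain w where w: "w \<in> carrier F" "h = cosN w" by (auto simp: carrier_Q)
  show "phi_bar \<rho> \<alpha> x0 h \<in> hom G G"
  proof (rule homI)
    fix A assume "A \<in> carrier G"
    then show "phi_bar \<rho> \<alpha> x0 h A \<in> carrier G" using w by (auto simp: carrier_G phi_bar_cosets)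
  next
    fix A B assume "A \<in> carrier G" "B \<in> carrier G"
    then obtain a b where "A = cosM a" "B = cosM b" "a \<in> carrier FG" "b \<in> carrier FG"
      by (auto simp: carrier_G)
    then show "phi_bar \<rho> \<alpha> x0 h (A \<otimes>\<^bsub>G\<^esub> B) = phi_bar \<rho> \<alpha> x0 h A \<otimes>\<^bsub>G\<^esub> phi_bar \<rho> \<alpha> x0 h B"
      using w by (simp add: mult_G phi_bar_cosets phi_mult)
  qed
  fix h' n assume "h' \<in> carrier Q" "n \<in> carrier G"
  then obtain w' a where "w' \<in> carrier F" "h' = cosN w'" "a \<in> carrier FG" "n = cosM a"
    by (auto simp: carrier_Q carrier_G)
  then show "phi_bar \<rho> \<alpha> x0 (h \<otimes>\<^bsub>Q\<^esub> h') n = phi_bar \<rho> \<alpha> x0 h (phi_bar \<rho> \<alpha> x0 h' n)"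
    using w mult_Q[of w w'] by (simp add: phi_bar_cosets phi_normal_form phi_append)
next
  fix n assume "n \<in> carrier G"
  then obtain a where "a \<in> carrier FG" "n = cosM a" by (auto simp: carrier_G)
  then show "phi_bar \<rho> \<alpha> x0 \<one>\<^bsub>Q\<^esub> n = n"
    using phi_bar_cosets[of "[]" a] by (simp add: one_Q cosN_one carrier_F)
qed

subsection \<open>Labels\<close>

text \<open>A path \<open>q\<close> from \<open>x\<close> to \<open>\<rho> w y\<close> is a jumping path from \<open>x\<close> to \<open>y\<close>: follow \<open>q\<close>, then jump back
  along \<open>w\<^sup>-\<^sup>1\<close>.  Closed up by \<open>\<beta>\<close>, it gives an element of the semidirect product, in which \<open>(1, w)\<close>
  stands for \<open>\<alpha>\<^sub>w\<close> followed by the jump along \<open>w\<^sup>-\<^sup>1\<close>.\<close>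

definition \<kappa> :: "(real \<Rightarrow> 'x) \<Rightarrow> 's letter list \<Rightarrow> 'x \<Rightarrow> (real \<Rightarrow> 'x) set set \<times> 's letter list set" where
  "\<kappa> q w y = (cosM (L q \<cdot> inv\<^bsub>FG\<^esub> L (\<rho> w \<circ> \<beta> y) \<cdot> inv\<^bsub>FG\<^esub> L (apath w)),
     cosN (normal_form w))"

lemma kappa_closed [simp]: "path q \<Longrightarrow> w \<in> words \<Longrightarrow> \<kappa> q w y \<in> carrier H"
  by (auto simp: \<kappa>_def carrier_G carrier_Q beta)

text \<open>Jumping paths are composed by moving the second path with w, past the jumps of the
  first. In the product the way back from w y to the base point meets the same way forwards and
  cancels; what remains at the end is the path of w followed by the translated path of w', which is
  the path of w w'.\<close>

lemma kappa_mult: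
  assumes "path q" "w \<in> words" "pathfinish q = \<rho> w y"
    and "path q'" "w' \<in> words" "pathstart q' = y" "pathfinish q' = \<rho> w' z"
  shows "\<kappa> q w y \<otimes>\<^bsub>H\<^esub> \<kappa> q' w' z = \<kappa> (q +++ (\<rho> w \<circ> q')) (w @ w') z"
proof -
  \<comment> \<open>The loop whose class is the first component of the second label;
    \<open>phi w\<close> is evaluated on it.\<close>
  define c where "c = \<beta> y +++ q' +++ reversepath (\<rho> w' \<circ> \<beta> z) +++ reversepath (apath w')"
  note [simp] = assms beta path_compose
  have c: "c \<in> loops x0" by (simp add: c_def loops_simps)
  have Lc: "L c = L q' \<cdot> inv\<^bsub>FG\<^esub> L (\<rho> w' \<circ> \<beta> z) \<cdot> inv\<^bsub>FG\<^esub> L (apath w')"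
    by (simp add: c_def L_join L_reversepath pi.m_assoc)
  have Lwc: "L (\<rho> w \<circ> c) = L (\<rho> w \<circ> \<beta> y) \<cdot> (L (\<rho> w \<circ> q') \<cdot>
      (inv\<^bsub>FG\<^esub> L (\<rho> (w @ w') \<circ> \<beta> z) \<cdot> inv\<^bsub>FG\<^esub> L (\<rho> w \<circ> apath w')))"
    by (simp add: c_def L_join L_reversepath rho_comp_append rho_append)
  have a: "L (apath (w @ w')) = L (apath w) \<cdot> L (\<rho> w \<circ> apath w')"
    using L_apath_append[of w w' "[]"] by simp
  have "\<kappa> q w y \<otimes>\<^bsub>H\<^esub> \<kappa> q' w' z =
      (cosM (L q \<cdot> inv\<^bsub>FG\<^esub> L (\<rho> w \<circ> \<beta> y) \<cdot> inv\<^bsub>FG\<^esub> L (apath w)) \<otimes>\<^bsub>G\<^esub> cosM (phi w (L c)),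
       cosN (normal_form (w @ w')))"
    using c by (simp add: \<kappa>_def flip: Lc) (simp add: phi_bar_cosets mult_Q phi_normal_form loops_simps)
  also have "\<dots> = \<kappa> (q +++ (\<rho> w \<circ> q')) (w @ w') z"
    using c by (simp add: mult_G phi_L Lwc \<kappa>_def a L_join pi.m_assoc pi.inv_mult_group pi.inv_cancel loops_simps)
  finally show ?thesis .
qed

text \<open>The word w w'^-1 reduces to a relator of length at most 4\<theta>. So w and w' have the
  same coset, and [\<alpha>_r] for this relator r is the difference between the classes of
  \<alpha>_w and \<alpha>_{w'}, an element of \<open>M\<close>.\<close>

lemma kappa_eqI:
  assumes "path q" "path q'" "w \<in> words" "w' \<in> words" "L q = L q'" "val w = val w'"
    and "length w + length w' \<le> 4 * \<theta>"
  shows "\<kappa> q w y = \<kappa> q' w' y"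
proof -
  let ?r = "w @ inv_word w'"
  have v: "val ?r = \<one>\<^bsub>\<Gamma>\<^esub>" using assms by (simp add: val_append val_inv_word)
  have "normal_form ?r \<in> R\<theta>"
    using assms v length_normal_form[of ?r] by (simp add: R\<theta>_iff val_normal_form)
  then have r: "normal_form ?r \<in> N\<theta>" by (rule subsetD[OF normal_closure_subset])
  have n: "cosN (normal_form w) = cosN (normal_form w')"
    using r assms by (subst N\<theta>.rcos_eq_iff)
      (simp_all add: free_group_simps inv_normal_form normal_form_append_normal_form)
  have "L (\<rho> w \<circ> apath (inv_word w')) = L (\<rho> w' \<circ> apath (inv_word w'))"
    using rho_cong[OF assms(6)] by simp
  also have "\<dots> = inv\<^bsub>FG\<^esub> L (apath w')" using L_apath_inv[of w' "[]"] assms by simp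
  finally have "L (apath w) \<cdot> inv\<^bsub>FG\<^esub> L (apath w') = L (apath (normal_form ?r))"
    using L_apath_append[of w "inv_word w'" "[]"] L_apath_normal_form[of ?r "[]"] assms by simp
  then have m: "L (apath w) \<cdot> inv\<^bsub>FG\<^esub> L (apath w') \<in> M" using apath_in_M[OF r] by simp
  let ?k = "L q' \<cdot> inv\<^bsub>FG\<^esub> L (\<rho> w' \<circ> \<beta> y)"
  have k: "?k \<in> carrier FG" using assms by (simp add: beta)
  \<comment> \<open>The quotient of the two first components is a conjugate of the inverse of that
    element of \<open>M\<close>.\<close>
  have "?k \<cdot> inv\<^bsub>FG\<^esub> L (apath w) \<cdot> inv\<^bsub>FG\<^esub> (?k \<cdot> inv\<^bsub>FG\<^esub> L (apath w')) =
      ?k \<cdot> (inv\<^bsub>FG\<^esub> L (apath w) \<cdot> inv\<^bsub>FG\<^esub> (L (apath w) \<cdot> inv\<^bsub>FG\<^esub> L (apath w')) \<cdot>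
        inv\<^bsub>FG\<^esub> (inv\<^bsub>FG\<^esub> L (apath w))) \<cdot> inv\<^bsub>FG\<^esub> ?k"
    using k assms by (simp add: pi.m_assoc pi.inv_mult_group pi.inv_cancel beta)
  also have "\<dots> \<in> M"
    using k assms m by (intro M.inv_op_closed2 M.m_inv_closed) auto
  finally show ?thesis
    unfolding \<kappa>_def n using k assms rho_cong[OF assms(6)]
    by (simp, subst M.rcos_eq_iff) (auto simp: beta)
qed

lemma kappa_const: "\<kappa> (\<lambda>_. y) [] y = \<one>\<^bsub>H\<^esub>"
  by (simp add: \<kappa>_def one_G one_Q cosN_one cosM_one)

lemma kappa_surj:
  assumes "h \<in> carrier H"
  obtains c w where "path c" "pathstart c = x0" "pathfinish c = \<rho> w x0" "w \<in> words" "\<kappa> c w x0 = h"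
proof -
  obtain A w where A: "A \<in> carrier FG" "w \<in> carrier F" "h = (cosM A, cosN w)"
    using assms by (auto simp: carrier_G carrier_Q)
  obtain p where p: "p \<in> loops x0" "A = L p" using A L_carrierE by metis
  show ?thesis
    by (rule that[of "p +++ apath w" w])
      (use A p in \<open>auto simp: loops_simps \<kappa>_def beta_base L_join pi.m_assoc\<close>)
qed

lemma kappa_one_iff:
  assumes "path c" "w \<in> words"
  shows "\<kappa> c w x0 = \<one>\<^bsub>H\<^esub> \<longleftrightarrow> L c \<cdot> inv\<^bsub>FG\<^esub> L (apath w) \<in> M \<and> normal_form w \<in> N\<theta>"
proof -
  have "cosM A = M \<longleftrightarrow> A \<in> M" if "A \<in> carrier FG" for A
    using that M.rcos_eq_iff[of A "\<one>\<^bsub>FG\<^esub>"] by (simp add: cosM_one)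
  moreover have "cosN (normal_form w) = N\<theta> \<longleftrightarrow> normal_form w \<in> N\<theta>"
    using assms N\<theta>.rcos_eq_iff[of "normal_form w" "\<one>\<^bsub>F\<^esub>"] F.coset_mult_one[OF N\<theta>.subset] by simp
  ultimately show ?thesis using assms by (simp add: \<kappa>_def one_G one_Q beta_base)
qed

end

context warped_action
begin

section \<open>Chains of jumps and the warped metric\<close>

text \<open>The cost skeleton of a jumping path: n jumps, and continuous pieces of which only the
  end points are kept. The number c bounds the total distance instead of being equal to it, so that
  adjacent pieces merge by the triangle inequality.\<close>

inductive reach :: "'x \<Rightarrow> 'x \<Rightarrow> nat \<Rightarrow> real \<Rightarrow> bool" for x where
  reach_base: "dist x y \<le> c \<Longrightarrow> reach x y 0 c"
| reach_step: "reach x y n c \<Longrightarrow> l \<in> S \<times> UNIV \<Longrightarrow> dist (\<rho> [l] y) z \<le> c' \<Longrightarrow> reach x z (Suc n) (c + c')"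

lemma reach_nonneg: "reach x y n c \<Longrightarrow> 0 \<le> c"
  by (induction rule: reach.induct) (auto intro: order_trans[OF zero_le_dist] add_nonneg_nonneg)

lemma reach_extend:
  assumes "reach x y n c" "dist y z \<le> c'"
  shows "reach x z n (c + c')"
  using assms(1)
proof (cases rule: reach.cases)
  case reach_base
  then show ?thesis using assms(2) dist_triangle[of x z y] by (simp add: reach.reach_base)
next
  case (reach_step u m r l r')
  then have "dist (\<rho> [l] u) z \<le> r' + c'" using assms(2) dist_triangle[of "\<rho> [l] u" z y] by simp
  from reach.reach_step[OF reach_step(3,4) this] show ?thesis using reach_step(1,2) by (simp add: add.assoc)
qed

lemma reach_trans: "reach y z n' c' \<Longrightarrow> reach x y n c \<Longrightarrow> reach x z (n + n') (c + c')"
proof (induction rule: reach.induct)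
  case (reach_base z c')
  then show ?case using reach_extend by simp
next
  case (reach_step z n' c' l z' c'')
  then have "reach x z' (Suc (n + n')) ((c + c') + c'')" by (intro reach.reach_step) auto
  then show ?case by (simp add: add.assoc)
qed

lemma reach_jump: "l \<in> S \<times> UNIV \<Longrightarrow> reach x (\<rho> [l] x) 1 0"
  using reach.reach_step[OF reach.reach_base[of x x 0], of l "\<rho> [l] x" 0] by simp

lemma reach_sym: "reach x y n c \<Longrightarrow> reach y x n c"
proof (induction rule: reach.induct)
  case (reach_base y c)
  then show ?case by (intro reach.reach_base) (simp add: dist_commute)
next
  case (reach_step y n c l z c')
  have il: "inv_letter l \<in> S \<times> UNIV" using reach_step.hyps by simp
  have "\<rho> [inv_letter l] (\<rho> [l] y) = y" using rho_cancel_letter[OF il] by simp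
  then have "reach (\<rho> [l] y) y 1 0" using reach_jump[OF il, of "\<rho> [l] y"] by simp
  moreover have "reach z (\<rho> [l] y) 0 c'" using reach_step.hyps by (intro reach.reach_base) (simp add: dist_commute)
  ultimately have "reach z y (0 + 1) (c' + 0)" by (rule reach_trans)
  from reach_trans[OF reach_step.IH this] show ?case by (simp add: add.commute)
qed

definition chain_costs :: "real \<Rightarrow> 'x \<Rightarrow> 'x \<Rightarrow> real set" where
  "chain_costs t x y = {real n + t * c | n c. reach x y n c}"

lemma chain_costs_nonneg: "0 < t \<Longrightarrow> r \<in> chain_costs t x y \<Longrightarrow> 0 \<le> r"
  by (auto simp: chain_costs_def dest: reach_nonneg)

lemma chain_costs_bdd: "0 < t \<Longrightarrow> bdd_below (chain_costs t x y)"
  by (rule bdd_belowI[of _ 0]) (rule chain_costs_nonneg)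

lemma chain_costs_dist: "t * dist x y \<in> chain_costs t x y"
  unfolding chain_costs_def using reach_base[of x y "dist x y"] by force

text \<open>The infimum of chain costs, being admissible, lies below the largest admissible metric.
  In this way a bound on the warped metric yields an actual chain.\<close>

lemma chain_admissible:
  assumes t: "0 < t"
  shows "warped_admissible S \<rho> t (\<lambda>x y. Inf (chain_costs t x y))"
proof -
  let ?D = "\<lambda>x y. Inf (chain_costs t x y)"
  note bdd = chain_costs_bdd[OF t]
  have ne: "chain_costs t x y \<noteq> {}" for x y using chain_costs_dist by blast
  have le: "?D x y \<le> r" if "r \<in> chain_costs t x y" for x y r using bdd that by (intro cInf_lower)
  have ge: "r \<le> ?D x y" if "\<And>s. s \<in> chain_costs t x y \<Longrightarrow> r \<le> s" for x y r
    using ne that by (intro cInf_greatest) auto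
  have nn: "0 \<le> ?D x y" for x y using chain_costs_nonneg[OF t] by (intro ge)
  have "Metric_space UNIV ?D"
  proof
    fix x y z
    show "0 \<le> ?D x y" by (rule nn)
    have "chain_costs t x y = chain_costs t y x" unfolding chain_costs_def using reach_sym by metis
    then show "?D x y = ?D y x" by simp
    show "?D x y = 0 \<longleftrightarrow> x = y"
    proof
      assume "?D x y = 0"
      show "x = y"
      proof (rule ccontr)
        assume "x \<noteq> y"
        \<comment> \<open>A chain of cost below 1 has no jump, and a chain without jumps costs at
          least t times the distance; the minimum excludes both.\<close>
        then have "?D x y < min 1 (t * dist x y)" using t \<open>?D x y = 0\<close> by simp
        then obtain n c where nc: "reach x y n c" "real n + t * c < min 1 (t * dist x y)"
          using cInf_lessD[OF ne] unfolding chain_costs_def by blast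
        have "0 \<le> t * c" using t reach_nonneg[OF nc(1)] by simp
        then have "n = 0" using nc(2) by simp
        then have "dist x y \<le> c" using nc(1) by (auto elim: reach.cases)
        then have "t * dist x y \<le> t * c" using t by simp
        then show False using nc(2) \<open>n = 0\<close> by simp
      qed
    next
      assume "x = y"
      then have "?D x y \<le> 0" using le[OF chain_costs_dist[of t x y]] by simp
      with nn[of x y] show "?D x y = 0" by simp
    qed
    show "?D x z \<le> ?D x y + ?D y z"
    proof -
      have "?D x z - s \<le> r" if "r \<in> chain_costs t x y" "s \<in> chain_costs t y z" for r s
      proof -
        obtain n c n' c' where "reach x y n c" "r = real n + t * c" "reach y z n' c'" "s = real n' + t * c'"
          using \<open>r \<in> _\<close> \<open>s \<in> _\<close> unfolding chain_costs_def by blast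
        then have "r + s \<in> chain_costs t x z"
          using reach_trans unfolding chain_costs_def by (force simp: algebra_simps)
        from le[OF this] show ?thesis by simp
      qed
      then have "?D x z - s \<le> ?D x y" if "s \<in> chain_costs t y z" for s using that by (intro ge)
      then have "?D x z - ?D x y \<le> s" if "s \<in> chain_costs t y z" for s using that by (simp add: algebra_simps)
      then have "?D x z - ?D x y \<le> ?D y z" by (rule ge)
      then show ?thesis by simp
    qed
  qed
  moreover have "?D x (\<rho> [(s, True)] x) \<le> 1" if "s \<in> S" for x s
    using reach_jump[of "(s, True)" x] that by (intro le) (force simp: chain_costs_def)
  ultimately show ?thesis unfolding warped_admissible_def using le[OF chain_costs_dist] by blast
qed

lemma reach_of_warped_metric:
  assumes "0 < t" "warped_metric S \<rho> t x y < b"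
  obtains n c where "reach x y n c" "real n + t * c < b"
proof -
  have "Inf (chain_costs t x y) \<le> warped_metric S \<rho> t x y"
    using warped_admissible_warped_metric(2)[OF assms(1) chain_admissible[OF assms(1)]] by (simp add: le_fun_def)
  then have lt: "Inf (chain_costs t x y) < b" using assms(2) by simp
  have "chain_costs t x y \<noteq> {}" using chain_costs_dist[of t x y] by auto
  from cInf_lessD[OF this lt] obtain s where "s \<in> chain_costs t x y" "s < b" by auto
  then show ?thesis unfolding chain_costs_def by (auto intro: that)
qed

section \<open>Uniform estimates\<close>

lemma finite_short_words: "finite {w \<in> words. length w \<le> k}"
  using finite_lists_length_le[of "S \<times> (UNIV :: bool set)" k] finite_S
  by (simp add: words_def lists_eq_set)

text \<open>Finitely many maps, each uniformly continuous by compactness.\<close>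

lemma words_equicontinuous:
  assumes "0 < e"
  obtains d where "0 < d"
    "\<And>w a b. w \<in> words \<Longrightarrow> length w \<le> k \<Longrightarrow> dist a b < d \<Longrightarrow> dist (\<rho> w a) (\<rho> w b) < e"
proof -
  have "\<exists>d>0. \<forall>w\<in>A. \<forall>a b. dist a b < d \<longrightarrow> dist (\<rho> w a) (\<rho> w b) < e" if "finite A" "A \<subseteq> words" for A
    using that
  proof (induction A)
    case (insert w A)
    then obtain d where d: "0 < d" "\<forall>w\<in>A. \<forall>a b. dist a b < d \<longrightarrow> dist (\<rho> w a) (\<rho> w b) < e" by auto
    have "uniformly_continuous_on UNIV (\<rho> w)"
      using insert.prems rho_continuous compact_space by (intro compact_uniformly_continuous) auto
    then obtain d' where d': "0 < d'" "\<forall>a b. dist a b < d' \<longrightarrow> dist (\<rho> w a) (\<rho> w b) < e"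
      using assms unfolding uniformly_continuous_on_def by (metis UNIV_I dist_commute)
    then show ?case using d by (intro exI[of _ "min d d'"]) auto
  qed (auto intro: exI[of _ 1])
  from this[OF finite_short_words[of k]] show ?thesis using that by auto
qed

text \<open>A non-trivial element has no fixed point, so by compactness its displacement has a
  positive minimum; there are only finitely many short words.\<close>

lemma words_displacement:
  obtains e where "0 < e"
    "\<And>w x. w \<in> words \<Longrightarrow> length w \<le> k \<Longrightarrow> dist x (\<rho> w x) < e \<Longrightarrow> val w = \<one>\<^bsub>\<Gamma>\<^esub>"
proof -
  have "\<exists>e>0. \<forall>w\<in>A. \<forall>x. dist x (\<rho> w x) < e \<longrightarrow> val w = \<one>\<^bsub>\<Gamma>\<^esub>" if "finite A" "A \<subseteq> words" for A
    using that
  proof (induction A)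
    case (insert w A)
    then obtain e where e: "0 < e" "\<forall>w\<in>A. \<forall>x. dist x (\<rho> w x) < e \<longrightarrow> val w = \<one>\<^bsub>\<Gamma>\<^esub>" by auto
    have w: "w \<in> words" using insert.prems by simp
    have "continuous_on UNIV (\<lambda>x. dist x (\<rho> w x))"
      by (intro continuous_on_dist continuous_on_id rho_continuous w)
    then obtain y where y: "\<forall>x. dist y (\<rho> w y) \<le> dist x (\<rho> w x)"
      using continuous_attains_inf[of UNIV "\<lambda>x. dist x (\<rho> w x)"] compact_space by auto
    show ?case
    proof (cases "val w = \<one>\<^bsub>\<Gamma>\<^esub>")
      case True
      then show ?thesis using e by (intro exI[of _ e]) auto
    next
      case False
      then have "0 < dist y (\<rho> w y)" using rho_fixed[OF w, of y] by auto
      moreover have "\<not> dist x (\<rho> w x) < dist y (\<rho> w y)" for x using y by (simp add: not_less)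
      ultimately show ?thesis using e by (intro exI[of _ "min e (dist y (\<rho> w y))"]) auto
    qed
  qed (auto intro: exI[of _ 1])
  from this[OF finite_short_words[of k]] show ?thesis using that by auto
qed

text \<open>The radius is a Lebesgue number of a cover by sets in which loops contract. Semilocal
  simple connectedness speaks only of loops at the centre z, so the loop made of p and the reverse
  of q is first joined to z within the same set.\<close>

lemma small_paths_homotopic:
  obtains e where "0 < e"
    "\<And>x p q. path p \<Longrightarrow> path q \<Longrightarrow> pathstart p = pathstart q \<Longrightarrow> pathfinish p = pathfinish q \<Longrightarrow>
       path_image p \<subseteq> ball x e \<Longrightarrow> path_image q \<subseteq> ball x e \<Longrightarrow> L p = L q"
proof -
  \<comment> \<open>The cover needs an open set u, and the joining path a path-connected set v;
    local path connectedness supplies u inside v inside the given neighbourhood.\<close>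
  define Q where "Q x u v \<longleftrightarrow> open u \<and> x \<in> u \<and> u \<subseteq> v \<and> path_connected v \<and>
      (\<forall>p. path p \<and> path_image p \<subseteq> v \<and> pathstart p = x \<and> pathfinish p = x
         \<longrightarrow> homotopic_paths UNIV p (\<lambda>_. x))" for x :: 'x and u v
  have "\<exists>u v. Q x u v" for x
  proof -
    have "\<exists>U. open U \<and> x \<in> U \<and>
        (\<forall>p. path p \<and> path_image p \<subseteq> U \<and> pathstart p = x \<and> pathfinish p = x \<longrightarrow> homotopic_paths UNIV p (\<lambda>_. x))"
      using slsc unfolding semilocally_simply_connected_def by simp
    then obtain U where U: "open U" "x \<in> U" "\<forall>p. path p \<and> path_image p \<subseteq> U \<and> pathstart p = x \<and> pathfinish p = x
         \<longrightarrow> homotopic_paths UNIV p (\<lambda>_. x)"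
      by (elim exE conjE)
    have "\<exists>u v. open u \<and> path_connected v \<and> x \<in> u \<and> u \<subseteq> v \<and> v \<subseteq> U"
      using loc_path_conn U(1,2) unfolding locally_def by simp
    then obtain u v where "open u" "path_connected v" "x \<in> u" "u \<subseteq> v" "v \<subseteq> U" by (elim exE conjE)
    then show ?thesis unfolding Q_def using U(3) by (intro exI[of _ u] exI[of _ v] conjI allI impI) auto
  qed
  then obtain u v where "\<And>x. Q x (u x) (v x)" by metis
  then have uv: "\<And>x. open (u x)" "\<And>x. x \<in> u x" "\<And>x. u x \<subseteq> v x" "\<And>x. path_connected (v x)"
    "\<And>x p. path p \<Longrightarrow> path_image p \<subseteq> v x \<Longrightarrow> pathstart p = x \<Longrightarrow> pathfinish p = x
       \<Longrightarrow> homotopic_paths UNIV p (\<lambda>_. x)"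
    unfolding Q_def by simp_all
  have "UNIV \<subseteq> \<Union> (range u)" using uv(2) by blast
  then obtain e where e: "0 < e" "\<And>x. \<exists>G\<in>range u. ball x e \<subseteq> G"
    using Heine_Borel_lemma[OF compact_space, of "range u"] uv(1) by (metis UNIV_I imageE)
  show ?thesis
  proof (rule that[OF e(1)])
    fix x :: 'x and p q
    assume pq: "path p" "path q" "pathstart p = pathstart q" "pathfinish p = pathfinish q"
      "path_image p \<subseteq> ball x e" "path_image q \<subseteq> ball x e"
    obtain z where z: "ball x e \<subseteq> v z" using e(2)[of x] uv(3) by blast
    have "pathstart p \<in> v z" using pq(5) z pathstart_in_path_image[of p] by blast
    moreover have "z \<in> v z" using uv(2,3) by blast
    ultimately obtain r where r: "path r" "path_image r \<subseteq> v z" "pathstart r = z" "pathfinish r = pathstart p"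
      using uv(4)[of z] unfolding path_connected_def by blast
    let ?c = "r +++ p +++ reversepath q +++ reversepath r"
    have "path_image ?c \<subseteq> v z"
      using r pq z by (intro subset_path_image_join) auto
    then have "homotopic_paths UNIV ?c (\<lambda>_. z)"
      using r pq by (intro uv(5)) auto
    from L_homotopic[OF this]
    have "L r \<cdot> (L p \<cdot> (inv\<^bsub>FG\<^esub> L q \<cdot> inv\<^bsub>FG\<^esub> L r)) = \<one>\<^bsub>FG\<^esub>"
      using r pq by (simp add: L_join L_reversepath)
    then have "inv\<^bsub>FG\<^esub> L r \<cdot> (L r \<cdot> (L p \<cdot> (inv\<^bsub>FG\<^esub> L q \<cdot> inv\<^bsub>FG\<^esub> L r))) \<cdot> L r = \<one>\<^bsub>FG\<^esub>"
      using r by simp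
    then have "L p \<cdot> inv\<^bsub>FG\<^esub> L q = \<one>\<^bsub>FG\<^esub>"
      using r pq by (simp add: pi.inv_cancel pi.m_assoc)
    then have "inv\<^bsub>FG\<^esub> (inv\<^bsub>FG\<^esub> L q) = L p" using pq by (intro pi.inv_equality) auto
    then show "L p = L q" using pq by simp
  qed
qed

section \<open>Short edges\<close>

text \<open>The pair (q, w) is a jumping path from x to y in the encoding used by
  \<open>\<kappa>\<close>. All of q, not only its end, is kept near x, because its homotopy class
  has to be controlled as well as the word.\<close>

definition edge :: "real \<Rightarrow> 'x \<Rightarrow> 'x \<Rightarrow> (real \<Rightarrow> 'x) \<Rightarrow> 's letter list \<Rightarrow> bool" where
  "edge e x y q w \<longleftrightarrow> w \<in> words \<and> length w \<le> \<theta> \<and> path q \<and> pathstart q = x \<and> pathfinish q = \<rho> w y \<and>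
     (\<forall>z\<in>path_image q. dist x z < e)"

text \<open>The property of short edges from which labels are built. It mentions neither t nor the
  warped metric, so e can be fixed before t.\<close>

definition coherent :: "real \<Rightarrow> bool" where
  "coherent e \<longleftrightarrow> (\<forall>a b c z q1 w1 q2 w2 q3 w3 q4 w4.
     edge e a b q1 w1 \<longrightarrow> edge e b z q2 w2 \<longrightarrow> edge e a c q3 w3 \<longrightarrow> edge e c z q4 w4 \<longrightarrow>
     \<kappa> q1 w1 b \<otimes>\<^bsub>H\<^esub> \<kappa> q2 w2 z = \<kappa> q3 w3 c \<otimes>\<^bsub>H\<^esub> \<kappa> q4 w4 z)"

text \<open>Two short edge paths of two edges with common end points differ by a loop of at most \<open>4\<theta>\<close> jumps
  that moves its base point only little, so that freeness makes its word a short relator.\<close>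

lemma coherent_exists: "\<exists>e>0. coherent e"
proof -
  obtain e0 where e0: "0 < e0"
    "\<And>x p q. path p \<Longrightarrow> path q \<Longrightarrow> pathstart p = pathstart q \<Longrightarrow> pathfinish p = pathfinish q \<Longrightarrow>
       path_image p \<subseteq> ball x e0 \<Longrightarrow> path_image q \<subseteq> ball x e0 \<Longrightarrow> L p = L q"
    using small_paths_homotopic by blast
  obtain e1 where e1: "0 < e1"
    "\<And>w x. w \<in> words \<Longrightarrow> length w \<le> 4 * \<theta> \<Longrightarrow> dist x (\<rho> w x) < e1 \<Longrightarrow> val w = \<one>\<^bsub>\<Gamma>\<^esub>"
    using words_displacement[of "4 * \<theta>"] by blast
  \<comment> \<open>Two consecutive edges stay within 2 \<open>e2\<close> of a, so the ends of two
    such routes are within 4 \<open>e2\<close> of each other; a quarter of the minimum suits both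
    the homotopy radius and the displacement bound.\<close>
  define e2 where "e2 = min e0 e1 / 4"
  have e2: "0 < e2" "4 * e2 \<le> e0" "4 * e2 \<le> e1" using e0(1) e1(1) by (auto simp: e2_def)
  obtain d where d: "0 < d"
    "\<And>w a b. w \<in> words \<Longrightarrow> length w \<le> \<theta> \<Longrightarrow> dist a b < d \<Longrightarrow> dist (\<rho> w a) (\<rho> w b) < e2"
    using words_equicontinuous[OF e2(1), of \<theta>] by blast
  \<comment> \<open>The second edge is translated by a word of at most \<theta> letters, which turns
    a distance below d into one below \<open>e2\<close>.\<close>
  define e where "e = min d e2"
  have comp: "path (q +++ (\<rho> w \<circ> q')) \<and> pathstart (q +++ (\<rho> w \<circ> q')) = a \<and>
      pathfinish (q +++ (\<rho> w \<circ> q')) = \<rho> (w @ w') z \<and> path_image (q +++ (\<rho> w \<circ> q')) \<subseteq> ball a (2 * e2) \<and>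
      \<kappa> q w b \<otimes>\<^bsub>H\<^esub> \<kappa> q' w' z = \<kappa> (q +++ (\<rho> w \<circ> q')) (w @ w') z"
    if "edge e a b q w" "edge e b z q' w'" for a b z q w q' w'
  proof -
    have q: "w \<in> words" "length w \<le> \<theta>" "path q" "pathstart q = a" "pathfinish q = \<rho> w b"
      "\<And>u. u \<in> path_image q \<Longrightarrow> dist a u < e" using that(1) by (auto simp: edge_def)
    have q': "w' \<in> words" "path q'" "pathstart q' = b" "pathfinish q' = \<rho> w' z"
      "\<And>u. u \<in> path_image q' \<Longrightarrow> dist b u < e" using that(2) by (auto simp: edge_def)
    have ab: "dist a (\<rho> w b) < e2" using q(6)[of "\<rho> w b"] pathfinish_in_path_image[of q] q(5) by (simp add: e_def)
    have "dist a (\<rho> w u) < 2 * e2" if "u \<in> path_image q'" for u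
      using d(2)[OF q(1,2), of b u] q'(5)[OF that] ab dist_triangle[of a "\<rho> w u" "\<rho> w b"] by (simp add: e_def)
    moreover have "dist a u < 2 * e2" if "u \<in> path_image q" for u
      using q(6)[OF that] e2(1) by (simp add: e_def)
    ultimately have "path_image (q +++ (\<rho> w \<circ> q')) \<subseteq> ball a (2 * e2)"
      by (intro subset_path_image_join) (auto simp: path_image_compose)
    then show ?thesis using q q' by (simp add: path_compose rho_append kappa_mult)
  qed
  have "coherent e"
    unfolding coherent_def
  proof (intro allI impI)
    fix a b c z q1 w1 q2 w2 q3 w3 q4 w4
    assume E: "edge e a b q1 w1" "edge e b z q2 w2" "edge e a c q3 w3" "edge e c z q4 w4"
    note C = comp[OF E(1,2)] and C' = comp[OF E(3,4)]
    have ws: "w1 @ w2 \<in> words" "w3 @ w4 \<in> words" "length (w1 @ w2) + length (w3 @ w4) \<le> 4 * \<theta>"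
      using E by (auto simp: edge_def)
    let ?q = "q1 +++ (\<rho> w1 \<circ> q2)" and ?q' = "q3 +++ (\<rho> w3 \<circ> q4)"
    have "\<rho> (w1 @ w2) z \<in> ball a (2 * e2)" "\<rho> (w3 @ w4) z \<in> ball a (2 * e2)"
      using C C' pathfinish_in_path_image[of ?q] pathfinish_in_path_image[of ?q'] by auto
    then have near: "dist (\<rho> (w3 @ w4) z) (\<rho> (w1 @ w2) z) < e1"
      using dist_triangle2[of "\<rho> (w3 @ w4) z" "\<rho> (w1 @ w2) z" a] e2 by (simp add: dist_commute)
    \<comment> \<open>The word around the quadrilateral has at most 4\<theta> letters and carries
      the end of the second route to the end of the first, a move by less than \<open>e1\<close>; so
      its value is 1.\<close>
    let ?r = "(w1 @ w2) @ inv_word (w3 @ w4)"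
    have "\<rho> ?r (\<rho> (w3 @ w4) z) = \<rho> (w1 @ w2) z"
      using ws rho_append[of "w1 @ w2" "inv_word (w3 @ w4)"] rho_cancel(2)[of "w3 @ w4" z] by simp
    then have "val ?r = \<one>\<^bsub>\<Gamma>\<^esub>"
      using ws near by (intro e1(2)[of ?r "\<rho> (w3 @ w4) z"]) simp_all
    then have "val (w1 @ w2) \<otimes>\<^bsub>\<Gamma>\<^esub> inv\<^bsub>\<Gamma>\<^esub> val (w3 @ w4) = \<one>\<^bsub>\<Gamma>\<^esub>"
      using ws(1,2) by (subst (asm) val_append) (auto simp only: val_inv_word words_simps)
    then have v: "val (w1 @ w2) = val (w3 @ w4)"
      using ws(1,2) Gam.inv_equality[of "val (w1 @ w2)" "inv\<^bsub>\<Gamma>\<^esub> val (w3 @ w4)"]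
      by (metis Gam.inv_closed Gam.inv_inv val_closed)
    have "ball a (2 * e2) \<subseteq> ball a e0" using e2 by (intro subset_ball) simp
    then have "L ?q = L ?q'"
      using C C' rho_cong[OF v] by (intro e0(2)[of _ _ a]) auto
    then show "\<kappa> q1 w1 b \<otimes>\<^bsub>H\<^esub> \<kappa> q2 w2 z = \<kappa> q3 w3 c \<otimes>\<^bsub>H\<^esub> \<kappa> q4 w4 z"
      using C C' ws v kappa_eqI[of ?q ?q' "w1 @ w2" "w3 @ w4" z] by simp
  qed
  then show ?thesis using d(1) e2(1) by (intro exI[of _ e]) (simp add: e_def)
qed

end

section \<open>Discrete paths as jumping paths\<close>

locale warped_level = warped_action x0 \<beta> \<Gamma> act S \<eta> R \<rho> \<alpha> \<theta>
  for x0 :: "'x::metric_space" and \<beta> and \<Gamma> :: "'g monoid" and act and S :: "'s set"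
    and \<eta> and R and \<rho> and \<alpha> and \<theta> +
  fixes t :: real
  assumes t_gt0: "0 < t"
begin

abbreviation "\<delta> \<equiv> warped_metric S \<rho> t"

lemma delta_letter: "l \<in> S \<times> UNIV \<Longrightarrow> \<delta> x (\<rho> [l] x) \<le> 1"
proof -
  assume l: "l \<in> S \<times> UNIV"
  note adm = warped_admissible_warped_metric(1)[OF t_gt0, of S \<rho>]
  have com: "\<delta> x y = \<delta> y x" for x y
    using adm by (auto simp: warped_admissible_def Metric_space_def)
  obtain s b where sb: "l = (s, b)" "s \<in> S" using l by auto
  have pos: "\<delta> x (\<rho> [(s, True)] x) \<le> 1" for x using adm sb by (auto simp: warped_admissible_def)
  show ?thesis
  proof (cases b)
    case True
    then show ?thesis using pos sb by simp
  next
    case False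
    have "\<rho> [(s, True)] (\<rho> [(s, False)] x) = x"
      using rho_cancel_letter[of "(s, True)" x] sb by (simp add: inv_letter_def)
    then show ?thesis using pos[of "\<rho> [(s, False)] x"] sb False com by simp
  qed
qed

sublocale sampled_space \<delta> "real \<theta>" t
proof (intro sampled_space.intro theta_space.intro sampled_space_axioms.intro)
  note adm = warped_admissible_warped_metric(1)[OF t_gt0, of S \<rho>]
  from adm have m: "Metric_space UNIV \<delta>" "\<And>x y. \<delta> x y \<le> t * dist x y"
    by (auto simp: warped_admissible_def)
  show "Metric_space UNIV \<delta>" by (rule m)
  show "0 < t" by (rule t_gt0)
  show "\<delta> x y \<le> t * dist x y" for x y by (rule m)
  show "0 < real \<theta>" "0 \<le> real \<theta>" using theta_ge1 by auto
qed

abbreviation hteq (infix "\<simeq>" 50) where "xs \<simeq> ys \<equiv> theta_homotopic \<delta> (real \<theta>) xs ys"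

section \<open>Jumps, and sliding them past paths\<close>

text \<open>The vertices from w y down to y, deleting letters of w from the left: this is the list
  of jumps along w^-1, which explains why it starts at w y, where the path part of a jumping path
  ends.\<close>

fun jumps :: "'s letter list \<Rightarrow> 'x \<Rightarrow> 'x list" where
  "jumps [] y = [y]"
| "jumps (l # w) y = \<rho> (l # w) y # jumps w y"

lemma jumps_not_Nil [simp]: "jumps w y \<noteq> []"
  by (cases w) auto

lemma jumps_ends [simp]: "hd (jumps w y) = \<rho> w y" "last (jumps w y) = y" "length (jumps w y) = Suc (length w)"
  by (induction w) (auto simp: rho_Nil)

lemma jumps_unit_steps: "w \<in> words \<Longrightarrow> successively (\<lambda>x y. \<delta> x y \<le> 1) (jumps w y)"
proof (induction w)
  case (Cons l w)
  then have "l \<in> S \<times> UNIV" "w \<in> words" by simp_all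
  then show ?case using Cons.IH delta_letter[of l "\<rho> w y"] rho_Cons[of l w y]
    by (simp add: successively_Cons d_commute)
qed simp

lemma jumps_theta_path [simp]: "w \<in> words \<Longrightarrow> tpath (jumps w y)"
  unfolding theta_path_def
  by (intro conjI successively_mono[OF jumps_unit_steps]) (use theta_ge1 in auto)

lemma jumps_append:
  assumes "u \<in> words" "v \<in> words"
  shows "jumps (u @ v) y = jumps u (\<rho> v y) @ tl (jumps v y)"
  using assms(1)
proof (induction u)
  case Nil
  then show ?case using hd_Cons_tl[of "jumps v y"] by simp
next
  case (Cons l u)
  then have "l # u \<in> words" "u \<in> words" by simp_all
  then show ?case using Cons.IH rho_append[of "l # u" v y] assms(2) by simp
qed

text \<open>A path and its translate by a letter are the sides of a ladder whose rungs are jumps, of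
  length at most 1 and hence at most \<theta>.\<close>

lemma slide_letter:
  assumes l: "l \<in> S \<times> UNIV" and p: "path p" and us: "samples p us" and vs: "samples (\<rho> [l] \<circ> p) vs"
  shows "\<rho> [l] (pathstart p) # us \<simeq> vs @ [pathfinish p]"
proof -
  have lw: "[l] \<in> words" using l by simp
  obtain zs where zs: "samples p zs" "samples (\<rho> [l] \<circ> p) (map (\<rho> [l]) zs)"
    using samples_common[OF p rho_path[OF lw p]] .
  have "list_all2 (\<lambda>x y. \<delta> x y \<le> real \<theta>) (map (\<rho> [l]) zs) zs"
  proof (rule list_all2_all_nthI)
    fix i assume i: "i < length (map (\<rho> [l]) zs)"
    have "\<delta> (\<rho> [l] (zs ! i)) (zs ! i) \<le> 1"
      using delta_letter[OF l, of "zs ! i"] d_commute[of "zs ! i" "\<rho> [l] (zs ! i)"] by simp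
    with i theta_ge1 show "\<delta> (map (\<rho> [l]) zs ! i) (zs ! i) \<le> real \<theta>" by simp
  qed simp
  from ladder[OF this samples_imp(1)[OF zs(2)] samples_imp(1)[OF zs(1)]]
  have 1: "map (\<rho> [l]) zs @ [pathfinish p] \<simeq> \<rho> [l] (pathstart p) # zs"
    using samples_imp(2,3)[OF zs(1)] samples_ne[OF zs(1)] by (simp add: hd_map)
  have 2: "\<rho> [l] (pathstart p) # us \<simeq> \<rho> [l] (pathstart p) # zs"
    by (rule heq_Cons[OF samples_heq[OF p us zs(1)]])
  have 3: "map (\<rho> [l]) zs @ [pathfinish p] \<simeq> vs @ [pathfinish p]"
    by (rule heq_append1[OF samples_heq[OF rho_path[OF lw p] zs(2) vs]])
  show ?thesis by (rule heq_trans[OF heq_trans[OF 2 heq_sym[OF 1]] 3])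
qed

lemma slide:
  assumes "w \<in> words" "path p" "samples p us" "samples (\<rho> w \<circ> p) vs"
  shows "jumps w (pathstart p) @ tl us \<simeq> vs @ tl (jumps w (pathfinish p))"
  using assms(1,4)
proof (induction w arbitrary: vs)
  case Nil
  have "jumps [] (pathstart p) @ tl us = us"
    using samples_imp(2)[OF assms(3)] samples_ne[OF assms(3)] by (cases us) auto
  then show ?case using samples_heq[OF assms(2,3), of vs] Nil.prems(2) by simp
next
  case (Cons l w)
  then have lw: "l \<in> S \<times> UNIV" "[l] \<in> words" "w \<in> words" by simp_all
  note wp = rho_path[OF lw(3) assms(2)]
  obtain vs1 where vs1: "samples (\<rho> w \<circ> p) vs1" using samples_exists[OF wp] by auto
  have e: "\<rho> [l] \<circ> (\<rho> w \<circ> p) = \<rho> (l # w) \<circ> p" using rho_comp_append[OF lw(2,3)] by simp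
  have "jumps (l # w) (pathstart p) @ tl us \<simeq> \<rho> (l # w) (pathstart p) # vs1 @ tl (jumps w (pathfinish p))"
    using heq_Cons[OF Cons.IH[OF lw(3) vs1]] by simp
  also have "\<dots> = (\<rho> [l] (pathstart (\<rho> w \<circ> p)) # vs1) @ tl (jumps w (pathfinish p))"
    by (simp add: pathstart_compose rho_Cons[OF lw(1,3)])
  also have "\<dots> \<simeq> (vs @ [pathfinish (\<rho> w \<circ> p)]) @ tl (jumps w (pathfinish p))"
    by (rule heq_append1, rule slide_letter[OF lw(1) wp vs1]) (use Cons.prems(2) e in \<open>simp add: o_def\<close>)
  also have "\<dots> = vs @ tl (jumps (l # w) (pathfinish p))"
    using hd_Cons_tl[of "jumps w (pathfinish p)"] by (simp add: pathfinish_compose)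
  finally show ?case .
qed

definition rep :: "'x list \<Rightarrow> (real \<Rightarrow> 'x) \<Rightarrow> 's letter list \<Rightarrow> 'x \<Rightarrow> bool" where
  "rep zs q w y \<longleftrightarrow> w \<in> words \<and> path q \<and> pathfinish q = \<rho> w y \<and> tpath zs \<and>
     (\<exists>us. samples q us \<and> zs \<simeq> us @ tl (jumps w y))"

lemma rep_samples:
  assumes "rep zs q w y" "samples q us"
  shows "zs \<simeq> us @ tl (jumps w y)"
proof -
  obtain vs where vs: "samples q vs" "zs \<simeq> vs @ tl (jumps w y)" "path q" using assms(1) by (auto simp: rep_def)
  from heq_trans[OF vs(2) heq_append1[OF samples_heq[OF vs(3,1) assms(2)]]] show ?thesis .
qed

lemma rep_ends:
  assumes "rep zs q w y"
  shows "zs \<noteq> []" "hd zs = pathstart q" "last zs = y"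
proof -
  obtain us where us: "samples q us" "zs \<simeq> us @ tl (jumps w y)" "pathfinish q = \<rho> w y"
    using assms by (auto simp: rep_def)
  have u: "us \<noteq> []" "hd us = pathstart q" "last us = hd (jumps w y)"
    using samples_ne[OF us(1)] samples_imp[OF us(1)] us(3) by auto
  have "last (us @ tl (jumps w y)) = y"
    using u(3) jumps_ends(2)[of w y] by (cases "jumps w y"; cases "tl (jumps w y)") auto
  then show "zs \<noteq> []" "hd zs = pathstart q" "last zs = y"
    using heq_imp[OF us(2)] u by auto
qed

lemma rep_heq: "rep zs q w y \<Longrightarrow> zs \<simeq> zs' \<Longrightarrow> rep zs' q w y"
  using heq_imp[of zs zs'] heq_trans[OF heq_sym[of zs zs']] by (auto simp: rep_def)

lemma rep_const: "rep [x] (\<lambda>_. x) [] x"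
  unfolding rep_def using samples_const[of x] heq_dup_Cons[of x "[]"] by (auto simp: rho_Nil)

text \<open>Sliding the jumps of w past q' turns path, jumps, path, jumps into a single path
  followed by all the jumps. The resulting rule for pairs is that of \<open>kappa_mult\<close>,
  which is what lets labels be computed from representations.\<close>

lemma rep_join:
  assumes 1: "rep zs q w y" and 2: "rep zs' q' w' z" and y: "pathstart q' = y"
  shows "rep (zs @ tl zs') (q +++ (\<rho> w \<circ> q')) (w @ w') z"
proof -
  have w: "w \<in> words" "path q" "pathfinish q = \<rho> w y" and w': "w' \<in> words" "path q'" "pathfinish q' = \<rho> w' z"
    using 1 2 by (auto simp: rep_def)
  note wq' = rho_path[OF w(1) w'(2)]
  obtain us where us: "samples q us" "zs \<simeq> us @ tl (jumps w y)" using 1 by (auto simp: rep_def)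
  obtain us' where us': "samples q' us'" "zs' \<simeq> us' @ tl (jumps w' z)" using 2 by (auto simp: rep_def)
  obtain vs where vs: "samples (\<rho> w \<circ> q') vs" using samples_exists[OF wq'] by auto
  note ne = samples_ne[OF us(1)] samples_ne[OF us'(1)] samples_ne[OF vs]
  have sj: "samples (q +++ (\<rho> w \<circ> q')) (us @ tl vs)"
    using samples_join[OF us(1) vs] w(3) y by (simp add: pathstart_compose)
  have "zs @ tl zs' \<simeq> (us @ tl (jumps w y)) @ tl (us' @ tl (jumps w' z))"
    by (rule heq_join[OF us(2) us'(2)]) (use rep_ends[OF 1] rep_ends[OF 2] y in auto)
  also have "\<dots> = (us @ tl (jumps w y @ tl us')) @ tl (jumps w' z)"
    using ne by simp
  also have "\<dots> \<simeq> (us @ tl (vs @ tl (jumps w (pathfinish q')))) @ tl (jumps w' z)"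
  proof (rule heq_append1, rule heq_join[OF heq_refl])
    show "jumps w y @ tl us' \<simeq> vs @ tl (jumps w (pathfinish q'))"
      using slide[OF w(1) w'(2) us'(1) vs] y by simp
  qed (use ne samples_imp(3)[OF us(1)] w(3) in auto)
  also have "\<dots> = (us @ tl vs) @ tl (jumps (w @ w') z)"
    using ne jumps_append[OF w(1) w'(1), of z] w'(3) by simp
  finally have "zs @ tl zs' \<simeq> (us @ tl vs) @ tl (jumps (w @ w') z)" .
  moreover have "tpath (zs @ tl zs')"
    using theta_path_join[of zs zs'] 1 2 rep_ends[OF 1] rep_ends[OF 2] y by (simp add: rep_def)
  ultimately show ?thesis unfolding rep_def using sj w w' wq' y
    by (auto simp: path_compose rho_append)
qed

lemma rep_samples_self:
  assumes "path p" "samples p us"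
  shows "rep us p [] (pathfinish p)"
  unfolding rep_def using assms samples_imp[OF assms(2)] by (auto simp: rho_Nil intro!: exI[of _ us])

text \<open>The word is the inverse letter because a pair (q, w) jumps along w^-1; indeed y is the
  image of l y under l^-1.\<close>

lemma rep_jump:
  assumes "l \<in> S \<times> UNIV"
  shows "rep [y, \<rho> [l] y] (\<lambda>_. y) [inv_letter l] (\<rho> [l] y)"
proof -
  have il: "inv_letter l \<in> S \<times> UNIV" using assms by simp
  have c: "\<rho> [inv_letter l] (\<rho> [l] y) = y" using rho_cancel_letter[OF il, of y] by simp
  have "\<delta> y (\<rho> [l] y) \<le> real \<theta>" using delta_letter[OF assms, of y] theta_ge1 by simp
  then show ?thesis unfolding rep_def using il samples_const[of y] heq_dup_Cons[of y "[\<rho> [l] y]"] c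
    by (intro conjI exI[of _ "[y, y]"]) simp_all
qed

section \<open>From chains of bounded cost to edges\<close>

lemma geodesic_samples:
  assumes "dist x y \<le> c" "t * c \<le> 2 * real \<theta>"
  shows "\<exists>p zs. path p \<and> pathstart p = x \<and> pathfinish p = y \<and> (\<forall>z\<in>path_image p. dist x z \<le> c) \<and>
    samples p zs \<and> len zs \<le> t * c"
proof -
  note ex = bspec[OF bspec[OF geodesic[unfolded geodesic_space_def] UNIV_I[of x]] UNIV_I[of y]]
  obtain g where g12: "g 0 = x" "g (dist x y) = y"
    and g3: "\<forall>a\<in>{0..dist x y}. \<forall>b\<in>{0..dist x y}. dist (g a) (g b) = \<bar>a - b\<bar>"
    using ex by (elim exE conjE)
  note g = g12 g3[rule_format]
  define p where "p u = g (u * dist x y)" for u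
  have in_dom: "u * dist x y \<in> {0..dist x y}" if "u \<in> {0..1}" for u
    using that mult_left_le_one_le[of "dist x y" u] by auto
  have dp: "dist (p u) (p v) = \<bar>u - v\<bar> * dist x y" if "u \<in> {0..1}" "v \<in> {0..1}" for u v
    unfolding p_def using g(3)[OF in_dom[OF that(1)] in_dom[OF that(2)]]
    by (simp add: abs_mult flip: left_diff_distrib)
  have ends: "pathstart p = x" "pathfinish p = y" using g by (simp_all add: p_def pathstart_def pathfinish_def)
  have "continuous_on {0..1} p"
    unfolding continuous_on_iff
  proof (intro ballI allI impI)
    fix u e :: real assume u: "u \<in> {0..1}" and e: "0 < e"
    show "\<exists>d>0. \<forall>v\<in>{0..1}. dist v u < d \<longrightarrow> dist (p v) (p u) < e"
    proof (intro exI conjI ballI impI)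
      show "0 < e / (dist x y + 1)" using e by (simp add: add_nonneg_pos)
      fix v assume v: "v \<in> {0..1}" "dist v u < e / (dist x y + 1)"
      then have "\<bar>v - u\<bar> * (dist x y + 1) < e"
        by (simp add: dist_real_def pos_less_divide_eq add_nonneg_pos)
      moreover have "\<bar>v - u\<bar> * dist x y \<le> \<bar>v - u\<bar> * (dist x y + 1)" by (intro mult_left_mono) auto
      ultimately show "dist (p v) (p u) < e" using dp[OF v(1) u] by simp
    qed
  qed
  then have path: "path p" by (simp add: path_def)
  have img: "dist x z \<le> c" if z: "z \<in> path_image p" for z
  proof -
    obtain u where u: "u \<in> {0..1}" "z = p u" using z by (auto simp: path_image_def)
    then have "dist x z = u * dist x y" using dp[of 0 u] g(1) by (simp add: p_def)
    also have "\<dots> \<le> dist x y" using u(1) by (simp add: mult_left_le_one_le)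
    finally show ?thesis using assms(1) by simp
  qed
  have tc: "t * dist x y \<le> t * c" using assms(1) t_gt0 by simp
  have near: "t * dist (p u) (p v) \<le> t * c / 2"
    if "u \<in> {0..1}" "v \<in> {0..1}" "\<bar>u - v\<bar> \<le> 1 / 2" for u v
  proof -
    have "\<bar>u - v\<bar> * (t * dist x y) \<le> (1 / 2) * (t * dist x y)"
      using that(3) t_gt0 by (intro mult_right_mono) auto
    then show ?thesis using dp[OF that(1,2)] tc by (simp add: mult.left_commute)
  qed
  \<comment> \<open>Each half of the geodesic has length at most \<theta> after scaling by t, since
    t c is at most 2\<theta>; one interior vertex suffices.\<close>
  have "sampling t (real \<theta>) p [0, 1 / 2, 1]"
  proof -
    have "t * dist (p ([0, 1 / 2, 1] ! i)) (p u) \<le> real \<theta>"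
      if "Suc i < 3" "u \<in> {[0, 1 / 2, 1] ! i..[0, 1 / 2, 1] ! Suc i}" for i and u :: real
    proof -
      have "i = 0 \<or> i = 1" using that(1) by auto
      then show ?thesis using near[of "[0, 1 / 2, 1] ! i" u] that(2) assms(2) by auto
    qed
    then show ?thesis by (auto simp: sampling_def numeral_3_eq_3)
  qed
  then have s: "samples p [p 0, p (1 / 2), p 1]" unfolding samples_def by (intro exI[of _ "[0, 1 / 2, 1]"]) simp
  have "len [p 0, p (1 / 2), p 1] \<le> t * c"
    using d_le[of "p 0" "p (1 / 2)"] d_le[of "p (1 / 2)" "p 1"] near[of 0 "1 / 2"] near[of "1 / 2" 1] by simp
  then show ?thesis using path ends img s by blast
qed

text \<open>Each of the n + 1 geodesic pieces is shorter than \<open>d0\<close> and gets translated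
  by a word of at most \<theta> letters, so it strays less than e from its start; this accounts for
  the factor n + 1. Sampling a geodesic does not lengthen it, so the list is no longer than the cost
  of the chain.\<close>

lemma reach_rep:
  assumes equi: "\<And>w a b. w \<in> words \<Longrightarrow> length w \<le> \<theta> \<Longrightarrow> dist a b < d0 \<Longrightarrow> dist (\<rho> w a) (\<rho> w b) < e"
    and r: "reach x y n c" and "n \<le> \<theta>" "c < d0" "t * c \<le> 2 * real \<theta>"
  shows "\<exists>zs q w. length w = n \<and> pathstart q = x \<and> rep zs q w y \<and> len zs \<le> real n + t * c \<and>
    (\<forall>z\<in>path_image q. dist x z < (real n + 1) * e)"
  using r assms(3-)
proof (induction rule: reach.induct)
  case (reach_base y c)
  obtain p zs where p: "path p" "pathstart p = x" "pathfinish p = y" "\<forall>z\<in>path_image p. dist x z \<le> c"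
    "samples p zs" "len zs \<le> t * c"
    using geodesic_samples[OF reach_base(1) reach_base(4)] by (elim exE conjE)
  have "dist x z < e" if "z \<in> path_image p" for z
    using equi[of "[]" x z] p(4)[rule_format, OF that] reach_base(3) by (simp add: rho_Nil)
  then show ?case using p rep_samples_self[OF p(1,5)]
    by (intro exI[of _ zs] exI[of _ p] exI[of _ "[]"]) auto
next
  case (reach_step y n c l z c')
  have c': "0 \<le> c'" using reach_step(3) order_trans[OF zero_le_dist] by blast
  have c: "0 \<le> c" by (rule reach_nonneg[OF reach_step(1)])
  have tc: "t * c \<le> t * (c + c')" "t * c' \<le> t * (c + c')" using c c' t_gt0 by auto
  obtain zs q w where IH: "length w = n" "pathstart q = x" "rep zs q w y" "len zs \<le> real n + t * c"
    "\<forall>z\<in>path_image q. dist x z < (real n + 1) * e"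
    using reach_step.IH reach_step.prems tc c' by auto
  define y' where "y' = \<rho> [l] y"
  have c'2: "t * c' \<le> 2 * real \<theta>" using reach_step.prems tc by linarith
  obtain p us where p: "path p" "pathstart p = y'" "pathfinish p = z" "\<forall>u\<in>path_image p. dist y' u \<le> c'"
    "samples p us" "len us \<le> t * c'"
    using geodesic_samples[OF reach_step(3)[folded y'_def] c'2] by (elim exE conjE)
  have il: "inv_letter l \<in> S \<times> UNIV" using reach_step(2) by simp
  have wy: "w \<in> words" "path q" "pathfinish q = \<rho> w y" using IH(3) by (simp_all add: rep_def)
  \<comment> \<open>Jumping on by l in the chain appends the inverse letter, as in
    \<open>rep_jump\<close>.\<close>
  let ?w = "w @ [inv_letter l]"
  have ww: "?w \<in> words" "length ?w \<le> \<theta>" using wy il reach_step.prems IH(1) by simp_all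
  have y'y: "\<rho> [inv_letter l] y' = y" using rho_cancel_letter[OF il, of y] by (simp add: y'_def)
  have wy': "\<rho> ?w y' = \<rho> w y"
    using rho_append[of w "[inv_letter l]" y'] y'y wy(1) il by simp
  let ?q2 = "(\<lambda>_. y) +++ (\<rho> [inv_letter l] \<circ> p)"
  have r2: "rep ([y, y'] @ tl us) ?q2 [inv_letter l] z"
    using rep_join[OF rep_jump[OF reach_step(2), of y] rep_samples_self[OF p(1,5)]] p(2,3) by (simp add: y'_def)
  have r3: "rep (zs @ tl ([y, y'] @ tl us)) (q +++ (\<rho> w \<circ> ?q2)) ?w z"
    using rep_join[OF IH(3) r2] by simp
  have us: "us \<noteq> []" "hd us = y'" using samples_ne[OF p(5)] samples_imp[OF p(5)] p(2) by auto
  have "len ([y, y'] @ tl us) = \<delta> y y' + len us" using len_join[of "[y, y']" us] us by simp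
  moreover have "len (zs @ tl ([y, y'] @ tl us)) = len zs + len ([y, y'] @ tl us)"
    using len_join[of zs "[y, y'] @ tl us"] rep_ends[OF IH(3)] by simp
  moreover have "\<delta> y y' \<le> 1" using delta_letter[OF reach_step(2)] by (simp add: y'_def)
  ultimately have "len (zs @ tl ([y, y'] @ tl us)) \<le> real (Suc n) + t * (c + c')"
    using IH(4) p(6) by (simp add: distrib_left)
  moreover have "dist x v < (real (Suc n) + 1) * e" if v: "v \<in> path_image (q +++ (\<rho> w \<circ> ?q2))" for v
  proof -
    have wqy: "\<rho> w y \<in> path_image q" using pathfinish_in_path_image[of q] wy(3) by simp
    have e: "0 < e" using equi[of "[]" x x] le_less_trans[OF c] reach_step.prems c' by auto
    have eq: "\<rho> w \<circ> ?q2 = (\<lambda>_. \<rho> w y) +++ (\<rho> ?w \<circ> p)"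
      using wy(1) il by (simp add: path_compose_join rho_comp_append)
    have "path_image (\<rho> w \<circ> ?q2) \<subseteq> {\<rho> w y} \<union> \<rho> ?w ` path_image p"
      unfolding eq using path_image_join_subset[of "\<lambda>_. \<rho> w y" "\<rho> ?w \<circ> p"]
      by (rule order_trans) (auto simp: path_image_compose path_image_def)
    then consider "v \<in> path_image q" | u where "u \<in> path_image p" "v = \<rho> ?w u"
      using v path_image_join_subset[of q "\<rho> w \<circ> ?q2"] wqy by blast
    then show ?thesis
    proof cases
      case 1
      then show ?thesis using IH(5) e by (auto simp: algebra_simps intro: less_trans)
    next
      case 2
      have "dist y' u < d0" using p(4)[rule_format, OF 2(1)] reach_step.prems c by simp
      then have "dist (\<rho> w y) v < e" using equi[OF ww, of y' u] wy' 2(2) by simp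
      moreover have "dist x (\<rho> w y) < (real n + 1) * e" using IH(5) wqy by blast
      ultimately show ?thesis using dist_triangle[of x v "\<rho> w y"] by (simp add: algebra_simps)
    qed
  qed
  moreover have "pathstart (q +++ (\<rho> w \<circ> ?q2)) = x" using IH(2) by simp
  ultimately show ?case using r3 IH(1)
    by (intro exI[of _ "zs @ tl ([y, y'] @ tl us)"] exI[of _ "q +++ (\<rho> w \<circ> ?q2)"] exI[of _ ?w]) simp
qed

text \<open>Here t has to be large: a chain of cost below \<theta> + 1/2 has t c < \<theta> + 1,
  which is at most t \<open>d0\<close>, so that c < \<open>d0\<close>. With at most \<theta> + 1
  pieces, each straying less than e / (\<theta> + 1), the path stays within e.\<close>

lemma edge_rep:
  assumes equi: "\<And>w a b. w \<in> words \<Longrightarrow> length w \<le> \<theta> \<Longrightarrow> dist a b < d0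
      \<Longrightarrow> dist (\<rho> w a) (\<rho> w b) < e / (real \<theta> + 1)"
    and t: "real \<theta> + 1 \<le> t * d0" and e: "0 < e" and xy: "\<delta> x y \<le> real \<theta>"
  shows "\<exists>q w. edge e x y q w \<and> rep [x, y] q w y"
proof -
  \<comment> \<open>The slack gives the strict bound needed to obtain a chain. Being less than 1 it
    still forces n to be at most \<theta>, and \<theta> + 1/2 is at most 2\<theta>, the length up to
    which \<open>heq_edge\<close> contracts a list to an edge.\<close>
  obtain n c where nc: "reach x y n c" "real n + t * c < real \<theta> + 1 / 2"
    using reach_of_warped_metric[OF t_gt0, of x y "real \<theta> + 1 / 2"] xy by auto
  have tc: "0 \<le> t * c" using reach_nonneg[OF nc(1)] t_gt0 by simp
  then have n: "n \<le> \<theta>" using nc(2) by linarith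
  have "t * c < t * d0" using nc(2) t by linarith
  then have c: "c < d0" using t_gt0 by simp
  have two: "real n + t * c \<le> 2 * real \<theta>" "t * c \<le> 2 * real \<theta>" using nc(2) theta_ge1 tc by linarith+
  obtain zs q w where *: "length w = n" "pathstart q = x" "rep zs q w y" "len zs \<le> real n + t * c"
    "\<forall>z\<in>path_image q. dist x z < (real n + 1) * (e / (real \<theta> + 1))"
    using reach_rep[OF equi nc(1) n c two(2)] by auto
  have zs: "tpath zs" "hd zs = x" "last zs = y"
    using *(2,3) rep_ends[OF *(3)] by (auto simp: rep_def)
  have "zs \<simeq> [x, y]" using heq_edge[OF zs(1)] zs(2,3) *(4) two(1) xy by simp
  then have "rep [x, y] q w y" by (rule rep_heq[OF *(3)])
  moreover have "(real n + 1) * (e / (real \<theta> + 1)) \<le> e"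
  proof -
    have "(real n + 1) * (e / (real \<theta> + 1)) \<le> (real \<theta> + 1) * (e / (real \<theta> + 1))"
      using n e by (intro mult_right_mono) auto
    then show ?thesis by simp
  qed
  ultimately show ?thesis using * n unfolding edge_def rep_def
    by (intro exI[of _ q] exI[of _ w]) (auto intro: less_le_trans)
qed

end

section \<open>The homomorphism onto the semidirect product\<close>

declare semidirect_product_simps [simp del]

lemma path_subinterval:
  assumes "path p" "u \<in> {0..1}" "v \<in> {0..1::real}"
  shows "path (p \<circ> linepath u v)"
proof (rule path_continuous_image[OF path_linepath])
  have "path_image (linepath u v) \<subseteq> {0..1}"
    using assms by (auto simp: closed_segment_eq_real_ivl)
  then show "continuous_on (path_image (linepath u v)) p"
    using assms(1) continuous_on_subset by (auto simp: path_def)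
qed

text \<open>Both sides are images under p of paths in the convex interval from 0 to 1 with the same
  ends, where the straight-line homotopy is available.\<close>

lemma homotopic_paths_subintervals:
  fixes p :: "real \<Rightarrow> 'a::topological_space"
  assumes p: "path p" and a: "a \<in> {0..1}" and b: "b \<in> {0..1}"
  shows "homotopic_paths UNIV ((p \<circ> linepath 0 a) +++ (p \<circ> linepath a b)) (p \<circ> linepath 0 b)"
  unfolding path_compose_join[symmetric]
proof (rule homotopic_paths_continuous_image)
  have seg: "path_image (linepath u v) \<subseteq> {0..1}" if "u \<in> {0..1}" "v \<in> {0..1}" for u v :: real
    using that by (auto simp: closed_segment_eq_real_ivl split: if_splits)
  have z: "0 \<in> {0..1::real}" by simp
  note A = subset_path_image_join[OF seg[OF z a] seg[OF a b]] seg[OF z b]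
  have mem: "q s \<in> {0..1}" if "path_image q \<subseteq> {0..1}" "s \<in> {0..1}" for q :: "real \<Rightarrow> real" and s
    by (rule subsetD[OF that(1)]) (use that(2) in \<open>simp add: path_image_def\<close>)
  show "homotopic_paths {0..1} (linepath 0 a +++ linepath a b) (linepath 0 b)"
  proof (rule homotopic_paths_linear)
    fix s :: real assume s: "s \<in> {0..1}"
    show "closed_segment ((linepath 0 a +++ linepath a b) s) (linepath 0 b s) \<subseteq> {0..1}"
      by (rule closed_segment_subset[OF mem[OF A(1) s] mem[OF A(2) s]]) simp
  qed simp_all
qed (use p in \<open>auto simp: path_def\<close>)

text \<open>All that the construction of the homomorphism uses of the size of t: every edge of
  warped length at most \<theta> is represented by an \<open>edge\<close> of the coherent size
  e.\<close>

locale coherent_level = warped_level x0 \<beta> \<Gamma> act S \<eta> R \<rho> \<alpha> \<theta> t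
  for x0 :: "'x::metric_space" and \<beta> and \<Gamma> :: "'g monoid" and act and S :: "'s set"
    and \<eta> and R and \<rho> and \<alpha> and \<theta> and t +
  fixes e :: real
  assumes coh: "coherent e" and e_pos: "0 < e"
    and edge_ex: "\<And>x y. \<delta> x y \<le> real \<theta> \<Longrightarrow> \<exists>q w. edge e x y q w \<and> rep [x, y] q w y"
begin


interpretation HH: group H by (rule group_H)

section \<open>Labels of edges and their products along discrete paths\<close>

definition lab :: "'x \<Rightarrow> 'x \<Rightarrow> (real \<Rightarrow> 'x) set set \<times> 's letter list set" where
  "lab x y = (SOME h. \<exists>q w. edge e x y q w \<and> h = \<kappa> q w y)"

lemma edge_imp: "edge e x y q w \<Longrightarrow> w \<in> words \<and> path q \<and> pathstart q = x \<and> pathfinish q = \<rho> w y"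
  by (simp add: edge_def)

lemma edge_const: "edge e x x (\<lambda>_. x) []"
  using e_pos by (simp add: edge_def rho_Nil path_image_def)

lemma lab_eq:
  assumes E: "edge e x y q w"
  shows "lab x y = \<kappa> q w y"
proof -
  have "\<exists>h q w. edge e x y q w \<and> h = \<kappa> q w y"
    by (intro exI conjI, rule E, rule HOL.refl)
  then have "\<exists>q w. edge e x y q w \<and> lab x y = \<kappa> q w y" unfolding lab_def by (rule someI_ex)
  then obtain q' w' where E': "edge e x y q' w'" "lab x y = \<kappa> q' w' y" by (elim exE conjE)
  \<comment> \<open>Coherence around the degenerate quadrilateral whose second edges are both
    constant at y.\<close>
  have "\<kappa> q w y \<otimes>\<^bsub>H\<^esub> \<kappa> (\<lambda>_. y) [] y = \<kappa> q' w' y \<otimes>\<^bsub>H\<^esub> \<kappa> (\<lambda>_. y) [] y"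
    using coh[unfolded coherent_def, rule_format, OF E edge_const E'(1) edge_const] .
  then show ?thesis using edge_imp[OF E] edge_imp[OF E'(1)] E'(2) by (simp add: kappa_const)
qed

lemma lab_closed: "\<delta> x y \<le> real \<theta> \<Longrightarrow> lab x y \<in> carrier H"
  using edge_ex[of x y] lab_eq edge_imp kappa_closed by metis

lemma lab_self: "lab x x = \<one>\<^bsub>H\<^esub>"
  using lab_eq[OF edge_const] by (simp add: kappa_const)

lemma lab_square:
  assumes "\<delta> a b \<le> real \<theta>" "\<delta> b z \<le> real \<theta>" "\<delta> a c \<le> real \<theta>" "\<delta> c z \<le> real \<theta>"
  shows "lab a b \<otimes>\<^bsub>H\<^esub> lab b z = lab a c \<otimes>\<^bsub>H\<^esub> lab c z"
proof -
  obtain q1 w1 q2 w2 q3 w3 q4 w4 where E: "edge e a b q1 w1" "edge e b z q2 w2" "edge e a c q3 w3" "edge e c z q4 w4"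
    using edge_ex[OF assms(1)] edge_ex[OF assms(2)] edge_ex[OF assms(3)] edge_ex[OF assms(4)] by auto
  show ?thesis
    unfolding lab_eq[OF E(1)] lab_eq[OF E(2)] lab_eq[OF E(3)] lab_eq[OF E(4)]
    using coh[unfolded coherent_def, rule_format, OF E] .
qed

fun lam :: "'x list \<Rightarrow> (real \<Rightarrow> 'x) set set \<times> 's letter list set" where
  "lam (x # y # zs) = lab x y \<otimes>\<^bsub>H\<^esub> lam (y # zs)"
| "lam _ = \<one>\<^bsub>H\<^esub>"

lemma lam_closed [simp]: "tpath zs \<Longrightarrow> lam zs \<in> carrier H"
proof (induction zs)
  case (Cons x zs)
  then show ?case using lab_closed by (cases zs) auto
qed simp

lemma lam_append:
  "tpath (us @ a # vs) \<Longrightarrow> lam (us @ a # vs) = lam (us @ [a]) \<otimes>\<^bsub>H\<^esub> lam (a # vs)"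
proof (induction us)
  case Nil
  then show ?case by simp
next
  case (Cons u us)
  show ?case
  proof (cases us)
    case Nil
    then show ?thesis using Cons.prems lab_closed by simp
  next
    case (Cons u' us')
    then have tp: "\<delta> u u' \<le> real \<theta>" "tpath (us @ a # vs)" using Cons.prems by simp_all
    have "tpath (us @ [a])" "tpath (a # vs)"
      using tp(2) Cons theta_path_append[of us "[a]"] theta_path_append[of us "a # vs"] by simp_all
    then show ?thesis
      using Cons.IH[OF tp(2)] Cons lab_closed[OF tp(1)] HH.m_assoc[of "lab u u'" "lam (us @ [a])" "lam (a # vs)"] by simp
  qed
qed

lemma lam_join:
  assumes "tpath xs" "tpath ys" "last xs = hd ys"
  shows "lam (xs @ tl ys) = lam xs \<otimes>\<^bsub>H\<^esub> lam ys"
proof -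
  have ne: "xs \<noteq> []" "ys \<noteq> []" using assms by auto
  then have "xs @ tl ys = butlast xs @ hd ys # tl ys" "butlast xs @ [hd ys] = xs"
    using assms(3) append_butlast_last_id[of xs] by (metis append.assoc append_Cons append_Nil, metis)
  moreover have "tpath (xs @ tl ys)" using theta_path_join[OF ne assms(3)] assms by simp
  ultimately show ?thesis using lam_append[of "butlast xs" "hd ys" "tl ys"] ne by simp
qed

text \<open>Doubling a vertex inserts the trivial label of a constant edge, and a flip replaces a
  product of two labels by an equal one by coherence.\<close>

lemma lam_heq: "xs \<simeq> ys \<Longrightarrow> tpath xs \<Longrightarrow> lam xs = lam ys"
proof (induction rule: theta_homotopic.induct)
  case (homotopic_sym xs ys)
  then show ?case using heq_imp[of xs ys] by simp
next
  case (homotopic_trans xs ys zs)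
  then show ?case using heq_imp[of xs ys] by simp
next
  case (homotopic_dup us a vs)
  have tp: "tpath (us @ a # a # vs)"
    using heq_imp[OF theta_homotopic.homotopic_dup[of \<delta> "real \<theta>" us a vs]] homotopic_dup by simp
  have "tpath (a # vs)"
    using homotopic_dup theta_path_append[of us "a # vs"] by (cases us) auto
  then show ?case using lam_append[of us a vs] lam_append[of us a "a # vs"] homotopic_dup tp
    by (simp add: lab_self)
next
  case (homotopic_square a b z c us vs)
  have tp': "tpath (us @ a # c # z # vs)"
    using heq_imp[OF theta_homotopic.homotopic_square[OF homotopic_square(1-4), of us vs]] homotopic_square by simp
  have "tpath (z # vs)"
    using homotopic_square.prems theta_path_append[of us "a # b # z # vs"] by (cases us) auto
  then have "lam (a # b # z # vs) = lam (a # c # z # vs)"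
    using homotopic_square(1-4) lab_square[OF homotopic_square(1-4)] lab_closed
      HH.m_assoc[of "lab a b" "lab b z" "lam (z # vs)"] HH.m_assoc[of "lab a c" "lab c z" "lam (z # vs)"]
    by simp
  then show ?case
    using lam_append[of us a "b # z # vs"] lam_append[of us a "c # z # vs"] homotopic_square.prems tp' by simp
qed simp

lemma kappa_L: "L q = L q' \<Longrightarrow> \<kappa> q w y = \<kappa> q' w y"
  by (simp add: \<kappa>_def)

text \<open>The given sampling is controlled by \<theta> and t, not by e. It is exchanged for one so
  fine that each piece of p is an edge with empty word; the labels of the pieces then multiply to
  the label of p.\<close>

lemma lam_samples:
  assumes p: "path p" and us: "samples p us"
  shows "lam us = \<kappa> p [] (pathfinish p)"
proof -
  obtain N1 where N1: "0 < N1"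
    "\<And>n u v. N1 \<le> n \<Longrightarrow> u \<in> {0..1} \<Longrightarrow> v \<in> {0..1} \<Longrightarrow> \<bar>u - v\<bar> \<le> 1 / real n \<Longrightarrow> dist (p u) (p v) < e"
    using fine_unif[OF p e_pos] by blast
  obtain N2 where N2: "\<forall>n\<ge>N2. sampling t (real \<theta>) p (unif n)" using sampling_unif_eventually[OF p] by auto
  define n where "n = max N1 N2"
  have n: "0 < n" "N1 \<le> n" using N1(1) by (auto simp: n_def)
  have "sampling t (real \<theta>) p (unif n)" using N2 by (simp add: n_def)
  then have s: "samples p (map p (unif n))" unfolding samples_def by blast
  let ?u = "\<lambda>i. real i / real n"
  have idc: "(\<lambda>x. x) \<circ> q = q" for q :: "real \<Rightarrow> 'x" by auto
  have in01: "?u i \<in> {0..1}" if "i \<le> n" for i using that n by auto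
  have E: "edge e (p (?u i)) (p (?u (Suc i))) (p \<circ> linepath (?u i) (?u (Suc i))) []" if i: "Suc i \<le> n" for i
  proof -
    have "dist (p (?u i)) z < e" if z: "z \<in> path_image (p \<circ> linepath (?u i) (?u (Suc i)))" for z
    proof -
      have le: "?u i \<le> ?u (Suc i)" using n by (simp add: divide_right_mono)
      obtain v where v: "v \<in> {?u i..?u (Suc i)}" "z = p v"
        using z le by (auto simp: path_image_compose closed_segment_eq_real_ivl)
      have "?u (Suc i) - ?u i = 1 / real n" using n by (simp add: field_simps)
      then have "\<bar>?u i - v\<bar> \<le> 1 / real n" using v(1) by auto
      moreover have "v \<in> {0..1}"
        using v(1) in01[of i] in01[of "Suc i"] i unfolding atLeastAtMost_iff by linarith
      ultimately show ?thesis using N1(2)[OF n(2) in01[of i]] v(2) i by simp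
    qed
    then show ?thesis using path_subinterval[OF p in01[of i] in01[of "Suc i"]] i
      by (simp add: edge_def rho_Nil path_compose)
  qed
  have tp: "tpath (map (\<lambda>i. p (?u i)) [0..<Suc j])" if "j \<le> n" for j
  proof -
    have "map p (unif n) = map (\<lambda>i. p (?u i)) [0..<Suc j] @ map (\<lambda>i. p (?u i)) [Suc j..<Suc n]"
      using upt_add_eq_append[of 0 "Suc j" "n - j"] that by (simp add: unif_def o_def flip: map_append)
    then show ?thesis
      using samples_imp(1)[OF s] theta_path_append[of "map (\<lambda>i. p (?u i)) [0..<Suc j]" "map (\<lambda>i. p (?u i)) [Suc j..<Suc n]"]
      by (cases "[Suc j..<Suc n] = []") (simp_all del: upt_Suc)
  qed
  have main: "lam (map (\<lambda>i. p (?u i)) [0..<Suc j]) = \<kappa> (p \<circ> linepath 0 (?u j)) [] (p (?u j))" if "j \<le> n" for j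
    using that
  proof (induction j)
    case 0
    have "p \<circ> linepath 0 0 = (\<lambda>_. p 0)" by (simp add: linepath_refl)
    then show ?case using kappa_const by simp
  next
    case (Suc j)
    let ?xs = "map (\<lambda>i. p (?u i)) [0..<Suc j]"
    have j: "j \<le> n" using Suc.prems by simp
    have d: "tpath [p (?u j), p (?u (Suc j))]"
      using tp[OF Suc.prems] theta_path_append[of "?xs" "[p (?u (Suc j))]"] by simp
    have "map (\<lambda>i. p (?u i)) [0..<Suc (Suc j)] = ?xs @ tl [p (?u j), p (?u (Suc j))]" by simp
    then have "lam (map (\<lambda>i. p (?u i)) [0..<Suc (Suc j)]) = lam ?xs \<otimes>\<^bsub>H\<^esub> lam [p (?u j), p (?u (Suc j))]"
      using lam_join[OF tp[OF j] d] by simp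
    also have "lam [p (?u j), p (?u (Suc j))] = \<kappa> (p \<circ> linepath (?u j) (?u (Suc j))) [] (p (?u (Suc j)))"
      using lab_eq[OF E[OF Suc.prems]] path_subinterval[OF p in01[OF j] in01[OF Suc.prems]] by simp
    also have "lam ?xs = \<kappa> (p \<circ> linepath 0 (?u j)) [] (p (?u j))" by (rule Suc.IH[OF j])
    also have "\<kappa> (p \<circ> linepath 0 (?u j)) [] (p (?u j)) \<otimes>\<^bsub>H\<^esub> \<kappa> (p \<circ> linepath (?u j) (?u (Suc j))) [] (p (?u (Suc j))) =
        \<kappa> ((p \<circ> linepath 0 (?u j)) +++ (p \<circ> linepath (?u j) (?u (Suc j)))) [] (p (?u (Suc j)))"
      using path_subinterval[OF p in01[OF j] in01[OF Suc.prems]] path_subinterval[OF p _ in01[OF j], of 0]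
      by (subst kappa_mult) (simp_all add: rho_Nil path_compose idc)
    also have "\<dots> = \<kappa> (p \<circ> linepath 0 (?u (Suc j))) [] (p (?u (Suc j)))"
      by (intro kappa_L L_homotopic homotopic_paths_subintervals p in01[OF j] in01[OF Suc.prems])
    finally show ?case .
  qed
  have lp: "p \<circ> linepath 0 1 = p" by (simp add: linepath_def o_def)
  have "map (\<lambda>i. p (?u i)) [0..<Suc n] = map p (unif n)" by (simp add: unif_def)
  then have "lam (map p (unif n)) = \<kappa> p [] (pathfinish p)"
    using main[of n] n lp by (simp add: pathfinish_def)
  then show ?thesis using lam_heq[OF samples_heq[OF p us s] samples_imp(1)[OF us]] by simp
qed

text \<open>A single jump is an edge with constant path and a word of one letter, which is short
  enough because \<theta> is at least 1.\<close>

lemma lam_jumps: "w \<in> words \<Longrightarrow> lam (jumps w y) = \<kappa> (\<lambda>_. \<rho> w y) w y"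
proof (induction w)
  case Nil
  then show ?case using kappa_const by (simp add: rho_Nil)
next
  case (Cons l w)
  then have lw: "l \<in> S \<times> UNIV" "[l] \<in> words" "w \<in> words" by simp_all
  have r: "\<rho> (l # w) y = \<rho> [l] (\<rho> w y)" by (rule rho_Cons[OF lw(1,3)])
  have E: "edge e (\<rho> (l # w) y) (\<rho> w y) (\<lambda>_. \<rho> (l # w) y) [l]"
    using lw e_pos r theta_ge1 by (simp add: edge_def path_image_def)
  define zs where "zs = tl (jumps w y)"
  have c: "jumps w y = \<rho> w y # zs" using hd_Cons_tl[of "jumps w y"] by (simp add: zs_def)
  have "lam (jumps (l # w) y) = lab (\<rho> (l # w) y) (\<rho> w y) \<otimes>\<^bsub>H\<^esub> lam (jumps w y)"
    by (simp add: c)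
  also have "\<dots> = \<kappa> (\<lambda>_. \<rho> (l # w) y) [l] (\<rho> w y) \<otimes>\<^bsub>H\<^esub> \<kappa> (\<lambda>_. \<rho> w y) w y"
    using lab_eq[OF E] Cons.IH lw by simp
  also have "\<dots> = \<kappa> ((\<lambda>_. \<rho> (l # w) y) +++ (\<rho> [l] \<circ> (\<lambda>_. \<rho> w y))) ([l] @ w) y"
    using lw r by (intro kappa_mult) simp_all
  also have "\<dots> = \<kappa> (\<lambda>_. \<rho> (l # w) y) ([l] @ w) y"
    using r by (intro kappa_L) (simp add: L_join)
  finally show ?case by simp
qed

text \<open>Labels are known edge by edge only, but their product can be read off from any
  representing pair, however long its path and its word.\<close>

lemma lam_rep:
  assumes "rep zs q w y"
  shows "lam zs = \<kappa> q w y"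
proof -
  have w: "w \<in> words" "path q" "pathfinish q = \<rho> w y" "tpath zs" using assms by (auto simp: rep_def)
  obtain us where us: "samples q us" "zs \<simeq> us @ tl (jumps w y)" using assms by (auto simp: rep_def)
  have "lam zs = lam (us @ tl (jumps w y))" by (rule lam_heq[OF us(2) w(4)])
  also have "\<dots> = lam us \<otimes>\<^bsub>H\<^esub> lam (jumps w y)"
    using samples_imp[OF us(1)] w by (intro lam_join) auto
  also have "\<dots> = \<kappa> q [] (\<rho> w y) \<otimes>\<^bsub>H\<^esub> \<kappa> (\<lambda>_. \<rho> w y) w y"
    using lam_samples[OF w(2) us(1)] lam_jumps[OF w(1)] w(3) by simp
  also have "\<dots> = \<kappa> (q +++ (\<rho> [] \<circ> (\<lambda>_. \<rho> w y))) ([] @ w) y"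
    using w by (intro kappa_mult) (simp_all add: rho_Nil)
  also have "\<dots> = \<kappa> q w y"
    using w L_join[of q "\<lambda>_. \<rho> w y"] kappa_L[of "q +++ (\<lambda>_. \<rho> w y)" q w y] by (simp add: rho_Nil)
  finally show ?thesis .
qed

lemma rep_exists:
  assumes "tpath zs"
  shows "\<exists>q w. pathstart q = hd zs \<and> rep zs q w (last zs)"
  using assms
proof (induction zs)
  case (Cons x zs)
  show ?case
  proof (cases zs)
    case Nil
    then show ?thesis using rep_const[of x] by (intro exI[of _ "\<lambda>_. x"] exI[of _ "[]"]) simp
  next
    case zs: (Cons y ys)
    have d: "\<delta> x y \<le> real \<theta>" "tpath zs" using Cons.prems zs by simp_all
    obtain q w where q: "rep [x, y] q w y" using edge_ex[OF d(1)] by auto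
    obtain q' w' where q': "pathstart q' = y" "rep zs q' w' (last zs)" using Cons.IH[OF d(2)] zs by auto
    have "rep ([x, y] @ tl zs) (q +++ (\<rho> w \<circ> q')) (w @ w') (last zs)"
      by (rule rep_join[OF q q'(2,1)])
    then show ?thesis using rep_ends[OF q] zs
      by (intro exI[of _ "q +++ (\<rho> w \<circ> q')"] exI[of _ "w @ w'"]) simp
  qed
qed simp

subsection \<open>Classes of jumping loops\<close>

abbreviation "\<P> \<equiv> discrete_fundamental_group \<delta> (real \<theta>) x0"
abbreviation "\<LL> \<equiv> theta_loops \<delta> (real \<theta>) x0"
abbreviation "cl \<equiv> theta_class \<delta> (real \<theta>) x0"

interpretation PP: group \<P> by (rule group_discrete)

definition jloop :: "(real \<Rightarrow> 'x) \<Rightarrow> 's letter list \<Rightarrow> bool" where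
  "jloop c w \<longleftrightarrow> w \<in> words \<and> path c \<and> pathstart c = x0 \<and> pathfinish c = \<rho> w x0"

text \<open>A function of the pair (c, w), so that relations between classes become equations. By
  \<open>samples_heq\<close> any sampling of c gives the same class.\<close>

definition vcls :: "(real \<Rightarrow> 'x) \<Rightarrow> 's letter list \<Rightarrow> 'x list set" where
  "vcls c w = cl ((SOME us. samples c us) @ tl (jumps w x0))"

lemma rep_self:
  assumes "jloop c w" "samples c us"
  shows "rep (us @ tl (jumps w x0)) c w x0"
proof -
  have "tpath (us @ tl (jumps w x0))"
    using assms samples_imp[OF assms(2)] samples_ne[OF assms(2)]
    by (subst theta_path_join) (auto simp: jloop_def)
  then show ?thesis using assms by (auto simp: rep_def jloop_def)
qed

lemma rep_vcls:
  assumes "rep zs c w x0" "pathstart c = x0"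
  shows "zs \<in> \<LL>" "cl zs = vcls c w" "jloop c w"
proof -
  show j: "jloop c w" using assms by (simp add: rep_def jloop_def)
  show z: "zs \<in> \<LL>" using assms rep_ends[OF assms(1)] by (simp add: theta_loops_def rep_def)
  obtain us where "samples c us" using samples_exists[of c] assms(1) by (auto simp: rep_def)
  then have s: "samples c (SOME us. samples c us)" by (rule someI)
  have h: "zs \<simeq> (SOME us. samples c us) @ tl (jumps w x0)" by (rule rep_samples[OF assms(1) s])
  then show "cl zs = vcls c w" unfolding vcls_def using theta_class_eq_iff[OF z] theta_loops_heq[OF h] z by simp
qed

lemma vcls_samples:
  assumes "jloop c w" "samples c us"
  shows "us @ tl (jumps w x0) \<in> \<LL>" "vcls c w = cl (us @ tl (jumps w x0))"
  using rep_vcls[OF rep_self[OF assms]] assms(1) by (auto simp: jloop_def)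

lemma jloop_samples: "jloop c w \<Longrightarrow> \<exists>us. samples c us"
  using samples_exists[of c] by (simp add: jloop_def)

lemma vcls_closed [simp]: "jloop c w \<Longrightarrow> vcls c w \<in> carrier \<P>"
  using jloop_samples[of c w] vcls_samples[of c w] by (auto simp: discrete_carrier)

lemma jloop_mult: "jloop c w \<Longrightarrow> jloop c' w' \<Longrightarrow> jloop (c +++ (\<rho> w \<circ> c')) (w @ w')"
  by (simp add: jloop_def path_compose rho_append)

lemma vcls_mult:
  assumes "jloop c w" "jloop c' w'"
  shows "vcls c w \<otimes>\<^bsub>\<P>\<^esub> vcls c' w' = vcls (c +++ (\<rho> w \<circ> c')) (w @ w')"
proof -
  obtain us us' where us: "samples c us" "samples c' us'" using jloop_samples assms by metis
  note r = rep_self[OF assms(1) us(1)] rep_self[OF assms(2) us(2)]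
  have st: "pathstart c = x0" "pathstart c' = x0" using assms by (auto simp: jloop_def)
  note v = rep_vcls[OF r(1) st(1)] rep_vcls[OF r(2) st(2)]
  have "pathstart (c +++ (\<rho> w \<circ> c')) = x0" using st by simp
  from rep_vcls(2)[OF rep_join[OF r st(2)] this] show ?thesis
    using discrete_mult[OF v(1) v(4)] v by simp
qed

lemma vcls_cong:
  assumes "jloop c w" "jloop c' w" "L c = L c'"
  shows "vcls c w = vcls c' w"
proof -
  obtain us us' where us: "samples c us" "samples c' us'" using jloop_samples assms by metis
  have "homotopic_paths UNIV c c'" using assms by (intro L_eqD) (auto simp: jloop_def)
  from heq_append1[OF samples_homotopic[OF this us]]
  show ?thesis
    using vcls_samples[OF assms(1) us(1)] vcls_samples[OF assms(2) us(2)] theta_class_eq_iff by simp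
qed

lemma jumps_normal_form:
  assumes "w \<in> words"
  shows "jumps w y \<simeq> jumps (normal_form w) y"
proof -
  \<comment> \<open>Equality of values is carried along because the first vertex of the jumps of l u
    depends on the value of the whole word.\<close>
  have "val w = val (normal_form w) \<and> (\<forall>y. jumps w y \<simeq> jumps (normal_form w) y)"
  proof (rule words_invariant[OF assms, where E = "\<lambda>u v. val u = val v \<and> (\<forall>y. jumps u y \<simeq> jumps v y)"])
    fix u v w assume "val u = val v \<and> (\<forall>y. jumps u y \<simeq> jumps v y)" "val v = val w \<and> (\<forall>y. jumps v y \<simeq> jumps w y)"
    then have *: "val u = val w" "\<And>y. jumps u y \<simeq> jumps v y" "\<And>y. jumps v y \<simeq> jumps w y" by simp_all
    show "val u = val w \<and> (\<forall>y. jumps u y \<simeq> jumps w y)"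
      by (intro conjI allI *(1) heq_trans[OF *(2,3)])
  next
    fix l u v assume *: "l \<in> S \<times> (UNIV :: bool set)" "val u = val v \<and> (\<forall>y. jumps u y \<simeq> jumps v y)"
    then have v: "val (l # u) = val (l # v)" by simp
    have "jumps (l # u) y \<simeq> jumps (l # v) y" for y
      using *(2) rho_cong[OF v] by (simp add: heq_Cons)
    with v show "val (l # u) = val (l # v) \<and> (\<forall>y. jumps (l # u) y \<simeq> jumps (l # v) y)" by blast
  next
    fix l v assume lv: "l \<in> S \<times> (UNIV :: bool set)" "v \<in> words"
    have il: "inv_letter l \<in> S \<times> UNIV" using lv(1) by simp
    have v: "val (l # inv_letter l # v) = val v"
      using lv il by (simp add: letter_val_inv Gam.inv_cancel)
    have "jumps (l # inv_letter l # v) y \<simeq> jumps v y" for y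
    proof -
      define a b where "a = \<rho> v y" and "b = \<rho> (inv_letter l # v) y"
      have "b = \<rho> [inv_letter l] a" using rho_Cons[OF il lv(2)] by (simp add: a_def b_def)
      then have ab: "\<delta> a b \<le> real \<theta>" using delta_letter[OF il, of a] theta_ge1 by simp
      have c: "jumps v y = a # tl (jumps v y)" using hd_Cons_tl[of "jumps v y"] by (simp add: a_def)
      have "jumps (l # inv_letter l # v) y = [a, b, a] @ tl (jumps v y)"
        using rho_cong[OF v] c by (simp add: a_def b_def)
      also have "\<dots> \<simeq> [a] @ tl (jumps v y)" using heq_spur[OF ab, of "[]" "tl (jumps v y)"] by simp
      finally show ?thesis using c by simp
    qed
    with v show "val (l # inv_letter l # v) = val v \<and> (\<forall>y. jumps (l # inv_letter l # v) y \<simeq> jumps v y)" by blast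
  qed simp_all
  then show ?thesis by simp
qed

lemma jloop_normal_form: "jloop c w \<Longrightarrow> jloop c (normal_form w)"
  by (simp add: jloop_def rho_normal_form)

lemma vcls_normal_form:
  assumes "jloop c w"
  shows "vcls c (normal_form w) = vcls c w"
proof -
  obtain us where us: "samples c us" using jloop_samples assms by metis
  have w: "w \<in> words" using assms by (simp add: jloop_def)
  have "us @ tl (jumps w x0) \<simeq> us @ tl (jumps (normal_form w) x0)"
    by (rule heq_join[OF heq_refl jumps_normal_form[OF w]])
      (use samples_ne[OF us] samples_imp(3)[OF us] assms in \<open>auto simp: jloop_def\<close>)
  then show ?thesis
    using vcls_samples[OF assms us] vcls_samples[OF jloop_normal_form[OF assms] us]
      theta_class_eq_iff[OF vcls_samples(1)[OF assms us] vcls_samples(1)[OF jloop_normal_form[OF assms] us]] by simp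
qed

section \<open>Relators whose jumps contract\<close>

text \<open>Contraction is demanded at every point, not only at the base point: in a conjugate of r
  the jumps along r take place at a translated point, so this is what makes the set normal.\<close>

definition T :: "'s letter list set" where
  "T = {r \<in> carrier F. val r = \<one>\<^bsub>\<Gamma>\<^esub> \<and> (\<forall>x. jumps r x \<simeq> [x])}"

lemma jumps_append_heq:
  assumes "u \<in> words" "v \<in> words" "jumps u (\<rho> v y) \<simeq> us" "jumps v y \<simeq> vs"
  shows "jumps (u @ v) y \<simeq> us @ tl vs"
  unfolding jumps_append[OF assms(1,2)] by (rule heq_join[OF assms(3,4)]) simp_all

lemma jumps_inv_word: "w \<in> words \<Longrightarrow> jumps (w @ inv_word w) y \<simeq> [y]"
  using jumps_normal_form[of "w @ inv_word w" y] by (simp add: normal_form_inv_word)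

lemma T_normal: "T \<lhd> F"
proof (subst F.normal_inv_iff, intro conjI ballI)
  \<comment> \<open>The jumps of r r^-1 contract by cancellation and those of r by assumption, hence
    those of r^-1 contract as well.\<close>
  have inv: "jumps (inv_word r) x \<simeq> [x]" if "r \<in> T" for r x
  proof -
    have r: "r \<in> words" "val r = \<one>\<^bsub>\<Gamma>\<^esub>" "\<And>x. jumps r x \<simeq> [x]" using that by (auto simp: T_def carrier_F)
    have "\<rho> (inv_word r) x = x" using rho_trivial[of "inv_word r"] r by (simp add: val_inv_word)
    then have "jumps (r @ inv_word r) x \<simeq> [x] @ tl (jumps (inv_word r) x)"
      using r by (intro jumps_append_heq) auto
    also have "\<dots> = jumps (inv_word r) x"
      using hd_Cons_tl[of "jumps (inv_word r) x"] \<open>\<rho> (inv_word r) x = x\<close> by simp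
    finally show ?thesis using heq_trans[OF heq_sym jumps_inv_word[OF r(1)]] by blast
  qed
  show "subgroup T F"
  proof (rule F.subgroupI)
    have "[] \<in> T" by (simp add: T_def carrier_F)
    then show "T \<noteq> {}" by auto
    fix r assume r: "r \<in> T"
    then have "val (normal_form (inv_word r)) = \<one>\<^bsub>\<Gamma>\<^esub>"
      by (simp add: T_def val_normal_form val_inv_word)
    moreover have "jumps (normal_form (inv_word r)) x \<simeq> [x]" for x
      using r by (intro heq_trans[OF heq_sym[OF jumps_normal_form] inv[OF r]]) (simp add: T_def)
    ultimately show "inv\<^bsub>F\<^esub> r \<in> T" using r by (simp add: T_def inv_free_group)
  next
    fix r s assume rs: "r \<in> T" "s \<in> T"
    then have "jumps (r @ s) x \<simeq> [x] @ tl [x]" for x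
      by (intro jumps_append_heq) (auto simp: T_def rho_trivial)
    then have "jumps (normal_form (r @ s)) x \<simeq> [x]" for x
      using rs heq_trans[OF heq_sym[OF jumps_normal_form[of "r @ s" x]]] by (simp add: T_def)
    then show "r \<otimes>\<^bsub>F\<^esub> s \<in> T" using rs by (simp add: T_def free_group_simps val_normal_form val_append)
  qed (auto simp: T_def)
  fix w r assume w: "w \<in> carrier F" and r: "r \<in> T"
  have ww: "w \<in> words" "r \<in> words" "val r = \<one>\<^bsub>\<Gamma>\<^esub>" using w r by (auto simp: T_def)
  let ?c = "w @ r @ inv_word w"
  have "jumps ?c x \<simeq> [x]" for x
  proof -
    have "jumps (r @ inv_word w) x \<simeq> [\<rho> (inv_word w) x] @ tl (jumps (inv_word w) x)"
      using r ww by (intro jumps_append_heq) (auto simp: T_def)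
    also have "\<dots> = jumps (inv_word w) x" using hd_Cons_tl[of "jumps (inv_word w) x"] by simp
    finally have "jumps ?c x \<simeq> jumps w (\<rho> (r @ inv_word w) x) @ tl (jumps (inv_word w) x)"
      using ww by (intro jumps_append_heq) auto
    also have "\<dots> = jumps (w @ inv_word w) x"
      using ww rho_trivial[of r] by (simp add: rho_append jumps_append)
    also have "\<dots> \<simeq> [x]" by (rule jumps_inv_word[OF ww(1)])
    finally show ?thesis .
  qed
  then have "jumps (normal_form ?c) x \<simeq> [x]" for x
    using ww heq_trans[OF heq_sym[OF jumps_normal_form[of ?c x]]] by simp
  moreover have "w \<otimes>\<^bsub>F\<^esub> r \<otimes>\<^bsub>F\<^esub> inv\<^bsub>F\<^esub> w = normal_form ?c"
    using w by (simp add: free_group_simps inv_free_group normal_form_append_normal_form)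
  ultimately show "w \<otimes>\<^bsub>F\<^esub> r \<otimes>\<^bsub>F\<^esub> inv\<^bsub>F\<^esub> w \<in> T"
    using ww by (simp add: T_def val_normal_form val_append val_inv_word)
qed

lemma N\<theta>_T: "N\<theta> \<subseteq> T"
proof (rule normal_closure_least[OF T_normal], rule subsetI)
  fix r assume r: "r \<in> R\<theta>"
  then have rr: "r \<in> words" "val r = \<one>\<^bsub>\<Gamma>\<^esub>" "length r \<le> 4 * \<theta>" by (auto simp: R\<theta>_iff)
  have "jumps r x \<simeq> [x]" for x
    using heq_closed_unit_steps[OF jumps_unit_steps[OF rr(1), of x], of \<theta>] rr rho_trivial[OF rr(2)] by simp
  then show "r \<in> T" using r by (simp add: T_def R\<theta>_iff)
qed

lemma apath_jloop: "w \<in> words \<Longrightarrow> jloop (apath w) w"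
  by (simp add: jloop_def)

section \<open>Lifts of words and of loops to the discrete fundamental group\<close>

text \<open>The lift of the element (1, w) of the semidirect product: \<alpha>_w followed by the
  jumps along w^-1.\<close>

definition U :: "'s letter list \<Rightarrow> 'x list set" where
  "U w = vcls (apath w) w"

lemma U_normal_form:
  assumes "w \<in> words"
  shows "U (normal_form w) = U w"
proof -
  have "vcls (apath (normal_form w)) (normal_form w) = vcls (apath w) (normal_form w)"
    using assms L_apath_normal_form[of w "[]"] apath_jloop[of "normal_form w"]
    by (intro vcls_cong jloop_normal_form apath_jloop) simp_all
  then show ?thesis unfolding U_def using vcls_normal_form[OF apath_jloop[OF assms]] by simp
qed

lemma U_append:
  assumes "u \<in> words" "v \<in> words"
  shows "U (u @ v) = U u \<otimes>\<^bsub>\<P>\<^esub> U v"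
proof -
  note j = apath_jloop[OF assms(1)] apath_jloop[OF assms(2)]
  have "L (apath (u @ v)) = L (apath u +++ (\<rho> u \<circ> apath v))"
    using L_apath_append[of u v "[]"] assms by (simp add: L_join path_compose)
  then show ?thesis
    unfolding U_def vcls_mult[OF j] using assms jloop_mult[OF j] by (intro vcls_cong apath_jloop) simp_all
qed

lemma U_hom: "U \<in> hom F \<P>"
proof (rule homI)
  show "U w \<in> carrier \<P>" if "w \<in> carrier F" for w
    using that unfolding U_def by (intro vcls_closed apath_jloop) simp
qed (simp add: free_group_simps U_normal_form U_append)

text \<open>The homomorphism induced by discretization, in a form adapted to \<open>L\<close>; by
  \<open>discretize_loop\<close> both take the value \<open>vcls p []\<close> on the class of a loop
  p.\<close>

definition D :: "(real \<Rightarrow> 'x) set \<Rightarrow> 'x list set" where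
  "D A = vcls (SOME p. p \<in> loops x0 \<and> A = L p) []"

lemma loop_jloop: "p \<in> loops x0 \<Longrightarrow> jloop p []"
  by (simp add: jloop_def loops_simps rho_Nil)

lemma D_L:
  assumes "p \<in> loops x0"
  shows "D (L p) = vcls p []"
proof -
  have "\<exists>q. q \<in> loops x0 \<and> L p = L q" using assms by auto
  then have "(SOME q. q \<in> loops x0 \<and> L p = L q) \<in> loops x0 \<and> L p = L (SOME q. q \<in> loops x0 \<and> L p = L q)"
    by (rule someI_ex)
  then show ?thesis unfolding D_def using assms loop_jloop by (intro vcls_cong) auto
qed

lemma D_hom: "D \<in> hom FG \<P>"
proof (rule homI)
  fix A assume "A \<in> carrier FG"
  then show "D A \<in> carrier \<P>" by (elim L_carrierE) (simp add: D_L loop_jloop)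
next
  fix A B assume "A \<in> carrier FG" "B \<in> carrier FG"
  then obtain p q where p: "p \<in> loops x0" "A = L p" and q: "q \<in> loops x0" "B = L q" using L_carrierE by metis
  have "A \<cdot> B = L (p +++ q)" using p q by (simp add: L_join loops_simps)
  then show "D (A \<cdot> B) = D A \<otimes>\<^bsub>\<P>\<^esub> D B"
    using p q loops_join[OF p(1) q(1)] vcls_mult[OF loop_jloop[OF p(1)] loop_jloop[OF q(1)]] by (simp add: D_L)
qed

lemma discretize_loop:
  assumes p: "p \<in> loops x0"
  shows "discretize S \<rho> t (real \<theta>) x0 (path_class p) = vcls p []"
proof -
  have *: "theta_class \<delta> (real \<theta>) x0 (map q ts) = vcls p []" if "q \<in> path_class p" "sampling t (real \<theta>) q ts" for q ts
  proof -
    have h: "homotopic_paths UNIV p q" using that(1) by (simp add: path_class_def)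
    have q: "q \<in> loops x0"
      using p homotopic_paths_imp_path[OF h] homotopic_paths_imp_pathstart[OF h] homotopic_paths_imp_pathfinish[OF h]
      by (simp add: loops_simps)
    have "samples q (map q ts)" using that(2) by (auto simp: samples_def)
    from vcls_samples(2)[OF loop_jloop[OF q] this] have "cl (map q ts) = vcls q []" by simp
    also have "\<dots> = vcls p []" using L_homotopic[OF h] by (intro vcls_cong loop_jloop p q) simp
    finally show ?thesis .
  qed
  obtain ts where ts: "sampling t (real \<theta>) p ts"
    using samples_exists[of p] p by (auto simp: samples_def loops_simps)
  have pp: "p \<in> path_class p" using p by (simp add: path_class_self loops_simps)
  show ?thesis
  proof (intro equalityI subsetI)
    fix zs assume "zs \<in> discretize S \<rho> t (real \<theta>) x0 (path_class p)"
    then show "zs \<in> vcls p []" unfolding discretize_def using * by blast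
  next
    fix zs assume "zs \<in> vcls p []"
    then show "zs \<in> discretize S \<rho> t (real \<theta>) x0 (path_class p)" unfolding discretize_def using *[OF pp ts] pp ts by blast
  qed
qed

abbreviation "\<N> \<equiv> normal_closure \<P> {discretize S \<rho> t (real \<theta>) x0 (path_class (apath r)) | r. r \<in> R\<theta>}"

lemma R\<theta>_N\<theta>: "r \<in> R\<theta> \<Longrightarrow> r \<in> N\<theta>"
  using normal_closure_subset by (rule subsetD)

lemma N_normal: "\<N> \<lhd> \<P>"
proof (rule normal_closure_normal[OF group_discrete], rule subsetI, clarify)
  fix r assume "r \<in> R\<theta>"
  then have "apath r \<in> loops x0" by (intro apath_relator_loop R\<theta>_N\<theta>)
  then show "discretize S \<rho> t (real \<theta>) x0 (path_class (apath r)) \<in> carrier \<P>"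
    by (simp add: discretize_loop loop_jloop)
qed

text \<open>The jumps of r contract, so that only the loop \<alpha>_r is left: on relators the lift
  of words and the discretization of loops agree.\<close>

lemma U_relator:
  assumes "r \<in> N\<theta>"
  shows "U r = vcls (apath r) []"
proof -
  have r: "r \<in> words" "jumps r x0 \<simeq> [x0]" using N\<theta>_T assms by (auto simp: T_def)
  note j = apath_jloop[OF r(1)] loop_jloop[OF apath_relator_loop[OF assms]]
  obtain us where us: "samples (apath r) us" using jloop_samples[OF j(1)] by auto
  have "us @ tl (jumps r x0) \<simeq> us @ tl (jumps [] x0)"
    by (rule heq_join[OF heq_refl]) (use r samples_ne[OF us] samples_imp(3)[OF us] in simp_all)
  then show ?thesis
    unfolding U_def using vcls_samples[OF j(1) us] vcls_samples[OF j(2) us]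
      theta_class_eq_iff[OF vcls_samples(1)[OF j(1) us] vcls_samples(1)[OF j(2) us]] by simp
qed

text \<open>Unlike the path \<alpha>_w, which is a loop only when w fixes the base point,
  \<open>U\<close> is a homomorphism on all of \<open>F\<close>. This makes the step from
  \<open>R\<theta>\<close> to its normal closure possible.\<close>

lemma U_in_N: "r \<in> N\<theta> \<Longrightarrow> U r \<in> \<N>"
proof -
  have "N\<theta> \<subseteq> {w \<in> carrier F. U w \<in> \<N>}"
  proof (rule normal_closure_least)
    show "{w \<in> carrier F. U w \<in> \<N>} \<lhd> F"
      by (rule hom_vimage_normal[OF group_free_group group_discrete U_hom N_normal])
    show "R\<theta> \<subseteq> {w \<in> carrier F. U w \<in> \<N>}"
    proof
      fix r assume r: "r \<in> R\<theta>"
      have "U r = discretize S \<rho> t (real \<theta>) x0 (path_class (apath r))"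
        using R\<theta>_N\<theta>[OF r] by (simp add: U_relator discretize_loop apath_relator_loop)
      also have "\<dots> \<in> \<N>" by (rule subsetD[OF normal_closure_subset]) (use r in blast)
      finally show "r \<in> {w \<in> carrier F. U w \<in> \<N>}" using r by (simp add: R\<theta>_iff)
    qed
  qed
  then show "r \<in> N\<theta> \<Longrightarrow> U r \<in> \<N>" by auto
qed

lemma D_in_N: "A \<in> M \<Longrightarrow> D A \<in> \<N>"
proof -
  have "M \<subseteq> {A \<in> carrier FG. D A \<in> \<N>}"
  proof (rule M_least)
    show "{A \<in> carrier FG. D A \<in> \<N>} \<lhd> FG"
      by (rule hom_vimage_normal[OF group_fundamental_group group_discrete D_hom N_normal])
    fix r assume r: "r \<in> N\<theta>"
    note a = apath_relator_loop[OF r]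
    then show "L (apath r) \<in> {A \<in> carrier FG. D A \<in> \<N>}"
      using U_in_N[OF r] by (simp add: D_L U_relator[OF r] loops_simps)
  qed
  then show "A \<in> M \<Longrightarrow> D A \<in> \<N>" by auto
qed

text \<open>The pair (c, w) is the product of the loop c followed by the reverse of \<alpha>_w with
  the lift \<open>U w\<close>. A trivial label puts the class of that loop in \<open>M\<close> and
  the reduced word in \<open>N\<theta>\<close>, so both factors lie in the normal closure.\<close>

lemma vcls_kernel:
  assumes j: "jloop c w" and k: "\<kappa> c w x0 = \<one>\<^bsub>H\<^esub>"
  shows "vcls c w \<in> \<N>"
proof -
  interpret N: normal \<N> \<P> by (rule N_normal)
  have w: "w \<in> words" "path c" using j by (simp_all add: jloop_def)
  have km: "L c \<cdot> inv\<^bsub>FG\<^esub> L (apath w) \<in> M" "normal_form w \<in> N\<theta>"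
    using k kappa_one_iff[OF w(2,1)] by simp_all
  define p where "p = c +++ reversepath (apath w)"
  have p: "p \<in> loops x0" using j by (simp add: p_def loops_simps jloop_def)
  have Lp: "L p = L c \<cdot> inv\<^bsub>FG\<^esub> L (apath w)"
    using j by (simp add: p_def L_join L_reversepath jloop_def)
  have "D (L p) \<otimes>\<^bsub>\<P>\<^esub> U (normal_form w) \<in> \<N>"
    using D_in_N km U_in_N Lp by (intro N.m_closed) auto
  moreover have "D (L p) \<otimes>\<^bsub>\<P>\<^esub> U (normal_form w) = vcls (p +++ (\<rho> [] \<circ> apath w)) ([] @ w)"
    unfolding U_normal_form[OF w(1)] D_L[OF p] unfolding U_def
    by (rule vcls_mult[OF loop_jloop[OF p] apath_jloop[OF w(1)]])
  moreover have "\<dots> = vcls c ([] @ w)"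
  proof (rule vcls_cong[OF jloop_mult[OF loop_jloop[OF p] apath_jloop[OF w(1)]]])
    show "L (p +++ (\<rho> [] \<circ> apath w)) = L c"
      using w p by (simp add: L_join loops_simps Lp pi.m_assoc)
  qed (use j in simp)
  ultimately show ?thesis by simp
qed

section \<open>The epimorphism, its kernel and exactness\<close>

definition \<Phi> :: "'x list set \<Rightarrow> (real \<Rightarrow> 'x) set set \<times> 's letter list set" where
  "\<Phi> C = lam (SOME zs. zs \<in> C)"

lemma Phi_cl:
  assumes "zs \<in> \<LL>"
  shows "\<Phi> (cl zs) = lam zs"
proof -
  have "zs \<in> cl zs" using assms by (simp add: theta_class_eq)
  then have "(SOME zs'. zs' \<in> cl zs) \<in> cl zs" by (rule someI)
  then have "zs \<simeq> (SOME zs'. zs' \<in> cl zs)" using assms by (simp add: theta_class_eq)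
  then show ?thesis unfolding \<Phi>_def using lam_heq assms by (simp add: theta_loops_def)
qed

lemma Phi_vcls: "jloop c w \<Longrightarrow> \<Phi> (vcls c w) = \<kappa> c w x0"
proof -
  assume j: "jloop c w"
  obtain us where us: "samples c us" using jloop_samples[OF j] by auto
  show ?thesis
    using vcls_samples[OF j us] Phi_cl lam_rep[OF rep_self[OF j us]] by simp
qed

lemma vclsE:
  assumes "C \<in> carrier \<P>"
  obtains c w where "jloop c w" "C = vcls c w"
proof -
  obtain zs where zs: "zs \<in> \<LL>" "C = cl zs" using assms by (auto simp: discrete_carrier)
  then have z: "tpath zs" "hd zs = x0" "last zs = x0" by (auto simp: theta_loops_def)
  obtain q w where "pathstart q = x0" "rep zs q w x0" using rep_exists[OF z(1)] z by auto
  with rep_vcls[of zs q w] zs that show ?thesis by simp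
qed

lemma Phi_epi: "\<Phi> \<in> epi \<P> H"
  unfolding epi_iff_subset
proof (intro conjI homI subsetI)
  fix C assume "C \<in> carrier \<P>"
  then show "\<Phi> C \<in> carrier H" by (elim vclsE) (simp add: Phi_vcls jloop_def)
next
  fix B C assume "B \<in> carrier \<P>" "C \<in> carrier \<P>"
  then obtain c w c' w' where *: "jloop c w" "B = vcls c w" "jloop c' w'" "C = vcls c' w'" using vclsE by metis
  then show "\<Phi> (B \<otimes>\<^bsub>\<P>\<^esub> C) = \<Phi> B \<otimes>\<^bsub>H\<^esub> \<Phi> C"
    using jloop_mult[OF *(1,3)] kappa_mult[of c w x0 c' w' x0] by (simp add: vcls_mult Phi_vcls jloop_def)
next
  fix h assume "h \<in> carrier H"
  then obtain c w where c: "path c" "pathstart c = x0" "pathfinish c = \<rho> w x0" "w \<in> words" "\<kappa> c w x0 = h"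
    by (rule kappa_surj)
  then have j: "jloop c w" by (simp add: jloop_def)
  have "h = \<Phi> (vcls c w)" using c(5) Phi_vcls[OF j] by simp
  then show "h \<in> \<Phi> ` carrier \<P>" using vcls_closed[OF j] by (rule image_eqI)
qed

lemma Phi_kernel: "kernel \<P> H \<Phi> = \<N>"
proof
  show "kernel \<P> H \<Phi> \<subseteq> \<N>"
  proof
    fix C assume "C \<in> kernel \<P> H \<Phi>"
    then have C: "C \<in> carrier \<P>" "\<Phi> C = \<one>\<^bsub>H\<^esub>" by (simp_all add: kernel_def)
    obtain c w where c: "jloop c w" "C = vcls c w" using C(1) by (rule vclsE)
    then show "C \<in> \<N>" using vcls_kernel[OF c(1)] C(2) Phi_vcls[OF c(1)] by simp
  qed
  interpret h: group_hom \<P> H \<Phi>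
    using Phi_epi group_discrete group_H by (simp add: group_hom_def group_hom_axioms_def epi_def)
  show "\<N> \<subseteq> kernel \<P> H \<Phi>"
  proof (rule normal_closure_least[OF h.normal_kernel], rule subsetI, clarify)
    fix r assume "r \<in> R\<theta>"
    then have r: "r \<in> N\<theta>" by (rule R\<theta>_N\<theta>)
    note a = apath_relator_loop[OF r]
    \<comment> \<open>The discretized loop \<alpha>_r carries the empty word, so its label is the
      coset of [\<alpha>_r] paired with the identity, and that coset is \<open>M\<close>.\<close>
    have "L (apath r) \<cdot> inv\<^bsub>FG\<^esub> L (apath []) \<in> M" "normal_form [] \<in> N\<theta>"
      using apath_in_M[OF r] a N\<theta>.one_closed by (simp_all add: loops_simps free_group_simps)
    then have "\<kappa> (apath r) [] x0 = \<one>\<^bsub>H\<^esub>" using kappa_one_iff[of "apath r" "[]"] a by (simp add: loops_simps)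
    then show "discretize S \<rho> t (real \<theta>) x0 (path_class (apath r)) \<in> kernel \<P> H \<Phi>"
      using Phi_vcls[OF loop_jloop[OF a]] loop_jloop[OF a] by (simp add: discretize_loop[OF a] kernel_def)
  qed
qed

lemma exact: "short_exact (\<P>\<lparr>carrier := \<N>\<rparr>) id \<P> \<Phi> H"
proof -
  interpret N: normal \<N> \<P> by (rule N_normal)
  have "id \<in> mon (\<P>\<lparr>carrier := \<N>\<rparr>) \<P>"
    using N.subset by (auto simp: mon_def hom_def)
  then show ?thesis
    unfolding short_exact_def
    using N.subgroup_is_group[OF group_discrete] group_discrete group_H Phi_epi Phi_kernel by simp
qed

end

theorem corollary7p4:
  fixes x0 :: "'x::metric_space"
    and \<Gamma> :: "'g monoid" and act :: "'g \<Rightarrow> 'x \<Rightarrow> 'x"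
    and S :: "'s set" and \<eta> :: "'s \<Rightarrow> 'g" and R :: "'s letter list set"
    and \<rho> :: "'s letter list \<Rightarrow> 'x \<Rightarrow> 'x"
    and \<alpha> :: "'s \<Rightarrow> real \<Rightarrow> 'x" and \<theta> :: nat
  assumes "compact (UNIV :: 'x set)"
    and "path_connected (UNIV :: 'x set)"
    and "locally path_connected (UNIV :: 'x set)"
    and "semilocally_simply_connected (UNIV :: 'x set)"
    and "homotopy_rectifiable (UNIV :: 'x set)"
    and "finite S" and "presentation \<Gamma> S \<eta> R"
    and "group_action \<Gamma> UNIV act"
    and "\<And>g. g \<in> carrier \<Gamma> \<Longrightarrow> \<exists>h. homeomorphism UNIV UNIV (act g) h"
    and "\<And>g x. g \<in> carrier \<Gamma> \<Longrightarrow> act g x = x \<Longrightarrow> g = \<one>\<^bsub>\<Gamma>\<^esub>"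
    and "\<rho> = free_action \<Gamma> \<eta> act"
    and "jumping_geodesic S \<rho>"
    and "\<And>s. s \<in> S \<Longrightarrow> path (\<alpha> s) \<and> pathstart (\<alpha> s) = x0 \<and> pathfinish (\<alpha> s) = \<rho> [(s, True)] x0"
    and "1 \<le> \<theta>"
  shows "\<forall>\<^sub>F t in at_top.
    let P = discrete_fundamental_group (warped_metric S \<rho> t) (real \<theta>) x0;
        N = normal_closure P
              {discretize S \<rho> t (real \<theta>) x0 (path_class (word_path \<rho> \<alpha> x0 r)) | r.
                 r \<in> short_relators S R \<theta>}
    in \<exists>\<Phi>. short_exact (P\<lparr>carrier := N\<rparr>) id P \<Phi>
             (semidirect_product (G_theta S R \<rho> \<alpha> x0 \<theta>) (Gamma_theta S R \<theta>) (phi_bar \<rho> \<alpha> x0))"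
proof -
  have "\<exists>p. path p \<and> pathstart p = x0 \<and> pathfinish p = x" for x
    using assms(2) unfolding path_connected_def by auto
  then obtain \<beta>' where \<beta>': "\<And>x. path (\<beta>' x) \<and> pathstart (\<beta>' x) = x0 \<and> pathfinish (\<beta>' x) = x" by metis
  \<comment> \<open>With the constant path at the base point, \<open>L\<close> agrees on loops with
    the plain homotopy class.\<close>
  define \<beta> where "\<beta> = \<beta>'(x0 := (\<lambda>_. x0))"
  have b: "based_paths x0 \<beta>" by unfold_locales (auto simp: \<beta>_def \<beta>')
  have "warped_action x0 \<beta> \<Gamma> act S \<eta> R \<rho> \<alpha> \<theta>"
    by (rule warped_action.intro[OF b], rule warped_action_axioms.intro)
      (use assms in \<open>simp_all add: jumping_geodesic_def\<close>)
  then interpret warped_action x0 \<beta> \<Gamma> act S \<eta> R \<rho> \<alpha> \<theta> .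
  \<comment> \<open>Both e and \<open>d0\<close> come from compactness and are fixed before
    t.\<close>
  obtain e where e: "0 < e" "coherent e" using coherent_exists by auto
  have "0 < e / (real \<theta> + 1)" using e(1) by (simp add: add_nonneg_pos)
  then obtain d0 where d0: "0 < d0"
    "\<And>w a b. w \<in> words \<Longrightarrow> length w \<le> \<theta> \<Longrightarrow> dist a b < d0 \<Longrightarrow> dist (\<rho> w a) (\<rho> w b) < e / (real \<theta> + 1)"
    using words_equicontinuous[of "e / (real \<theta> + 1)" \<theta>] by blast
  show ?thesis
    unfolding eventually_at_top_linorder Let_def
  proof (intro exI allI impI)
    \<comment> \<open>The bound 1 makes t positive; the other bound is the condition on t in
      \<open>edge_rep\<close>.\<close>
    fix t assume t: "max 1 ((real \<theta> + 1) / d0) \<le> t"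
    then have t': "0 < t" "real \<theta> + 1 \<le> t * d0" using d0(1) by (auto simp: pos_divide_le_eq)
    have wl: "warped_level x0 \<beta> \<Gamma> act S \<eta> R \<rho> \<alpha> \<theta> t"
      by (intro warped_level.intro warped_level_axioms.intro warped_action_axioms t'(1))
    interpret coherent_level x0 \<beta> \<Gamma> act S \<eta> R \<rho> \<alpha> \<theta> t e
    proof (rule coherent_level.intro[OF wl], rule coherent_level_axioms.intro)
      interpret warped_level x0 \<beta> \<Gamma> act S \<eta> R \<rho> \<alpha> \<theta> t by (rule wl)
      show "coherent e" "0 < e" using e by auto
      show "\<exists>q w. edge e x y q w \<and> rep [x, y] q w y" if "warped_metric S \<rho> t x y \<le> real \<theta>" for x y
        using d0(2) t'(2) e(1) that by (rule edge_rep)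
    qed
    show "short_exact (discrete_fundamental_group (warped_metric S \<rho> t) (real \<theta>) x0
         \<lparr>carrier := normal_closure (discrete_fundamental_group (warped_metric S \<rho> t) (real \<theta>) x0)
              {discretize S \<rho> t (real \<theta>) x0 (path_class (word_path \<rho> \<alpha> x0 r)) | r.
                 r \<in> short_relators S R \<theta>}\<rparr>) id
         (discrete_fundamental_group (warped_metric S \<rho> t) (real \<theta>) x0) \<Phi>
         (semidirect_product (G_theta S R \<rho> \<alpha> x0 \<theta>) (Gamma_theta S R \<theta>) (phi_bar \<rho> \<alpha> x0))"
      by (rule exact)
  qed
qed

end
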